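(* Let $f_1,\dots,f_m$ be rational linear forms on $\mathbb{R}^d$ such that every variable appears in at least one form and the system $f_1(x)=\cdots=f_m(x)=1$ is consistent; let $s$ be its solution space and $P:=s\cap\mathbb{R}^d_{\ge0}$. For $t=1,2,\ldots$ let $A^\circ(t)$ be the number of integer points $x\in tP$ with distinct positive entries, and $A(t)$ the number of pairs $(x,\sigma)$ consisting of a nonnegative integer point $x\in tP$ and a permutation $\sigma$ of $[d]$ compatible with $x$ and realizable in $P^\circ$. Suppose $P$ is bounded and does not lie within a coordinate hyperplane. Then $A^\circ$ and $A$ are quasipolynomials with leading term $(\operatorname{vol}P)\,t^{\dim s}$, with constant term $A(0)$ equal to the number of permutations of $[d]$ realizable in $P^\circ$, and $(-1)^{\dim s}A^\circ(-t)=A(t)$.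
   Context: $P^\circ$ is the relative interior of $P$. A quasipolynomial is a function $\sum_i c_i(t)t^i$ with periodic coefficients; values at $-t$ and $0$ refer to the quasipolynomials. $\operatorname{vol}P$ is normalized relative to the lattice $\mathbb{Z}^d\cap\operatorname{aff}P$. A point $x$ with distinct coordinates realizes the permutation $\tau$ of $[d]$ if $x_{\tau1}<\cdots<x_{\tau d}$; $\tau$ is realizable in $A$ if some $x\in A$ realizes it. $x$ and $\sigma$ are compatible if $x_{\sigma1}\le\cdots\le x_{\sigma d}$.
   Formalization: The leading-term claim assumes that P lies in no hyperplane x_i = x_j (otherwise both counts vanish), and if aff P has no integer point the leading coefficient is vol P only for those t for which ts contains an integer point, and 0 for other t. *)

theory Defs
  imports "HOL-Analysis.Analysis" "HOL-Combinatorics.Permutations"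
begin

text \<open>
  \<open>\<real>\<^sup>d\<close> is \<^typ>\<open>real ^ 'n\<close>, where the finite linear order \<^typ>\<open>'n\<close> plays the role of
  \<open>[d]\<close>: the order is what makes \<open>x\<^bsub>\<tau>1\<^esub> < \<dots> < x\<^bsub>\<tau>d\<^esub>\<close> meaningful.
\<close>

definition rational_linear_form :: "(real ^ 'n \<Rightarrow> real) \<Rightarrow> bool" where
  "rational_linear_form g \<longleftrightarrow> linear g \<and> (\<forall>j. g (axis j 1) \<in> \<rat>)"

definition appears_in :: "'n \<Rightarrow> (real ^ 'n \<Rightarrow> real) \<Rightarrow> bool" where
  "appears_in j g \<longleftrightarrow> g (axis j 1) \<noteq> 0"

definition integer_points :: "(real ^ 'n) set" where
  "integer_points = {x. \<forall>j. x $ j \<in> \<int>}"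

definition dilate :: "real \<Rightarrow> (real ^ 'n) set \<Rightarrow> (real ^ 'n) set" where
  "dilate t S = (\<lambda>x. t *\<^sub>R x) ` S"

definition realizes :: "real ^ 'n::{finite,linorder} \<Rightarrow> ('n \<Rightarrow> 'n) \<Rightarrow> bool" where
  "realizes x \<tau> \<longleftrightarrow> strict_mono (\<lambda>i. x $ \<tau> i)"

definition realizable_in :: "('n \<Rightarrow> 'n) \<Rightarrow> (real ^ 'n::{finite,linorder}) set \<Rightarrow> bool" where
  "realizable_in \<tau> S \<longleftrightarrow> (\<exists>x\<in>S. realizes x \<tau>)"

definition compatible :: "real ^ 'n::{finite,linorder} \<Rightarrow> ('n \<Rightarrow> 'n) \<Rightarrow> bool" where
  "compatible x \<sigma> \<longleftrightarrow> mono (\<lambda>i. x $ \<sigma> i)"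

definition A_open :: "(real ^ 'n) set \<Rightarrow> nat \<Rightarrow> nat" where
  "A_open P t = card {x \<in> integer_points \<inter> dilate (real t) P.
     (\<forall>j. 0 < x $ j) \<and> inj (\<lambda>j. x $ j)}"

definition A_closed :: "(real ^ 'n::{finite,linorder}) set \<Rightarrow> nat \<Rightarrow> nat" where
  "A_closed P t = card {(x, \<sigma>). x \<in> integer_points \<inter> dilate (real t) P \<and> (\<forall>j. 0 \<le> x $ j) \<and>
     \<sigma> permutes UNIV \<and> compatible x \<sigma> \<and> realizable_in \<sigma> (rel_interior P)}"

definition periodic :: "(int \<Rightarrow> real) \<Rightarrow> bool" where
  "periodic c \<longleftrightarrow> (\<exists>p>0. \<forall>t. c (t + p) = c t)"

definition quasipolynomial :: "(int \<Rightarrow> real) \<Rightarrow> bool" where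
  "quasipolynomial q \<longleftrightarrow> (\<exists>n c. (\<forall>i\<le>n. periodic (c i)) \<and>
     (\<forall>t. q t = (\<Sum>i\<le>n. c i t * of_int t ^ i)))"

text \<open>
  The leading coefficient of a quasipolynomial is itself a periodic function; \<open>L\<close> is that
  function. Coefficient functions are determined by the quasipolynomial.
\<close>

definition has_leading_term :: "(int \<Rightarrow> real) \<Rightarrow> (int \<Rightarrow> real) \<Rightarrow> nat \<Rightarrow> bool" where
  "has_leading_term q L n \<longleftrightarrow> (\<exists>c. (\<forall>i\<le>n. periodic (c i)) \<and>
     (\<forall>t. q t = (\<Sum>i\<le>n. c i t * of_int t ^ i)) \<and> c n = L)"

text \<open>
  The translation lattice of \<open>\<int>\<^sup>d \<inter> aff P\<close>, which also makes sense when
  \<open>\<int>\<^sup>d \<inter> aff P\<close> is empty (then it is the translation lattice of \<open>\<int>\<^sup>d \<inter> aff (tP)\<close>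
  for every \<open>t \<ge> 1\<close> for which that set is nonempty).
\<close>

definition direction_lattice :: "(real ^ 'n) set \<Rightarrow> (real ^ 'n) set" where
  "direction_lattice P =
     integer_points \<inter> {x - y | x y. x \<in> affine hull P \<and> y \<in> affine hull P}"

definition lattice_basis :: "(real ^ 'n) set \<Rightarrow> (real ^ 'n) set \<Rightarrow> bool" where
  "lattice_basis B \<Lambda> \<longleftrightarrow> independent B \<and>
     \<Lambda> = range (\<lambda>z :: real ^ 'n \<Rightarrow> int. \<Sum>b\<in>B. of_int (z b) *\<^sub>R b)"

text \<open>
  Volume in the affine coordinates \<open>p + (\<Sum>b\<in>B. u b *\<^sub>R b)\<close>, in which a fundamental
  domain of the lattice is a unit cube. For a rational polytope a lattice basis \<open>B\<close> exists,
  and by unimodularity and translation invariance the value depends on neither \<open>B\<close> nor \<open>p\<close>.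
  A single point has volume 1.
\<close>

definition coordinate_volume ::
    "(real ^ 'n) set \<Rightarrow> real ^ 'n \<Rightarrow> (real ^ 'n) set \<Rightarrow> real" where
  "coordinate_volume B p P = measure (Pi\<^sub>M B (\<lambda>_. lborel))
     {u \<in> B \<rightarrow>\<^sub>E UNIV. p + (\<Sum>b\<in>B. u b *\<^sub>R b) \<in> P}"

definition vol :: "(real ^ 'n) set \<Rightarrow> real" where
  "vol P = coordinate_volume (SOME B. lattice_basis B (direction_lattice P))
     (SOME p. p \<in> affine hull P) P"

end

theory Submission
  imports Defs
begin

text \<open>
  The points counted by \<open>A_closed\<close> and \<open>A_open\<close> are split by the permutations \<open>\<sigma>\<close> that sort their
  coordinates. Passing from \<open>f\<^sub>1(x) = \<dots> = f\<^sub>m(x) = t\<close> to the linear space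
  \<open>W = {f\<^sub>1 = \<dots> = f\<^sub>m}\<close> with height \<open>f\<^sub>1\<close>, the points belonging to \<open>\<sigma>\<close> are the integer points of height \<open>t\<close>
  in a pointed rational cone of \<open>W\<close>, respectively in its interior, so that everything
  reduces to reciprocity for such cones.

  Let \<open>w\<close> be an interior point of the cone satisfying no rational linear relation beyond those of \<open>W\<close>.
  A point \<open>x\<close> lies in the closed cone iff \<open>x + \<epsilon> w\<close> lies in the cone for small \<open>\<epsilon> > 0\<close>,
  and in the open cone iff \<open>x - \<epsilon> w\<close> does. A triangulation therefore induces two partitions
  into half-open simplicial cones, one of the closed cone and one of the open cone, in which
  corresponding pieces have complementary facets removed. For a half-open simplicial cone the count is an explicit
  sum of binomial coefficients over the integer points of a half-open parallelepiped, and a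
  point reflection of the parallelepiped gives the reciprocity. The leading coefficient is a limit of
  Riemann sums.
\<close>

section \<open>Quasipolynomials\<close>

text \<open>One triangulation has to serve the closed and the open cone at once. Deciding boundary
  membership by the sign \<open>e\<close> of a displacement \<open>e *\<^sub>R w\<close> achieves
  this without inclusion-exclusion over faces, provided \<open>w\<close> has no zero coordinate in
  any simplex that occurs. All generators are rational, so it is enough that \<open>w\<close> has no
  accidental rational relation. Projection to a facet along a rational ray preserves this property;
  hence the recursion carries only \<open>w\<close>, and the ambient space is read off as
  \<open>relation_space w\<close>.

  The formula for the closed cone is valid already at t = 0, and this gives the constant term. The
  leading coefficient is computed for the open count only and carried to the closed one by
  reciprocity. It is a periodic function, because a dilate of the affine hull of P may miss the
  integer lattice, and it requires that P lie in no hyperplane x_i = x_j: inside such a hyperplane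
  no permutation is realizable and both counts vanish.\<close>

definition quasipoly_le :: "nat \<Rightarrow> (int \<Rightarrow> real) \<Rightarrow> bool" where
  "quasipoly_le n q \<longleftrightarrow> (\<exists>c. (\<forall>i\<le>n. periodic (c i)) \<and>
     (\<forall>t. q t = (\<Sum>i\<le>n. c i t * of_int t ^ i)))"

lemma quasipolynomial_iff: "quasipolynomial q \<longleftrightarrow> (\<exists>n. quasipoly_le n q)"
  by (auto simp: quasipolynomial_def quasipoly_le_def)

lemma periodic_mult_period:
  fixes c :: "int \<Rightarrow> real"
  assumes "\<forall>t. c (t + p) = c t"
  shows "c (t + p * k) = c t"
proof (induction k rule: int_induct[where k = 0])
  case (step1 i)
  have "c (t + p * (i + 1)) = c ((t + p * i) + p)" by (simp add: algebra_simps)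
  then show ?case using assms step1 by simp
next
  case (step2 i)
  have "c (t + p * (i - 1)) = c ((t + p * (i - 1)) + p)" using assms by simp
  also have "\<dots> = c (t + p * i)" by (simp add: algebra_simps)
  finally show ?case using step2 by simp
qed auto

lemma periodic_const [simp]: "periodic (\<lambda>_. a)"
  unfolding periodic_def by (intro exI[of _ 1]) auto

lemma periodic_combine:
  assumes "periodic c" "periodic d"
  shows "periodic (\<lambda>t. F (c t) (d t))"
proof -
  obtain p q where p: "p > 0" "\<forall>t. c (t + p) = c t" and q: "q > 0" "\<forall>t. d (t + q) = d t"
    using assms unfolding periodic_def by blast
  have "c (t + p * q) = c t" "d (t + p * q) = d t" for t
    using periodic_mult_period[OF p(2), of t q] periodic_mult_period[OF q(2), of t p]
    by (simp_all add: mult.commute)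
  then show ?thesis
    unfolding periodic_def using p(1) q(1) by (intro exI[of _ "p * q"]) auto
qed

lemma periodic_reflect: "periodic c \<Longrightarrow> periodic (\<lambda>t. c (- t))"
proof -
  assume "periodic c"
  then obtain p where p: "p > 0" "\<forall>t. c (t + p) = c t" unfolding periodic_def by blast
  have "c (- (t + p)) = c (- t)" for t
    using spec[OF p(2), of "- (t + p)"] by simp
  then show ?thesis unfolding periodic_def using p(1) by auto
qed

lemma quasipoly_le_periodic: "periodic c \<Longrightarrow> quasipoly_le 0 c"
  unfolding quasipoly_le_def by (intro exI[of _ "\<lambda>_. c"]) auto

lemma quasipoly_le_zero: "quasipoly_le n (\<lambda>_. 0)"
  unfolding quasipoly_le_def by (intro exI[of _ "\<lambda>_ _. 0"]) auto

lemma quasipoly_le_add: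
  assumes "quasipoly_le n q" "quasipoly_le n r"
  shows "quasipoly_le n (\<lambda>t. q t + r t)"
proof -
  obtain c where c: "\<forall>i\<le>n. periodic (c i)" "\<forall>t. q t = (\<Sum>i\<le>n. c i t * of_int t ^ i)"
    using assms(1) unfolding quasipoly_le_def by blast
  obtain d where d: "\<forall>i\<le>n. periodic (d i)" "\<forall>t. r t = (\<Sum>i\<le>n. d i t * of_int t ^ i)"
    using assms(2) unfolding quasipoly_le_def by blast
  show ?thesis
    unfolding quasipoly_le_def using c d
    by (intro exI[of _ "\<lambda>i t. c i t + d i t"])
       (auto simp: sum.distrib ring_distribs intro!: periodic_combine[of _ _ "(+)"])
qed

lemma quasipoly_le_sum:
  assumes "\<And>i. i \<in> I \<Longrightarrow> quasipoly_le n (q i)"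
  shows "quasipoly_le n (\<lambda>t. \<Sum>i\<in>I. q i t)"
  using assms
  by (induction I rule: infinite_finite_induct) (auto simp: quasipoly_le_zero quasipoly_le_add)

lemma quasipoly_le_mult_linear:
  assumes "quasipoly_le n q"
  shows "quasipoly_le (Suc n) (\<lambda>t. q t * (a * of_int t + b))"
proof -
  obtain c where c: "\<forall>i\<le>n. periodic (c i)" "\<forall>t. q t = (\<Sum>i\<le>n. c i t * of_int t ^ i)"
    using assms unfolding quasipoly_le_def by blast
  \<comment> \<open>Zero padding at index \<open>Suc n\<close> lets the coefficients and their shift
    be added over one index range.\<close>
  define c' where "c' i = (if i \<le> n then c i else (\<lambda>_. 0))" for i
  have per: "periodic (c' i)" for i using c(1) by (simp add: c'_def)
  define d where "d i t = b * c' i t + a * (case i of 0 \<Rightarrow> 0 | Suc j \<Rightarrow> c' j t)" for i t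
  have "periodic (d i)" for i
  proof -
    have "periodic (case i of 0 \<Rightarrow> (\<lambda>_. 0) | Suc j \<Rightarrow> c' j)"
      using per by (cases i) auto
    from periodic_combine[OF per this, of "\<lambda>x y. b * x + a * y" i] show ?thesis
      unfolding d_def[abs_def] by (cases i) auto
  qed
  moreover have "q t * (a * of_int t + b) = (\<Sum>i\<le>Suc n. d i t * of_int t ^ i)" for t
  proof -
    have qn: "q t = (\<Sum>i\<le>n. c' i t * of_int t ^ i)" using c(2) by (simp add: c'_def)
    then have qn': "q t = (\<Sum>i\<le>Suc n. c' i t * of_int t ^ i)" by (simp add: c'_def)
    have "(\<Sum>i\<le>Suc n. d i t * of_int t ^ i) = b * (\<Sum>i\<le>Suc n. c' i t * of_int t ^ i)
       + a * (\<Sum>i\<le>Suc n. (case i of 0 \<Rightarrow> 0 | Suc j \<Rightarrow> c' j t) * of_int t ^ i)"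
      by (simp add: d_def ring_distribs sum.distrib sum_distrib_left mult.assoc del: sum.atMost_Suc)
    also have "(\<Sum>i\<le>Suc n. (case i of 0 \<Rightarrow> 0 | Suc j \<Rightarrow> c' j t) * of_int t ^ i)
       = of_int t * (\<Sum>i\<le>n. c' i t * of_int t ^ i)"
      by (subst sum.atMost_Suc_shift) (simp add: sum_distrib_left mult_ac)
    finally show ?thesis using qn qn' by (simp add: algebra_simps)
  qed
  ultimately show ?thesis unfolding quasipoly_le_def by blast
qed

lemma quasipoly_le_mult_prod_linear:
  assumes "periodic c"
  shows "quasipoly_le n (\<lambda>t. c t * (\<Prod>i<n. a i * of_int t + b i))"
proof (induction n)
  case 0
  then show ?case using quasipoly_le_periodic[OF assms] by simp
next
  case (Suc n)
  from quasipoly_le_mult_linear[OF this, of "a n" "b n"] show ?case by (simp add: mult.assoc)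
qed

lemma quasipoly_le_cmult_reflect:
  assumes "quasipoly_le n q"
  shows "quasipoly_le n (\<lambda>t. a * q (- t))"
proof -
  obtain c where c: "\<forall>i\<le>n. periodic (c i)" "\<forall>t. q t = (\<Sum>i\<le>n. c i t * of_int t ^ i)"
    using assms unfolding quasipoly_le_def by blast
  have 1: "periodic (\<lambda>t. a * (-1) ^ i * c i (- t))" if "i \<le> n" for i
    using that c(1) periodic_combine[OF periodic_reflect periodic_const[of 0],
      of "c i" "\<lambda>x y. a * (-1) ^ i * x"] by simp
  have 2: "a * q (- t) = (\<Sum>i\<le>n. (a * (-1) ^ i * c i (- t)) * of_int t ^ i)" for t
    by (simp add: c(2) sum_distrib_left power_minus[of "of_int t"] mult_ac)
  show ?thesis unfolding quasipoly_le_def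
    using 1 2 by (intro exI[of _ "\<lambda>i t. a * (-1) ^ i * c i (- t)"]) auto
qed

text \<open>At the top index the outer sign cancels the sign of \<open>(- t) ^ n\<close>, so an even
  \<open>L\<close> survives. This carries the leading term from the open to the closed
  count.\<close>

lemma has_leading_term_reflect:
  assumes "has_leading_term q L n" and "\<And>t. L (- t) = L t"
  shows "has_leading_term (\<lambda>t. (-1) ^ n * q (- t)) L n"
proof -
  obtain c where c: "\<forall>i\<le>n. periodic (c i)" "\<forall>t. q t = (\<Sum>i\<le>n. c i t * of_int t ^ i)" "c n = L"
    using assms(1) unfolding has_leading_term_def by blast
  have 1: "periodic (\<lambda>t. (-1) ^ n * (-1) ^ i * c i (- t))" if "i \<le> n" for i
    using that c(1) periodic_combine[OF periodic_reflect periodic_const[of 0],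
      of "c i" "\<lambda>x y. (-1) ^ n * (-1) ^ i * x"] by simp
  have 2: "(-1) ^ n * q (- t) = (\<Sum>i\<le>n. ((-1) ^ n * (-1) ^ i * c i (- t)) * of_int t ^ i)" for t
    by (simp add: c(2) sum_distrib_left power_minus[of "of_int t"] mult_ac)
  have 3: "(\<lambda>t. (-1) ^ n * (-1) ^ n * c n (- t)) = L"
    using assms(2) c(3) by (auto simp: fun_eq_iff simp flip: power_mult_distrib)
  show ?thesis unfolding has_leading_term_def
    using 1 2 3 by (intro exI[of _ "\<lambda>i t. (-1) ^ n * (-1) ^ i * c i (- t)"]) auto
qed

text \<open>Along a progression whose step is a multiple of all periods the coefficients are
  constant, and division by the n-th power leaves only the top one. The periods are hidden inside
  \<open>quasipoly_le\<close>, so the limit is demanded for every factor \<open>r\<close>;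
  \<open>M\<close> is left to the caller, who may want steps of a special kind.\<close>

lemma has_leading_termI:
  fixes q :: "int \<Rightarrow> real"
  assumes q: "quasipoly_le n q" and M: "M > 0"
    and lim: "\<And>t r. r > 0 \<Longrightarrow>
      (\<lambda>k. q (t + M * r * int k) / of_int (t + M * r * int k) ^ n) \<longlonglongrightarrow> L t"
  shows "has_leading_term q L n"
proof -
  obtain c where c: "\<forall>i\<le>n. periodic (c i)" "\<forall>t. q t = (\<Sum>i\<le>n. c i t * of_int t ^ i)"
    using q unfolding quasipoly_le_def by blast
  obtain p where p: "p i > 0" "\<forall>t. c i (t + p i) = c i t" if "i \<le> n" for i
    using c(1) unfolding periodic_def by metis
  define r where "r = (\<Prod>i\<le>n. p i)"
  have r: "r > 0" unfolding r_def using p(1) by (intro prod_pos) auto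
  have per: "c i (t + M * r * k) = c i t" if "i \<le> n" for i t k
  proof -
    have "p i dvd r" unfolding r_def using that by (intro dvd_prodI) auto
    then obtain l where "r = p i * l" by blast
    then have "M * r * k = p i * (l * M * k)" by simp
    then show ?thesis using periodic_mult_period[OF p(2)[OF that]] by metis
  qed
  have "c n t = L t" for t
  proof -
    define T where "T k = (of_int (t + M * r * int k) :: real)" for k
    have Mr: "real_of_int (M * r) > 0" using M r by (simp only: of_int_0_less_iff) simp
    have T_eq: "T k = of_int t + of_int (M * r) * real k" for k by (simp add: T_def)
    have T: "filterlim T at_top sequentially"
      unfolding T_eq
      by (rule filterlim_tendsto_add_at_top[OF tendsto_const
            filterlim_tendsto_pos_mult_at_top[OF tendsto_const Mr filterlim_real_sequentially]])
    have ev: "\<forall>\<^sub>F k in sequentially. T k > 0"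
      using T unfolding filterlim_at_top_dense by blast
    have "(\<lambda>k. \<Sum>i\<le>n. c i t * (1 / T k ^ (n - i))) \<longlonglongrightarrow> (\<Sum>i\<le>n. c i t * (if i = n then 1 else 0))"
    proof (intro tendsto_sum tendsto_mult tendsto_const)
      fix i assume "i \<in> {..n}"
      show "(\<lambda>k. 1 / T k ^ (n - i)) \<longlonglongrightarrow> (if i = n then 1 else 0)"
      proof (cases "i = n")
        case False
        then have "n - i > 0" using \<open>i \<in> {..n}\<close> by simp
        then have "(\<lambda>k. 1 / T k ^ (n - i)) \<longlonglongrightarrow> 0"
          by (intro tendsto_divide_0[OF tendsto_const]
                filterlim_at_top_imp_at_infinity filterlim_pow_at_top T)
        then show ?thesis using False by simp
      qed simp
    qed
    also have "(\<Sum>i\<le>n. c i t * (if i = n then 1 else 0)) = c n t"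
      by (simp add: if_distrib[of "\<lambda>x. _ * x"] cong: if_cong)
    finally have "(\<lambda>k. \<Sum>i\<le>n. c i t * (1 / T k ^ (n - i))) \<longlonglongrightarrow> c n t" .
    moreover have "\<forall>\<^sub>F k in sequentially. (\<Sum>i\<le>n. c i t * (1 / T k ^ (n - i)))
        = q (t + M * r * int k) / of_int (t + M * r * int k) ^ n"
      using ev
    proof eventually_elim
      case (elim k)
      have "q (t + M * r * int k) = (\<Sum>i\<le>n. c i t * T k ^ i)"
        using c(2) per by (simp add: T_def)
      then show ?case
        using elim unfolding T_def[symmetric]
        by (auto simp: sum_divide_distrib power_diff intro!: sum.cong)
    qed
    ultimately have "(\<lambda>k. q (t + M * r * int k) / of_int (t + M * r * int k) ^ n) \<longlonglongrightarrow> c n t"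
      by (rule Lim_transform_eventually)
    then show ?thesis using lim[OF r] LIMSEQ_unique by blast
  qed
  then have "c n = L" by auto
  then show ?thesis unfolding has_leading_term_def using c by blast
qed

section \<open>Half-open triangulation of rational cones\<close>

definition rational_points :: "(real ^ 'n) set" where
  "rational_points = {c. \<forall>j. c $ j \<in> \<rat>}"

lemma rational_points_zero [simp]: "0 \<in> rational_points"
  by (simp add: rational_points_def)

lemma rational_points_add: "c \<in> rational_points \<Longrightarrow> d \<in> rational_points \<Longrightarrow> c + d \<in> rational_points"
  by (simp add: rational_points_def)

lemma rational_points_diff: "c \<in> rational_points \<Longrightarrow> d \<in> rational_points \<Longrightarrow> c - d \<in> rational_points"
  by (simp add: rational_points_def)

lemma rational_points_scale: "r \<in> \<rat> \<Longrightarrow> c \<in> rational_points \<Longrightarrow> r *\<^sub>R c \<in> rational_points"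
  by (simp add: rational_points_def)

lemma rational_points_axis [simp]: "axis j 1 \<in> rational_points"
  by (auto simp: rational_points_def axis_def)

lemma rational_points_inner:
  "c \<in> rational_points \<Longrightarrow> d \<in> rational_points \<Longrightarrow> c \<bullet> d \<in> \<rat>"
  for c :: "real ^ 'n"
  unfolding inner_vec_def rational_points_def by (auto intro!: Rats_sum)

lemma countable_rational_points: "countable (rational_points :: (real ^ 'n::finite) set)"
  unfolding rational_points_def by (rule countable_vector) (rule countable_rat)

lemma subspace_kernel: "subspace {x :: real ^ 'n::finite. \<forall>c\<in>C. c \<bullet> x = 0}"
  by (auto simp: subspace_def inner_add_right)

text \<open>Equations are added one at a time. If a new \<open>d\<close> vanishes on the rational
  points found so far, nothing is lost, since they span; otherwise some rational \<open>v\<close>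
  has \<open>d \<bullet> v = 1\<close>, and projection along \<open>v\<close> onto the kernel of
  \<open>d\<close> maps rational spanning vectors to rational ones.\<close>

lemma rational_kernel_span:
  fixes C :: "(real ^ 'n::finite) set"
  assumes C: "C \<subseteq> rational_points"
  shows "{x. \<forall>c\<in>C. c \<bullet> x = 0} \<subseteq> span ({x. \<forall>c\<in>C. c \<bullet> x = 0} \<inter> rational_points)"
proof -
  have fin: "{x. \<forall>c\<in>F. c \<bullet> x = 0} \<subseteq> span ({x. \<forall>c\<in>F. c \<bullet> x = 0} \<inter> rational_points)"
    if "finite F" "F \<subseteq> rational_points" for F :: "(real ^ 'n) set"
    using that
  proof (induction F rule: finite_induct)
    case empty
    have "x \<in> span rational_points" for x :: "real ^ 'n"
    proof -
      have "Basis \<subseteq> (rational_points :: (real ^ 'n) set)"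
        by (auto simp: Basis_vec_def)
      then show ?thesis using span_mono span_Basis by blast
    qed
    then show ?case by auto
  next
    case (insert d F)
    let ?W' = "{x. \<forall>c\<in>F. c \<bullet> x = 0}" and ?W = "{x. \<forall>c\<in>insert d F. c \<bullet> x = 0}"
    have IH: "?W' \<subseteq> span (?W' \<inter> rational_points)" using insert by auto
    show ?case
    proof (cases "\<forall>v\<in>?W' \<inter> rational_points. d \<bullet> v = 0")
      case True
      then have "?W' \<inter> rational_points \<subseteq> ?W \<inter> rational_points" by auto
      then show ?thesis using IH span_mono by blast
    next
      case False
      then obtain v0 where v0: "v0 \<in> ?W'" "v0 \<in> rational_points" "d \<bullet> v0 \<noteq> 0" by auto
      define v where "v = (1 / (d \<bullet> v0)) *\<^sub>R v0"
      have v: "v \<in> ?W'" "v \<in> rational_points" "d \<bullet> v = 1"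
        using v0 insert.prems
        by (auto simp: v_def intro!: rational_points_scale rational_points_inner Rats_divide)
      have key: "x - (d \<bullet> x) *\<^sub>R v \<in> span (?W \<inter> rational_points)"
        if "x \<in> span (?W' \<inter> rational_points)" for x
        using that
      proof (induction rule: span_induct_alt)
        case base
        then show ?case by (simp add: span_zero)
      next
        case (step r y z)
        have "y - (d \<bullet> y) *\<^sub>R v \<in> ?W \<inter> rational_points"
          using step v insert.prems
          by (auto simp: inner_diff_right intro!: rational_points_diff rational_points_scale rational_points_inner)
        then have "r *\<^sub>R (y - (d \<bullet> y) *\<^sub>R v) + (z - (d \<bullet> z) *\<^sub>R v) \<in> span (?W \<inter> rational_points)"
          by (rule span_add[OF span_scale[OF span_base] step(2)])
        then show ?case by (simp add: inner_add_right algebra_simps)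
      qed
      show ?thesis
      proof
        fix x assume x: "x \<in> ?W"
        then have "x \<in> span (?W' \<inter> rational_points)" using IH by auto
        from key[OF this] x show "x \<in> span (?W \<inter> rational_points)" by simp
      qed
    qed
  qed
  \<comment> \<open>Finitely many equations suffice: a maximal independent subset of
    \<open>C\<close> has the same kernel.\<close>
  obtain F where F: "F \<subseteq> C" "independent F" "C \<subseteq> span F"
    using maximal_independent_subset by blast
  have "{x. \<forall>c\<in>F. c \<bullet> x = 0} = {x. \<forall>c\<in>C. c \<bullet> x = 0}"
  proof -
    have "c \<bullet> x = 0" if "\<forall>c\<in>F. c \<bullet> x = 0" "c \<in> C" for c x
    proof -
      have "c \<in> span F" using F that by auto
      then show ?thesis
        by (induction rule: span_induct_alt) (use that in \<open>auto simp: inner_add_left\<close>)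
    qed
    then show ?thesis using F by blast
  qed
  moreover have "finite F" using F(2) independent_imp_finite by blast
  ultimately show ?thesis using fin[of F] F(1) C by auto
qed

text \<open>In a combination of rational spanning vectors, each real coefficient is a limit of
  rational ones.\<close>

lemma rational_kernel_closure:
  fixes C :: "(real ^ 'n::finite) set"
  assumes C: "C \<subseteq> rational_points"
  shows "{x. \<forall>c\<in>C. c \<bullet> x = 0} \<subseteq> closure ({x. \<forall>c\<in>C. c \<bullet> x = 0} \<inter> rational_points)"
proof
  let ?S = "{x. \<forall>c\<in>C. c \<bullet> x = 0} \<inter> rational_points"
  fix x assume "x \<in> {x. \<forall>c\<in>C. c \<bullet> x = 0}"
  then have "x \<in> span ?S" using rational_kernel_span[OF C] by blast
  then show "x \<in> closure ?S"
  proof (induction rule: span_induct_alt)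
    case base
    then show ?case by (intro closure_subset[THEN subsetD]) auto
  next
    case (step r y z)
    obtain q where q: "\<And>n. q n \<in> \<rat>" "q \<longlonglongrightarrow> r"
      using Rats_closure_real[THEN eqset_imp_iff, of r] unfolding closure_sequential by auto
    obtain zs where zs: "\<And>n. zs n \<in> ?S" "zs \<longlonglongrightarrow> z"
      using step(2) unfolding closure_sequential by auto
    have "q n *\<^sub>R y + zs n \<in> ?S" for n
      using zs(1)[of n] step(1) q(1)[of n]
      by (auto simp: inner_add_right intro!: rational_points_add rational_points_scale)
    moreover have "(\<lambda>n. q n *\<^sub>R y + zs n) \<longlonglongrightarrow> r *\<^sub>R y + z"
      by (intro tendsto_intros q zs)
    ultimately show ?case
      unfolding closure_sequential by (intro exI[of _ "\<lambda>n. q n *\<^sub>R y + zs n"]) blast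
  qed
qed

text \<open>Strict inequalities survive a small perturbation but equalities do not. The latter are
  therefore added to \<open>C\<close> as equations before the density of rational points is
  applied.\<close>

lemma rational_approximation:
  fixes C A :: "(real ^ 'n::finite) set"
  assumes C: "C \<subseteq> rational_points" and A: "A \<subseteq> rational_points" "finite A"
    and x: "\<forall>c\<in>C. c \<bullet> x = 0"
  obtains u where "u \<in> rational_points" "\<forall>c\<in>C. c \<bullet> u = 0"
    "\<forall>a\<in>A. (a \<bullet> x > 0 \<longrightarrow> a \<bullet> u > 0) \<and> (a \<bullet> x = 0 \<longrightarrow> a \<bullet> u = 0)"
proof -
  define C' where "C' = C \<union> {a\<in>A. a \<bullet> x = 0}"
  have C': "C' \<subseteq> rational_points" using C A by (auto simp: C'_def)
  have "\<forall>c\<in>C'. c \<bullet> x = 0" using x by (auto simp: C'_def)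
  then have "x \<in> closure ({x. \<forall>c\<in>C'. c \<bullet> x = 0} \<inter> rational_points)"
    using rational_kernel_closure[OF C'] by auto
  moreover have "open (\<Inter>a\<in>{a\<in>A. a \<bullet> x > 0}. {y. a \<bullet> y > 0})"
    using A(2) by (intro open_INT) (auto intro: open_halfspace_gt)
  moreover have "x \<in> (\<Inter>a\<in>{a\<in>A. a \<bullet> x > 0}. {y. a \<bullet> y > 0})" by auto
  ultimately have "(\<Inter>a\<in>{a\<in>A. a \<bullet> x > 0}. {y. a \<bullet> y > 0}) \<inter>
      ({x. \<forall>c\<in>C'. c \<bullet> x = 0} \<inter> rational_points) \<noteq> {}"
    by (metis (lifting) IntI emptyE open_Int_closure_eq_empty)
  then obtain u where "u \<in> rational_points" "\<forall>c\<in>C'. c \<bullet> u = 0" "\<forall>a\<in>A. a \<bullet> x > 0 \<longrightarrow> a \<bullet> u > 0"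
    by auto
  then show ?thesis using that unfolding C'_def by blast
qed

text \<open>The smallest subspace containing \<open>w\<close> that is defined over the rationals.
  Naming the space by \<open>w\<close> builds the genericity of \<open>w\<close> into it.\<close>

definition relation_space :: "real ^ 'n \<Rightarrow> (real ^ 'n) set" where
  "relation_space w = {x. \<forall>c\<in>rational_points. c \<bullet> w = 0 \<longrightarrow> c \<bullet> x = 0}"

lemma relation_space_kernel:
  "relation_space w = {x. \<forall>c\<in>{c\<in>rational_points. c \<bullet> w = 0}. c \<bullet> x = 0}"
  by (auto simp: relation_space_def)

lemma subspace_relation_space: "subspace (relation_space (w :: real ^ 'n::finite))"
  unfolding relation_space_kernel by (rule subspace_kernel)

lemma self_in_relation_space: "w \<in> relation_space w"
  by (simp add: relation_space_def)

lemma relation_space_zero: "relation_space (0 :: real ^ 'n::finite) = {0}"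
proof -
  have "x = 0" if "x \<in> relation_space (0 :: real ^ 'n)" for x
  proof -
    have "axis j 1 \<bullet> x = 0" for j using that rational_points_axis[of j] by (auto simp: relation_space_def)
    then show ?thesis by (simp add: vec_eq_iff inner_axis' )
  qed
  then show ?thesis by (auto simp: relation_space_def)
qed

text \<open>Nonnegativity of the pair in the lexicographic order, i.e. of \<open>a + \<epsilon> b\<close> for small \<open>\<epsilon> > 0\<close>.\<close>

definition lexnn :: "real \<Rightarrow> real \<Rightarrow> bool" where
  "lexnn a b \<longleftrightarrow> a > 0 \<or> (a = 0 \<and> b \<ge> 0)"

lemma lexnn_add: "lexnn a b \<Longrightarrow> lexnn c d \<Longrightarrow> lexnn (a + c) (b + d)"
  unfolding lexnn_def by auto

lemma lexnn_scale: "r \<ge> 0 \<Longrightarrow> lexnn a b \<Longrightarrow> lexnn (r * a) (r * b)"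
  unfolding lexnn_def by (cases "r = 0") auto

lemma lexnn_sum:
  "(\<And>i. i \<in> I \<Longrightarrow> lexnn (f i) (g i)) \<Longrightarrow> lexnn (sum f I) (sum g I)"
  by (induction I rule: infinite_finite_induct) (auto simp: lexnn_add, auto simp: lexnn_def)

text \<open>The first differences must vanish, so only the infinitesimal parts are left to compare.
  This is what forces uniqueness of the piece containing a given point.\<close>

lemma lexnn_antisym: "lexnn (a - b) (c - d) \<Longrightarrow> lexnn (b - a) (d - c) \<Longrightarrow> c = d"
  unfolding lexnn_def by auto

text \<open>When all coordinates of \<open>w\<close> are nonzero, the facet opposite to
  \<open>b\<close> is removed exactly if the \<open>b\<close>-coordinate of \<open>w\<close> is
  negative; thus \<open>w\<close> and \<open>- w\<close> remove complementary facets.\<close>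

definition simplicial_cone :: "(real ^ 'n) set \<Rightarrow> real ^ 'n \<Rightarrow> (real ^ 'n) set" where
  "simplicial_cone U w = {x \<in> span U. \<forall>b\<in>U. lexnn (representation U x b) (representation U w b)}"

lemma sum_representation:
  fixes U :: "(real ^ 'n::finite) set"
  assumes "independent U" "x \<in> span U"
  shows "(\<Sum>b\<in>U. representation U x b *\<^sub>R b) = x"
  using assms independent_imp_finite[OF assms(1)]
  by (intro real_vector.sum_representation_eq) auto

lemma representation_insert:
  fixes U :: "(real ^ 'n::finite) set"
  assumes U: "independent U" and u: "u \<notin> span U" and x: "x - r *\<^sub>R u \<in> span U"
  shows "representation (insert u U) x u = r"
    and "b \<in> U \<Longrightarrow> representation (insert u U) x b = representation U (x - r *\<^sub>R u) b"
proof -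
  have fin: "finite U" using U independent_imp_finite by blast
  have ind: "independent (insert u U)" using U u by (simp add: independent_insert)
  have uU: "u \<notin> U" using u span_base by blast
  define g where "g b = (if b = u then r else representation U (x - r *\<^sub>R u) b)" for b
  have g0: "g b \<noteq> 0 \<Longrightarrow> b \<in> insert u U" for b
    using representation_ne_zero[of U] by (auto simp: g_def split: if_splits)
  have "(\<Sum>b | g b \<noteq> 0. g b *\<^sub>R b) = (\<Sum>b\<in>insert u U. g b *\<^sub>R b)"
    using g0 fin by (intro sum.mono_neutral_left) auto
  also have "\<dots> = r *\<^sub>R u + (\<Sum>b\<in>U. representation U (x - r *\<^sub>R u) b *\<^sub>R b)"
    using fin uU by (auto simp: g_def intro!: sum.cong)
  also have "\<dots> = x" using sum_representation[OF U x] by simp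
  finally have "(\<Sum>b | g b \<noteq> 0. g b *\<^sub>R b) = x" .
  moreover have "x \<in> span (insert u U)"
    using x by (auto simp: span_insert)
  moreover have "finite {b. g b \<noteq> 0}"
    by (rule finite_subset[of _ "insert u U"]) (use g0 fin in auto)
  ultimately have rep: "representation (insert u U) x = g"
    using ind g0 by (intro representation_eqI) auto
  show "representation (insert u U) x u = r" by (simp add: rep g_def)
  show "b \<in> U \<Longrightarrow> representation (insert u U) x b = representation U (x - r *\<^sub>R u) b"
    using uU by (auto simp: rep g_def)
qed

lemma inner_representation:
  fixes U :: "(real ^ 'n::finite) set"
  assumes "independent U" "x \<in> span U"
  shows "a \<bullet> x = (\<Sum>b\<in>U. (a \<bullet> b) * representation U x b)"
proof -
  have "a \<bullet> x = a \<bullet> (\<Sum>b\<in>U. representation U x b *\<^sub>R b)" using sum_representation[OF assms] by simp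
  then show ?thesis by (simp add: inner_sum_right mult.commute)
qed

text \<open>A form nonnegative on the generators is a nonnegative combination of the coordinates,
  and such combinations preserve \<open>lexnn\<close>.\<close>

lemma simplicial_cone_lexnn:
  fixes U :: "(real ^ 'n::finite) set"
  assumes "independent U" "x \<in> simplicial_cone U w" "w \<in> span U" "\<And>b. b \<in> U \<Longrightarrow> a \<bullet> b \<ge> 0"
  shows "lexnn (a \<bullet> x) (a \<bullet> w)"
proof -
  have x: "x \<in> span U" using assms(2) by (simp add: simplicial_cone_def)
  show ?thesis
    unfolding inner_representation[OF assms(1) x] inner_representation[OF assms(1,3)]
    by (rule lexnn_sum) (use assms in \<open>auto simp: simplicial_cone_def intro!: lexnn_scale\<close>)
qed


text \<open>Used when a simplex in a facet is coned with a new ray: the \<open>u\<close>-coordinate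
  and the remainder can be tested separately.\<close>

lemma simplicial_cone_insert:
  fixes U :: "(real ^ 'n::finite) set"
  assumes U: "independent U" and u: "u \<notin> span U"
    and x: "x - r *\<^sub>R u \<in> span U" and w: "w - s *\<^sub>R u \<in> span U"
  shows "x \<in> simplicial_cone (insert u U) w \<longleftrightarrow>
    lexnn r s \<and> x - r *\<^sub>R u \<in> simplicial_cone U (w - s *\<^sub>R u)"
proof -
  have "x \<in> span (insert u U)" using x by (auto simp: span_insert)
  then show ?thesis
    using x representation_insert[OF U u x] representation_insert[OF U u w]
    by (auto simp: simplicial_cone_def)
qed

text \<open>Genericity is inherited: every rational relation of the projected point is a relation of
  \<open>w\<close> plus a multiple of \<open>k\<close>.\<close>

lemma relation_space_project:
  fixes w :: "real ^ 'n::finite"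
  assumes u: "u \<in> relation_space w" "u \<in> rational_points"
    and k: "k \<in> rational_points" "k \<bullet> u \<noteq> 0"
  shows "relation_space (w - ((k \<bullet> w) / (k \<bullet> u)) *\<^sub>R u) = {x \<in> relation_space w. k \<bullet> x = 0}"
proof (intro set_eqI iffI)
  fix x assume x: "x \<in> relation_space (w - ((k \<bullet> w) / (k \<bullet> u)) *\<^sub>R u)"
  have "c \<bullet> x = 0" if "c \<in> rational_points" "c \<bullet> w = 0" for c
    using x that u by (auto simp: relation_space_def inner_diff_right)
  moreover have "k \<bullet> x = 0"
    using x k by (auto simp: relation_space_def inner_diff_right)
  ultimately show "x \<in> {x \<in> relation_space w. k \<bullet> x = 0}" by (simp add: relation_space_def)
next
  fix x assume "x \<in> {x \<in> relation_space w. k \<bullet> x = 0}"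
  then have x: "x \<in> relation_space w" "k \<bullet> x = 0" by auto
  show "x \<in> relation_space (w - ((k \<bullet> w) / (k \<bullet> u)) *\<^sub>R u)"
    unfolding relation_space_def
  proof (safe)
    fix c assume c: "c \<in> rational_points" "c \<bullet> (w - ((k \<bullet> w) / (k \<bullet> u)) *\<^sub>R u) = 0"
    \<comment> \<open>The multiple of \<open>k\<close> is chosen so that \<open>d\<close> vanishes
      at \<open>u\<close>; then \<open>d\<close> takes the same value at \<open>w\<close> as at its
      projection, namely 0.\<close>
    define d where "d = c - ((c \<bullet> u) / (k \<bullet> u)) *\<^sub>R k"
    have "d \<in> rational_points"
      unfolding d_def using c(1) k u
      by (intro rational_points_diff rational_points_scale Rats_divide rational_points_inner)
    moreover have "d \<bullet> w = 0"
      using c(2) k(2) by (simp add: d_def inner_diff_left inner_diff_right field_simps)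
    ultimately have "d \<bullet> x = 0" using x by (auto simp: relation_space_def)
    then show "c \<bullet> x = 0" using x by (simp add: d_def inner_diff_left)
  qed
qed

text \<open>Minimize \<open>X\<close>, then minimize \<open>Y\<close> among the minimizers of
  \<open>X\<close>.\<close>

lemma lexnn_minimal:
  fixes X Y :: "'a \<Rightarrow> real"
  assumes "finite R" "R \<noteq> {}"
  obtains k where "k \<in> R" "\<And>a. a \<in> R \<Longrightarrow> lexnn (X a - X k) (Y a - Y k)"
proof -
  define m where "m = Min (X ` R)"
  define R1 where "R1 = {a\<in>R. X a = m}"
  have m: "m \<in> X ` R" "\<And>a. a \<in> R \<Longrightarrow> m \<le> X a"
    using assms by (auto simp: m_def)
  have R1: "finite R1" "R1 \<noteq> {}" using assms m by (auto simp: R1_def)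
  define n where "n = Min (Y ` R1)"
  have n: "n \<in> Y ` R1" "\<And>a. a \<in> R1 \<Longrightarrow> n \<le> Y a"
    using R1 by (auto simp: n_def)
  then obtain k where k: "k \<in> R1" "Y k = n" by auto
  have "lexnn (X a - X k) (Y a - Y k)" if "a \<in> R" for a
    using m(2)[OF that] n(2)[of a] k that by (fastforce simp: lexnn_def R1_def)
  then show ?thesis using that k by (auto simp: R1_def)
qed

text \<open>
  A pulling triangulation from the ray through \<open>u\<close>, with all ties broken by the infinitesimal
  displacement in direction \<open>w\<close> (or \<open>-w\<close>), so that the pieces are disjoint.
\<close>

lemma cone_decomposition:
  fixes w \<eta> :: "real ^ 'n::finite" and A :: "(real ^ 'n) set"
  assumes A: "finite A" "A \<subseteq> rational_points" and \<eta>: "\<eta> \<in> rational_points"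
    and pointed: "\<forall>x\<in>relation_space w. x \<noteq> 0 \<longrightarrow> (\<forall>a\<in>A. a \<bullet> x \<ge> 0) \<longrightarrow> \<eta> \<bullet> x > 0"
  shows "\<exists>\<U>. finite \<U> \<and>
    (\<forall>U\<in>\<U>. independent U \<and> U \<subseteq> rational_points \<and> span U = relation_space w \<and>
      (\<forall>b\<in>U. \<eta> \<bullet> b = 1 \<and> (\<forall>a\<in>A. a \<bullet> b \<ge> 0) \<and> representation U w b \<noteq> 0)) \<and>
    (\<forall>e\<in>{1,-1}. \<forall>x\<in>relation_space w. (\<forall>a\<in>A. lexnn (a \<bullet> x) (e * (a \<bullet> w))) \<longrightarrow>
      (\<exists>!U. U \<in> \<U> \<and> x \<in> simplicial_cone U (e *\<^sub>R w)))"
  using pointed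
\<comment> \<open>The measure counts the constraints that do not vanish at \<open>w\<close>.
  Projecting \<open>w\<close> to the facet of \<open>k\<close> makes \<open>k\<close> vanish there
  and keeps every constraint that vanished before.\<close>
proof (induction "card {a\<in>A. a \<bullet> w \<noteq> 0}" arbitrary: w rule: less_induct)
  case less
  let ?W = "relation_space w"
  let ?K = "{x \<in> ?W. \<forall>a\<in>A. a \<bullet> x \<ge> 0}"
  consider "w = 0" | "w \<noteq> 0" "?K \<subseteq> {0}" | x where "w \<noteq> 0" "x \<in> ?K" "x \<noteq> 0" by blast
  then show ?case
  proof cases
    \<comment> \<open>The space is {0}, and the empty simplex is the single piece.\<close>
    case 1
    then show ?thesis
      by (intro exI[of _ "{{}}"])
         (auto simp: relation_space_zero simplicial_cone_def independent_empty)
  next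
    \<comment> \<open>Nothing has to be covered: a qualifying \<open>x\<close> would lie in the
      trivial cone, hence be 0, and then \<open>e *\<^sub>R w\<close> itself would be a nonzero
      point of that cone.\<close>
    case 2
    have False if "e \<in> {1,-1}" "x \<in> ?W" "\<forall>a\<in>A. lexnn (a \<bullet> x) (e * (a \<bullet> w))" for e x
    proof -
      have "x \<in> ?K" using that(2,3) by (auto simp: lexnn_def order_le_less)
      then have "x = 0" using 2 by auto
      then have "\<forall>a\<in>A. e * (a \<bullet> w) \<ge> 0" using that(3) by (auto simp: lexnn_def)
      moreover have "e *\<^sub>R w \<in> ?W"
        using subspace_relation_space self_in_relation_space by (rule subspace_scale)
      ultimately have "e *\<^sub>R w \<in> ?K" by simp
      then have "e *\<^sub>R w = 0" using 2 by auto
      then show False using 2 that(1) by auto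
    qed
    then show ?thesis by (intro exI[of _ "{}"]) blast
  next
    case (3 x)
    \<comment> \<open>The point \<open>x\<close> of the cone may be irrational. A rational point
      replaces it that is positive, respectively zero, on the same forms.\<close>
    obtain v where v: "v \<in> rational_points" "v \<in> ?W"
      "\<forall>a\<in>insert \<eta> A. (a \<bullet> x > 0 \<longrightarrow> a \<bullet> v > 0) \<and> (a \<bullet> x = 0 \<longrightarrow> a \<bullet> v = 0)"
    proof -
      have 1: "\<forall>c\<in>{c\<in>rational_points. c \<bullet> w = 0}. c \<bullet> x = 0"
        using 3 by (auto simp: relation_space_def)
      have 2: "{c \<in> rational_points. c \<bullet> w = 0} \<subseteq> rational_points"
        "insert \<eta> A \<subseteq> rational_points" "finite (insert \<eta> A)"
        using A \<eta> by auto
      obtain v where "v \<in> rational_points" "\<forall>c\<in>{c\<in>rational_points. c \<bullet> w = 0}. c \<bullet> v = 0"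
        "\<forall>a\<in>insert \<eta> A. (a \<bullet> x > 0 \<longrightarrow> a \<bullet> v > 0) \<and> (a \<bullet> x = 0 \<longrightarrow> a \<bullet> v = 0)"
        by (rule rational_approximation[OF 2 1])
      then show ?thesis using that[of v] unfolding relation_space_kernel by simp
    qed
    have "\<eta> \<bullet> x > 0" using less.prems 3 by auto
    then have \<eta>v: "\<eta> \<bullet> v > 0" using v by auto
    \<comment> \<open>Generators are normalized to height 1, so that the height of a point is the
      sum of its coordinates.\<close>
    define u where "u = (1 / (\<eta> \<bullet> v)) *\<^sub>R v"
    have u: "u \<in> rational_points" "u \<in> ?W" "\<eta> \<bullet> u = 1"
      using v \<eta> \<eta>v subspace_scale[OF subspace_relation_space v(2)]
      by (auto simp: u_def intro!: rational_points_scale Rats_divide rational_points_inner)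
    have Au: "a \<bullet> u \<ge> 0" if "a \<in> A" for a
    proof -
      have "a \<bullet> x \<ge> 0" using 3 that by auto
      then have "a \<bullet> v \<ge> 0" using v(3) that by (auto simp: order_le_less)
      then show ?thesis using \<eta>v by (simp add: u_def)
    qed
    \<comment> \<open>The constraints whose facets avoid \<open>u\<close>; the pulled simplices have
      their bases in these facets.\<close>
    define S where "S = {a\<in>A. a \<bullet> u > 0}"
    have S_A: "S \<subseteq> A" "finite S" using A by (auto simp: S_def)
    \<comment> \<open>Otherwise \<open>- u\<close> would lie in the cone too, against
      pointedness.\<close>
    have "S \<noteq> {}"
    proof
      assume "S = {}"
      then have "\<forall>a\<in>A. a \<bullet> (- u) \<ge> 0" using Au by (force simp: S_def)
      moreover have "- u \<in> ?W" using subspace_neg[OF subspace_relation_space u(2)] .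
      moreover have "- u \<noteq> 0" using u(3) by auto
      ultimately have "\<eta> \<bullet> (- u) > 0" using less.prems by blast
      then show False using u(3) by simp
    qed
    \<comment> \<open>The multiple of \<open>u\<close> that has to be subtracted from
      \<open>w\<close> for \<open>a\<close> to become tight.\<close>
    define \<rho> where "\<rho> a = (a \<bullet> w) / (a \<bullet> u)" for a
    \<comment> \<open>One representative per value of \<open>\<rho>\<close>: equal values belong to
      the same facet, and a facet used twice would be covered by two overlapping families.\<close>
    obtain R where R: "R \<subseteq> S" "inj_on \<rho> R" "\<rho> ` S = \<rho> ` R"
      using subset_image_inj[of "\<rho> ` S" \<rho> S] by auto
    have fR: "finite R" using R(1) S_A(2) by (rule finite_subset)
    have R0: "R \<noteq> {}" using R(3) \<open>S \<noteq> {}\<close> by auto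
    have same: "(a \<bullet> y) / (a \<bullet> u) = (k \<bullet> y) / (k \<bullet> u)"
      if "a \<in> S" "k \<in> S" "\<rho> a = \<rho> k" "y \<in> ?W" for a k y
    proof -
      \<comment> \<open>A rational relation of \<open>w\<close>, hence zero on the whole space. So
        two constraints with equal \<open>\<rho>\<close> are proportional there.\<close>
      define c where "c = (k \<bullet> u) *\<^sub>R a - (a \<bullet> u) *\<^sub>R k"
      have "c \<in> rational_points"
        unfolding c_def using that A S_A u
        by (intro rational_points_diff rational_points_scale rational_points_inner) auto
      moreover have "c \<bullet> w = 0"
        using that by (auto simp: c_def inner_diff_left \<rho>_def S_def field_simps)
      ultimately have "c \<bullet> y = 0" using that(4) by (auto simp: relation_space_def)
      then show ?thesis
        using that by (auto simp: c_def inner_diff_left S_def field_simps)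
    qed
    define wk where "wk k = w - \<rho> k *\<^sub>R u" for k
    have Wk: "relation_space (wk k) = {x \<in> ?W. k \<bullet> x = 0}" if "k \<in> S" for k
      unfolding wk_def \<rho>_def using that A S_A u
      by (intro relation_space_project) (auto simp: S_def)
    have IH: "\<exists>\<U>. finite \<U> \<and>
      (\<forall>U\<in>\<U>. independent U \<and> U \<subseteq> rational_points \<and> span U = relation_space (wk k) \<and>
        (\<forall>b\<in>U. \<eta> \<bullet> b = 1 \<and> (\<forall>a\<in>A. a \<bullet> b \<ge> 0) \<and> representation U (wk k) b \<noteq> 0)) \<and>
      (\<forall>e\<in>{1,-1}. \<forall>x\<in>relation_space (wk k). (\<forall>a\<in>A. lexnn (a \<bullet> x) (e * (a \<bullet> wk k))) \<longrightarrow>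
        (\<exists>!U. U \<in> \<U> \<and> x \<in> simplicial_cone U (e *\<^sub>R wk k)))" if k: "k \<in> R" for k
    proof (rule less.hyps)
      have kS: "k \<in> S" using k R by auto
      have "k \<bullet> w \<noteq> 0" using kS u A S_A by (auto simp: S_def relation_space_def)
      moreover have "k \<bullet> wk k = 0" using kS by (simp add: wk_def \<rho>_def inner_diff_right S_def)
      moreover have "a \<bullet> wk k = 0" if "a \<in> A" "a \<bullet> w = 0" for a
        using that u A by (auto simp: wk_def inner_diff_right relation_space_def)
      ultimately have "{a\<in>A. a \<bullet> wk k \<noteq> 0} \<subset> {a\<in>A. a \<bullet> w \<noteq> 0}" using kS S_A by blast
      then show "card {a\<in>A. a \<bullet> wk k \<noteq> 0} < card {a\<in>A. a \<bullet> w \<noteq> 0}"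
        using A by (intro psubset_card_mono) auto
      show "\<forall>x\<in>relation_space (wk k). x \<noteq> 0 \<longrightarrow> (\<forall>a\<in>A. a \<bullet> x \<ge> 0) \<longrightarrow> \<eta> \<bullet> x > 0"
        using less.prems Wk[OF kS] by auto
    qed
    define good where "good k \<U> \<longleftrightarrow> finite \<U> \<and>
      (\<forall>U\<in>\<U>. independent U \<and> U \<subseteq> rational_points \<and> span U = relation_space (wk k) \<and>
        (\<forall>b\<in>U. \<eta> \<bullet> b = 1 \<and> (\<forall>a\<in>A. a \<bullet> b \<ge> 0) \<and> representation U (wk k) b \<noteq> 0)) \<and>
      (\<forall>e\<in>{1,-1}. \<forall>x\<in>relation_space (wk k). (\<forall>a\<in>A. lexnn (a \<bullet> x) (e * (a \<bullet> wk k))) \<longrightarrow>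
        (\<exists>!U. U \<in> \<U> \<and> x \<in> simplicial_cone U (e *\<^sub>R wk k)))" for k \<U>
    have "\<forall>k\<in>R. \<exists>\<U>. good k \<U>" unfolding good_def using IH by (rule ballI)
    then obtain \<V> where "\<forall>k\<in>R. good k (\<V> k)" using bchoice[of R good] by blast
    then have \<V>: "\<And>k. k \<in> R \<Longrightarrow> good k (\<V> k)" by simp
    \<comment> \<open>Each simplex triangulating a facet is coned with \<open>u\<close>.\<close>
    define \<U> where "\<U> = (\<Union>k\<in>R. insert u ` \<V> k)"
    have fin: "finite \<U>" unfolding \<U>_def using fR \<V> by (auto simp: good_def)
    define proj where "proj k y = y - ((k \<bullet> y) / (k \<bullet> u)) *\<^sub>R u" for k y
    have proj: "proj k y \<in> relation_space (wk k)" if "k \<in> R" "y \<in> ?W" for k y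
    proof -
      have kS: "k \<in> S" using that R by auto
      have "proj k y \<in> ?W"
        unfolding proj_def
        by (intro subspace_diff subspace_scale subspace_relation_space that u)
      moreover have "k \<bullet> proj k y = 0" using kS by (simp add: proj_def inner_diff_right S_def)
      ultimately show ?thesis using Wk[OF kS] by simp
    qed
    have proj_w: "proj k (e *\<^sub>R w) = e *\<^sub>R wk k" for k e
      by (simp add: proj_def wk_def \<rho>_def algebra_simps)
    have piece: "independent U" "u \<notin> span U" "span U = relation_space (wk k)"
      if "k \<in> R" "U \<in> \<V> k" for k U
    proof -
      show U: "independent U" "span U = relation_space (wk k)"
        using \<V>[OF that(1)] that(2) by (auto simp: good_def)
      show "u \<notin> span U" using U(2) Wk[of k] that R by (auto simp: S_def)
    qed
    have cone_iff: "y \<in> simplicial_cone (insert u U) (e *\<^sub>R w) \<longleftrightarrow>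
        lexnn ((k \<bullet> y) / (k \<bullet> u)) (e * \<rho> k) \<and> proj k y \<in> simplicial_cone U (e *\<^sub>R wk k)"
      if "k \<in> R" "U \<in> \<V> k" "y \<in> ?W" for k U y e
    proof -
      have ew: "e *\<^sub>R w \<in> ?W" using subspace_relation_space self_in_relation_space by (rule subspace_scale)
      have "y - ((k \<bullet> y) / (k \<bullet> u)) *\<^sub>R u \<in> span U"
        "e *\<^sub>R w - ((k \<bullet> (e *\<^sub>R w)) / (k \<bullet> u)) *\<^sub>R u \<in> span U"
        using proj[OF that(1) that(3)] proj[OF that(1) ew] piece(3)[OF that(1,2)]
        by (simp_all add: proj_def)
      from simplicial_cone_insert[OF piece(1,2)[OF that(1,2)] this]
      show ?thesis unfolding proj_w[symmetric] by (simp add: proj_def \<rho>_def)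
    qed
    \<comment> \<open>For \<open>e\<close>-displaced points: after projection to the facet of
      \<open>k\<close>, the form \<open>a\<close> is nonnegative iff a point moving in direction
      \<open>- u\<close> makes \<open>k\<close> tight no later than \<open>a\<close>.\<close>
    have lexproj: "lexnn (a \<bullet> proj k y) (e * (a \<bullet> wk k)) \<longleftrightarrow>
        lexnn ((a \<bullet> y) / (a \<bullet> u) - (k \<bullet> y) / (k \<bullet> u)) (e * \<rho> a - e * \<rho> k)"
      if "a \<in> S" for a k e y
    proof -
      have au: "a \<bullet> u > 0" using that by (simp add: S_def)
      have "a \<bullet> proj k y = (a \<bullet> u) * ((a \<bullet> y) / (a \<bullet> u) - (k \<bullet> y) / (k \<bullet> u))"
        "e * (a \<bullet> wk k) = (a \<bullet> u) * (e * \<rho> a - e * \<rho> k)"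
        using au by (simp_all add: proj_def wk_def \<rho>_def inner_diff_right field_simps)
      then show ?thesis using au
        by (auto simp: lexnn_def zero_less_mult_iff zero_le_mult_iff)
    qed
    have props: "\<forall>U\<in>\<U>. independent U \<and> U \<subseteq> rational_points \<and> span U = ?W \<and>
      (\<forall>b\<in>U. \<eta> \<bullet> b = 1 \<and> (\<forall>a\<in>A. a \<bullet> b \<ge> 0) \<and> representation U w b \<noteq> 0)"
    proof
      fix V assume "V \<in> \<U>"
      then obtain k U where k: "k \<in> R" and U: "U \<in> \<V> k" and V: "V = insert u U"
        by (auto simp: \<U>_def)
      note p = piece[OF k U]
      have g: "U \<subseteq> rational_points" "\<forall>b\<in>U. \<eta> \<bullet> b = 1 \<and> (\<forall>a\<in>A. a \<bullet> b \<ge> 0) \<and> representation U (wk k) b \<noteq> 0"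
        using \<V>[OF k] U by (auto simp: good_def)
      have kS: "k \<in> S" using k R by auto
      have "k \<bullet> w \<noteq> 0" using kS u A S_A by (auto simp: S_def relation_space_def)
      \<comment> \<open>\<open>\<rho> k\<close> is the coordinate of \<open>w\<close> at
        \<open>u\<close> in the new simplex; the remaining coordinates are those of
        \<open>wk k\<close> in the facet.\<close>
      then have \<rho>k: "\<rho> k \<noteq> 0" using kS by (auto simp: \<rho>_def S_def)
      have "span V = ?W"
      proof
        have "U \<subseteq> ?W" using span_superset[of U] p(3) Wk[OF kS] by auto
        then have "V \<subseteq> ?W" using u V by auto
        then show "span V \<subseteq> ?W" using subspace_relation_space by (rule span_minimal)
        show "?W \<subseteq> span V"
        proof
          fix y assume "y \<in> ?W"
          then have "proj k y \<in> span U" using proj[OF k] p(3) by auto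
          then show "y \<in> span V" unfolding V span_insert proj_def by blast
        qed
      qed
      moreover have "w - \<rho> k *\<^sub>R u \<in> span U" using p(3) self_in_relation_space[of "wk k"] by (simp add: wk_def)
      note rep = representation_insert[OF p(1,2) this]
      have "\<forall>b\<in>V. representation V w b \<noteq> 0"
        using rep g(2) \<rho>k unfolding V wk_def by auto
      ultimately show "independent V \<and> V \<subseteq> rational_points \<and> span V = ?W \<and>
        (\<forall>b\<in>V. \<eta> \<bullet> b = 1 \<and> (\<forall>a\<in>A. a \<bullet> b \<ge> 0) \<and> representation V w b \<noteq> 0)"
        using p g u Au V by (auto simp: independent_insert)
    qed
    have uniq: "\<exists>!U. U \<in> \<U> \<and> y \<in> simplicial_cone U (e *\<^sub>R w)"
      if e: "e \<in> {1,-1}" and y: "y \<in> ?W" and pos: "\<forall>a\<in>A. lexnn (a \<bullet> y) (e * (a \<bullet> w))" for e y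
    proof -
      \<comment> \<open>The facet through which the displaced point leaves the cone when it moves in
        direction \<open>- u\<close>; the displacement breaks ties.\<close>
      obtain k where k: "k \<in> R" and kmin: "\<And>a. a \<in> R \<Longrightarrow>
          lexnn ((a \<bullet> y) / (a \<bullet> u) - (k \<bullet> y) / (k \<bullet> u)) (e * \<rho> a - e * \<rho> k)"
        using lexnn_minimal[OF fR R0, of "\<lambda>a. (a \<bullet> y) / (a \<bullet> u)" "\<lambda>a. e * \<rho> a"] by blast
      have kS: "k \<in> S" using k R by auto
      have "lexnn (a \<bullet> proj k y) (e * (a \<bullet> wk k))" if a: "a \<in> A" for a
      proof (cases "a \<in> S")
        case True
        then obtain a' where a': "a' \<in> R" "\<rho> a = \<rho> a'" using R(3) by blast
        then have "(a \<bullet> y) / (a \<bullet> u) = (a' \<bullet> y) / (a' \<bullet> u)"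
          using same[OF True _ a'(2) y] R(1) by auto
        then show ?thesis using lexproj[OF True] kmin[OF a'(1)] a'(2) by simp
      next
        case False
        then have "a \<bullet> u = 0" using Au[OF a] a by (auto simp: S_def)
        then show ?thesis using pos a by (simp add: proj_def wk_def inner_diff_right)
      qed
      moreover have "\<forall>e\<in>{1,-1}. \<forall>x\<in>relation_space (wk k).
          (\<forall>a\<in>A. lexnn (a \<bullet> x) (e * (a \<bullet> wk k))) \<longrightarrow>
          (\<exists>!U. U \<in> \<V> k \<and> x \<in> simplicial_cone U (e *\<^sub>R wk k))"
        using \<V>[OF k] unfolding good_def by (elim conjE)
      ultimately have "\<exists>!U. U \<in> \<V> k \<and> proj k y \<in> simplicial_cone U (e *\<^sub>R wk k)"
        using proj[OF k y] e by (elim ballE[of _ _ e] ballE[of _ _ "proj k y"]) blast+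
      then obtain U where U: "U \<in> \<V> k" "proj k y \<in> simplicial_cone U (e *\<^sub>R wk k)"
        and Uuniq: "\<And>U'. U' \<in> \<V> k \<Longrightarrow> proj k y \<in> simplicial_cone U' (e *\<^sub>R wk k) \<Longrightarrow> U' = U"
        by (elim ex1E) blast
      have "lexnn ((1 / (k \<bullet> u)) * (k \<bullet> y)) ((1 / (k \<bullet> u)) * (e * (k \<bullet> w)))"
        using kS pos S_A by (intro lexnn_scale) (auto simp: S_def)
      then have "lexnn ((k \<bullet> y) / (k \<bullet> u)) (e * \<rho> k)" by (simp add: \<rho>_def)
      then have 1: "y \<in> simplicial_cone (insert u U) (e *\<^sub>R w)"
        using cone_iff[OF k U(1) y] U(2) by blast
      \<comment> \<open>The facet \<open>l\<close> below any other piece containing \<open>y\<close>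
        passes the same minimality test, so \<open>\<rho> k = \<rho> l\<close>, and injectivity on
        \<open>R\<close> gives \<open>k = l\<close>.\<close>
      have 2: "V = insert u U" if V: "V \<in> \<U>" "y \<in> simplicial_cone V (e *\<^sub>R w)" for V
      proof -
        obtain l U' where l: "l \<in> R" and U': "U' \<in> \<V> l" and V_eq: "V = insert u U'"
          using V(1) by (auto simp: \<U>_def)
        have c: "proj l y \<in> simplicial_cone U' (e *\<^sub>R wk l)"
          using cone_iff[OF l U' y] V(2) V_eq by blast
        have "e *\<^sub>R wk l \<in> span U'"
          using piece(3)[OF l U'] subspace_scale[OF subspace_relation_space self_in_relation_space] by auto
        then have "lexnn (k \<bullet> proj l y) (e * (k \<bullet> wk l))"
          using simplicial_cone_lexnn[OF piece(1)[OF l U'] c, of k] \<V>[OF l] U' kS S_A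
          by (auto simp: good_def)
        then have "e * \<rho> k = e * \<rho> l"
          using lexproj[OF kS] kmin[OF l] lexnn_antisym by blast
        then have "\<rho> k = \<rho> l" using e by auto
        then have "k = l" using R(2) k l by (auto dest: inj_onD)
        then show ?thesis using Uuniq U' c V_eq by auto
      qed
      show ?thesis using 1 2 U(1) k by (intro ex1I[of _ "insert u U"]) (auto simp: \<U>_def)
    qed
    show ?thesis
    proof (intro exI[of _ \<U>] conjI)
      show "\<forall>e\<in>{1,-1}. \<forall>x\<in>?W. (\<forall>a\<in>A. lexnn (a \<bullet> x) (e * (a \<bullet> w))) \<longrightarrow>
          (\<exists>!U. U \<in> \<U> \<and> x \<in> simplicial_cone U (e *\<^sub>R w))"
        by (intro ballI impI) (rule uniq)
    qed (rule fin, rule props)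
  qed
qed

section \<open>Reciprocity for rational cones\<close>

lemma integer_points_zero [simp]: "0 \<in> integer_points"
  by (simp add: integer_points_def)

lemma integer_points_add: "x \<in> integer_points \<Longrightarrow> y \<in> integer_points \<Longrightarrow> x + y \<in> integer_points"
  by (simp add: integer_points_def)

lemma integer_points_diff: "x \<in> integer_points \<Longrightarrow> y \<in> integer_points \<Longrightarrow> x - y \<in> integer_points"
  by (simp add: integer_points_def)

lemma integer_points_scale: "r \<in> \<int> \<Longrightarrow> x \<in> integer_points \<Longrightarrow> r *\<^sub>R x \<in> integer_points"
  by (simp add: integer_points_def)

lemma integer_points_sum:
  "(\<And>i. i \<in> I \<Longrightarrow> x i \<in> integer_points) \<Longrightarrow> (\<Sum>i\<in>I. x i) \<in> integer_points"
  by (induction I rule: infinite_finite_induct) (auto intro: integer_points_add)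

lemma finite_integer_points:
  fixes S :: "(real ^ 'n::finite) set"
  assumes "bounded S"
  shows "finite (integer_points \<inter> S)"
proof -
  obtain M where M: "\<And>x. x \<in> S \<Longrightarrow> norm x \<le> M" using assms bounded_iff by blast
  have "integer_points \<inter> S \<subseteq> vec_lambda ` (UNIV \<rightarrow>\<^sub>E {k \<in> \<int>. \<bar>k\<bar> \<le> M} :: ('n \<Rightarrow> real) set)"
  proof
    fix x assume x: "x \<in> integer_points \<inter> S"
    have "vec_nth x \<in> UNIV \<rightarrow>\<^sub>E {k \<in> \<int>. \<bar>k\<bar> \<le> M}"
      using x order_trans[OF component_le_norm_cart M] by (auto simp: integer_points_def)
    then show "x \<in> vec_lambda ` (UNIV \<rightarrow>\<^sub>E {k \<in> \<int>. \<bar>k\<bar> \<le> M})"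
      by (rule image_eqI[rotated]) simp
  qed
  moreover have "finite (vec_lambda ` (UNIV \<rightarrow>\<^sub>E {k \<in> \<int>. \<bar>k\<bar> \<le> M} :: ('n \<Rightarrow> real) set))"
    by (intro finite_imageI finite_PiE finite_abs_int_segment) auto
  ultimately show ?thesis using finite_subset by blast
qed

lemma ex_common_denominator:
  fixes U :: "(real ^ 'n::finite) set"
  assumes "finite U" "U \<subseteq> rational_points"
  obtains D :: nat where "D > 0" "\<And>b. b \<in> U \<Longrightarrow> real D *\<^sub>R b \<in> integer_points"
proof -
  have "\<exists>D>0. \<forall>b\<in>U. \<forall>j. real D * b $ j \<in> \<int>"
  proof -
    have "\<exists>d>0. real d * r \<in> \<int>" if r: "r \<in> \<rat>" for r :: real
    proof -
      obtain m n :: nat where "n \<noteq> 0" "\<bar>r\<bar> = real m / real n"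
        using r by (rule Rats_abs_nat_div_natE)
      then have "real n * r = real m \<or> real n * r = - real m" by (auto simp: abs_if field_simps split: if_splits)
      then show ?thesis using \<open>n \<noteq> 0\<close> by (intro exI[of _ n]) auto
    qed
    then obtain d where d: "\<And>r. r \<in> \<rat> \<Longrightarrow> d r > (0::nat)" "\<And>r. r \<in> \<rat> \<Longrightarrow> real (d r) * r \<in> \<int>" by metis
    define D where "D = (\<Prod>p\<in>U \<times> UNIV. d (fst p $ snd p))"
    have "D > 0" unfolding D_def using assms d(1) by (intro prod_pos) (auto simp: rational_points_def)
    moreover have "real D * b $ j \<in> \<int>" if "b \<in> U" for b j
    proof -
      have "d (b $ j) dvd D" unfolding D_def using that assms
        by (intro dvd_prodI[of _ "(b, j)" "\<lambda>p. d (fst p $ snd p)", simplified]) auto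
      then obtain e where "D = d (b $ j) * e" by blast
      then have "real D * b $ j = real e * (real (d (b $ j)) * b $ j)" by simp
      moreover have "b $ j \<in> \<rat>" using that assms by (auto simp: rational_points_def)
      then have "real e * (real (d (b $ j)) * b $ j) \<in> \<int>" by (rule Ints_mult[OF Ints_of_nat d(2)])
      ultimately show ?thesis by (simp only:)
    qed
    ultimately show ?thesis by blast
  qed
  then show ?thesis using that by (auto simp: integer_points_def)
qed

text \<open>Stars and bars by induction on the number of parts; summing over the value of the new
  part gives the hockey-stick identity. Finiteness is carried along because the cardinality of the
  dependent sum requires it.\<close>

lemma card_compositions:
  fixes U :: "'a set"
  assumes "finite U" "U \<noteq> {}"
  shows "card {q \<in> U \<rightarrow>\<^sub>E (UNIV :: nat set). sum q U = N} = (N + (card U - 1)) choose (card U - 1)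
    \<and> finite {q \<in> U \<rightarrow>\<^sub>E (UNIV :: nat set). sum q U = N}"
  using assms
proof (induction U arbitrary: N rule: finite_ne_induct)
  case (singleton b)
  have "{q \<in> {b} \<rightarrow>\<^sub>E (UNIV :: nat set). sum q {b} = N} = {\<lambda>x. if x = b then N else undefined}"
    by (auto simp: PiE_def extensional_def fun_eq_iff)
  then show ?case by simp
next
  case (insert b U)
  define K where "K = card U - 1"
  have cU: "card U = Suc K" using insert.hyps by (simp add: K_def card_gt_0_iff)
  let ?S = "SIGMA i:{..N}. {q \<in> U \<rightarrow>\<^sub>E (UNIV :: nat set). sum q U = N - i}"
  let ?f = "\<lambda>(y, g :: 'a \<Rightarrow> nat). g(b := y)"
  have upd: "sum (g(b := y)) U = sum g U" for g :: "'a \<Rightarrow> nat" and y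
    using insert.hyps by (intro sum.cong) auto
  have img: "{q \<in> insert b U \<rightarrow>\<^sub>E (UNIV :: nat set). sum q (insert b U) = N} = ?f ` ?S"
  proof (intro set_eqI iffI)
    fix q assume q: "q \<in> {q \<in> insert b U \<rightarrow>\<^sub>E (UNIV :: nat set). sum q (insert b U) = N}"
    then obtain y g where "q = g(b := y)" "g \<in> U \<rightarrow>\<^sub>E (UNIV :: nat set)"
      unfolding PiE_insert_eq by auto
    moreover from this have "sum q (insert b U) = y + sum g U"
      using insert.hyps upd by simp
    ultimately show "q \<in> ?f ` ?S" using q by (intro image_eqI[of _ _ "(y, g)"]) auto
  next
    fix q assume "q \<in> ?f ` ?S"
    then obtain y g where y: "q = g(b := y)" "g \<in> U \<rightarrow>\<^sub>E (UNIV :: nat set)" "y \<le> N" "sum g U = N - y" by auto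
    then have "sum q (insert b U) = y + sum g U" using insert.hyps upd by simp
    then show "q \<in> {q \<in> insert b U \<rightarrow>\<^sub>E (UNIV :: nat set). sum q (insert b U) = N}"
      using y by (auto simp: PiE_insert_eq)
  qed
  have inj: "inj_on ?f ?S"
    by (rule inj_on_subset[OF inj_combinator[OF insert.hyps(3), of "\<lambda>_. UNIV"]]) auto
  have fin: "finite ?S" using insert.IH by (intro finite_SigmaI) auto
  have "card ?S = (\<Sum>i\<le>N. card {q \<in> U \<rightarrow>\<^sub>E (UNIV :: nat set). sum q U = N - i})"
    using insert.IH by (intro card_SigmaI) auto
  also have "\<dots> = (\<Sum>i\<le>N. (N - i + K) choose K)"
    using insert.IH by (simp add: K_def)
  also have "\<dots> = (\<Sum>j\<le>N. (K + j) choose j)"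
  proof (rule sum.reindex_bij_witness[of _ "\<lambda>j. N - j" "\<lambda>i. N - i"])
    fix i assume "i \<in> {..N}"
    show "K + (N - i) choose (N - i) = N - i + K choose K"
      using binomial_symmetric[of K "N - i + K"] by (simp add: add.commute)
  qed auto
  also have "\<dots> = Suc (K + N) choose N" by (rule sum_choose_lower)
  also have "\<dots> = (N + Suc K) choose Suc K"
    using binomial_symmetric[of "Suc K" "N + Suc K"] by (simp add: add.commute)
  finally have "card ?S = (N + Suc K) choose Suc K" .
  moreover have "card (insert b U) - 1 = Suc K" using insert.hyps cU by simp
  ultimately show ?case unfolding img using card_image[OF inj] fin by simp
qed

text \<open>The number of ways to write \<open>y\<close> as an ordered sum of \<open>k + 1\<close>
  natural numbers, continued polynomially to negative integers. The value 0 at non-integers is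
  needed because \<open>y\<close> will be a difference of heights divided by
  \<open>D\<close>.\<close>

definition multichoose :: "nat \<Rightarrow> real \<Rightarrow> real" where
  "multichoose k y = (if y \<in> \<int> then (y + of_nat k) gchoose k else 0)"

text \<open>The polynomial vanishes at -1, ..., -k and so agrees with the empty count there. The
  first discrepancy is at -(k + 1), whence the bound on \<open>y\<close>.\<close>

lemma multichoose_eq_card:
  assumes "finite U" "card U = Suc k" "y > - real (Suc k)"
  shows "real (card {q \<in> U \<rightarrow>\<^sub>E (UNIV :: nat set). real (sum q U) = y}) = multichoose k y"
proof -
  consider (frac) "y \<notin> \<int>" | (neg) "y \<in> \<int>" "y < 0" | (nn) N where "y = real N"
    by (metis Ints_cases of_int_of_nat_eq of_int_less_0_iff int_cases not_less zero_le_imp_eq_int of_int_0_le_iff)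
  then show ?thesis
  proof cases
    case frac
    then have "{q \<in> U \<rightarrow>\<^sub>E (UNIV :: nat set). real (sum q U) = y} = {}" by (auto simp del: of_nat_sum)
    then show ?thesis using frac unfolding multichoose_def by (simp only: card.empty if_False of_nat_0)
  next
    case neg
    then have 1: "{q \<in> U \<rightarrow>\<^sub>E (UNIV :: nat set). real (sum q U) = y} = {}" by (auto simp del: of_nat_sum)
    obtain i where i: "y = of_int i" using neg by (auto elim: Ints_cases)
    define j where "j = nat (i + int k)"
    have "i < 0" "i > - int (Suc k)"
      using neg(2) assms(3) unfolding i by linarith+
    then have "y + of_nat k = real j" "j < k" unfolding i j_def by simp_all
    then have "(y + of_nat k) gchoose k = 0"
      by (metis binomial_gbinomial binomial_eq_0 of_nat_0)
    then show ?thesis using 1 unfolding multichoose_def by (simp only: card.empty if_cancel of_nat_0)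
  next
    case nn
    have "U \<noteq> {}" using assms by auto
    have "{q \<in> U \<rightarrow>\<^sub>E (UNIV :: nat set). real (sum q U) = y} = {q \<in> U \<rightarrow>\<^sub>E (UNIV :: nat set). sum q U = N}"
      using nn by (auto simp del: of_nat_sum)
    then have "real (card {q \<in> U \<rightarrow>\<^sub>E (UNIV :: nat set). real (sum q U) = y}) = real ((N + k) choose k)"
      using card_compositions[OF assms(1) \<open>U \<noteq> {}\<close>, of N] assms by simp
    then show ?thesis using nn by (simp add: multichoose_def binomial_gbinomial del: of_nat_sum)
  qed
qed

text \<open>Negation of the upper index of a binomial coefficient. The reflection also preserves
  non-integrality.\<close>

lemma multichoose_reciprocity: "multichoose k (- y - real (Suc k)) = (-1) ^ k * multichoose k y"
proof (cases "y \<in> \<int>")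
  case True
  then have 1: "- y - real (Suc k) \<in> \<int>" by (intro Ints_diff Ints_minus Ints_of_nat)
  have "(- y - real (Suc k) + of_nat k) = - y - 1" by simp
  moreover have "(- y - 1) gchoose k = (-1) ^ k * ((of_nat k - (- y - 1) - 1) gchoose k)"
    by (rule gbinomial_negated_upper)
  moreover have "of_nat k - (- y - 1) - 1 = y + of_nat k" by simp
  ultimately show ?thesis using True 1 by (simp add: multichoose_def)
next
  case False
  have "- y - real (Suc k) \<notin> \<int>"
  proof
    assume "- y - real (Suc k) \<in> \<int>"
    then have "- (- y - real (Suc k)) - real (Suc k) \<in> \<int>"
      by (rule Ints_diff[OF Ints_minus Ints_of_nat])
    moreover have "- (- y - real (Suc k)) - real (Suc k) = y" by simp
    ultimately show False using False by metis
  qed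
  then show ?thesis using False by (simp add: multichoose_def)
qed

text \<open>Integrality has period \<open>D\<close> in \<open>t\<close>, and the binomial
  coefficient is a product of \<open>k\<close> factors linear in \<open>t\<close>.\<close>

lemma quasipoly_le_multichoose:
  assumes "D > (0::nat)"
  shows "quasipoly_le k (\<lambda>t. multichoose k ((of_int t - a) / real D))"
proof -
  define c where "c t = (if (of_int t - a) / real D \<in> \<int> then 1 / fact k else 0 :: real)" for t
  have "c (t + int D) = c t" for t
  proof -
    have "(of_int (t + int D) - a) / real D = (of_int t - a) / real D + 1"
      using assms by (simp add: field_simps)
    moreover have "x + 1 \<in> \<int> \<longleftrightarrow> x \<in> \<int>" for x :: real
      by (metis Ints_1 Ints_add Ints_diff add_diff_cancel_right')
    ultimately show ?thesis by (simp add: c_def)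
  qed
  then have "periodic c" unfolding periodic_def using assms by (intro exI[of _ "int D"]) auto
  then have "quasipoly_le k (\<lambda>t. c t * (\<Prod>i<k. (1 / real D) * of_int t + (real k - real i - a / real D)))"
    by (rule quasipoly_le_mult_prod_linear)
  moreover have "multichoose k ((of_int t - a) / real D) =
      c t * (\<Prod>i<k. (1 / real D) * of_int t + (real k - real i - a / real D))" for t
    unfolding multichoose_def c_def gbinomial_prod_rev
    by (auto simp: atLeast0LessThan diff_divide_distrib algebra_simps intro!: prod.cong)
  ultimately show ?thesis by simp
qed

section \<open>Half-open parallelepipeds\<close>

lemma representation_sum_scale:
  fixes U :: "(real ^ 'n::finite) set"
  assumes U: "independent U" and b: "b \<in> U"
  shows "representation U (\<Sum>b\<in>U. c b *\<^sub>R b) b = c b"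
proof -
  have "representation U (\<Sum>b\<in>U. c b *\<^sub>R b) b = (\<Sum>b'\<in>U. representation U (c b' *\<^sub>R b') b)"
    using U by (simp add: representation_sum span_base span_scale)
  also have "\<dots> = (\<Sum>b'\<in>U. c b' * (if b' = b then 1 else 0))"
    using U by (intro sum.cong) (auto simp: representation_scale span_base representation_basis)
  also have "\<dots> = c b" using b independent_imp_finite[OF U]
    by (simp add: if_distrib[of "\<lambda>x. _ * x"] cong: if_cong)
  finally show ?thesis .
qed

lemma representation_add_sum:
  fixes U :: "(real ^ 'n::finite) set"
  assumes U: "independent U" and b: "b \<in> U" and x: "x \<in> span U"
  shows "representation U (x + (\<Sum>b\<in>U. c b *\<^sub>R b)) b = representation U x b + c b"
proof -
  have "(\<Sum>b\<in>U. c b *\<^sub>R b) \<in> span U" by (intro span_sum span_scale span_base)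
  then have "representation U (x + (\<Sum>b\<in>U. c b *\<^sub>R b)) = (\<lambda>b. representation U x b + representation U (\<Sum>b\<in>U. c b *\<^sub>R b) b)"
    using U x by (intro representation_add) auto
  then show ?thesis using representation_sum_scale[OF U b] by simp
qed

text \<open>Integer points of the half-open parallelepiped on the generators \<open>D *\<^sub>R b\<close> whose translates
  by the semigroup of these generators tile the integer points of \<open>simplicial_cone U w\<close>.\<close>

definition fundamental_points :: "(real ^ 'n) set \<Rightarrow> nat \<Rightarrow> real ^ 'n \<Rightarrow> (real ^ 'n) set" where
  "fundamental_points U D w = {x \<in> integer_points \<inter> span U. \<forall>b\<in>U.
     representation U x b / real D \<in> (if representation U w b > 0 then {0..<1} else {0<..1})}"

lemma finite_fundamental_points:
  fixes U :: "(real ^ 'n::finite) set"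
  assumes U: "independent U" and D: "D > 0"
  shows "finite (fundamental_points U D w)"
proof -
  have "bounded (fundamental_points U D w)"
    unfolding bounded_iff
  proof (intro exI ballI)
    fix x assume x: "x \<in> fundamental_points U D w"
    then have "norm x = norm (\<Sum>b\<in>U. representation U x b *\<^sub>R b)"
      using sum_representation[OF U] by (simp add: fundamental_points_def)
    also have "\<dots> \<le> (\<Sum>b\<in>U. norm (representation U x b *\<^sub>R b))" by (rule norm_sum)
    also have "\<dots> \<le> (\<Sum>b\<in>U. real D * norm b)"
    proof (rule sum_mono)
      fix b assume "b \<in> U"
      then have "0 \<le> representation U x b / real D" "representation U x b / real D \<le> 1"
        using x by (auto simp: fundamental_points_def split: if_splits)
      then have "\<bar>representation U x b\<bar> \<le> real D" using D by (auto simp: field_simps zero_le_divide_iff)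
      then show "norm (representation U x b *\<^sub>R b) \<le> real D * norm b"
        by (simp add: mult_right_mono)
    qed
    finally show "norm x \<le> (\<Sum>b\<in>U. real D * norm b)" .
  qed
  from finite_integer_points[OF this] show ?thesis
    by (rule finite_subset[rotated]) (auto simp: fundamental_points_def)
qed

text \<open>Splitting every coordinate into a multiple of \<open>D\<close> and a remainder in a
  half-open interval writes an integer point of the cone uniquely as \<open>x\<close> plus a natural
  combination \<open>q\<close> of the vectors \<open>D *\<^sub>R b\<close>. A given height fixes the
  sum of \<open>q\<close>, so \<open>multichoose\<close> counts the fiber over \<open>x\<close>; the
  bound on \<open>t\<close> keeps its argument above -(k + 1).\<close>

lemma card_simplicial_cone:
  fixes U :: "(real ^ 'n::finite) set"
  assumes U: "independent U" and card: "card U = Suc k" and D: "D > 0"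
    and int: "\<And>b. b \<in> U \<Longrightarrow> real D *\<^sub>R b \<in> integer_points"
    and \<eta>: "\<And>b. b \<in> U \<Longrightarrow> \<eta> \<bullet> b = 1"
    and w: "\<And>b. b \<in> U \<Longrightarrow> representation U w b \<noteq> 0"
    and t: "\<And>x. x \<in> fundamental_points U D w \<Longrightarrow> \<eta> \<bullet> x < t + real D * real (Suc k)"
  shows "real (card {x \<in> integer_points \<inter> simplicial_cone U w. \<eta> \<bullet> x = t}) =
    (\<Sum>x\<in>fundamental_points U D w. multichoose k ((t - \<eta> \<bullet> x) / real D))"
    and "finite {x \<in> integer_points \<inter> simplicial_cone U w. \<eta> \<bullet> x = t}"
proof -
  have fU: "finite U" using U independent_imp_finite by blast
  define Q where "Q x = {q \<in> U \<rightarrow>\<^sub>E (UNIV :: nat set). real (sum q U) = (t - \<eta> \<bullet> x) / real D}" for x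
  define F where "F = (\<lambda>(x, q :: real ^ 'n \<Rightarrow> nat). x + (\<Sum>b\<in>U. (real D * real (q b)) *\<^sub>R b))"
  let ?\<Pi> = "fundamental_points U D w"
  let ?T = "{x \<in> integer_points \<inter> simplicial_cone U w. \<eta> \<bullet> x = t}"
  have rep: "representation U (F (x, q)) b = representation U x b + real D * real (q b)"
    if "x \<in> ?\<Pi>" "b \<in> U" for x q b
    using representation_add_sum[OF U that(2), of x "\<lambda>b. real D * real (q b)"] that(1)
    by (simp add: F_def fundamental_points_def)
  have finQ: "finite (Q x)" for x
  proof (cases "\<exists>N. (t - \<eta> \<bullet> x) / real D = real N")
    case True
    then obtain N where N: "(t - \<eta> \<bullet> x) / real D = real N" by blast
    have "Q x = {q \<in> U \<rightarrow>\<^sub>E (UNIV :: nat set). sum q U = N}" by (auto simp: Q_def N simp del: of_nat_sum)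
    moreover have "U \<noteq> {}" using card by auto
    ultimately show ?thesis using card_compositions[OF fU] by simp
  next
    case False
    then have "Q x = {}" unfolding Q_def by (metis (mono_tags, lifting) Collect_empty_eq)
    then show ?thesis by simp
  qed
  have \<eta>F: "\<eta> \<bullet> F (x, q) = \<eta> \<bullet> x + real D * real (sum q U)" for x q
    using \<eta> by (simp add: F_def inner_add_right inner_sum_right sum_distrib_left)
  have F_span: "F (x, q) \<in> span U" "F (x, q) \<in> integer_points" if "x \<in> ?\<Pi>" for x q
  proof -
    have "x \<in> span U" using that by (simp add: fundamental_points_def)
    then show "F (x, q) \<in> span U"
      unfolding F_def prod.case by (rule span_add[OF _ span_sum]) (intro span_scale span_base)
    have "real (q b) *\<^sub>R (real D *\<^sub>R b) \<in> integer_points" if "b \<in> U" for b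
      by (rule integer_points_scale[OF Ints_of_nat int[OF that]])
    then have "(\<Sum>b\<in>U. (real D * real (q b)) *\<^sub>R b) \<in> integer_points"
      by (intro integer_points_sum) (simp add: mult.commute)
    then show "F (x, q) \<in> integer_points" using that
      by (auto simp: F_def fundamental_points_def intro: integer_points_add)
  qed
  have bij: "bij_betw F (Sigma ?\<Pi> Q) ?T"
    unfolding bij_betw_def
  proof
    show "inj_on F (Sigma ?\<Pi> Q)"
    proof (rule inj_onI, clarify)
      fix x q x' q' assume x: "x \<in> ?\<Pi>" "x' \<in> ?\<Pi>" and q: "q \<in> Q x" "q' \<in> Q x'" and eq: "F (x, q) = F (x', q')"
      have "q b = q' b" if b: "b \<in> U" for b
      proof -
        define l where "l = representation U x b / real D"
        define l' where "l' = representation U x' b / real D"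
        have "representation U x b + real D * real (q b) = representation U x' b + real D * real (q' b)"
          using rep[OF x(1) b, of q] rep[OF x(2) b, of q'] eq by simp
        then have "l + real (q b) = l' + real (q' b)"
          using D by (simp add: l_def l'_def field_simps)
        moreover have "l \<in> (if representation U w b > 0 then {0..<1} else {0<..1})"
          "l' \<in> (if representation U w b > 0 then {0..<1} else {0<..1})"
          using x b by (auto simp: l_def l'_def fundamental_points_def)
        \<comment> \<open>Two numbers in the same half-open unit interval differ by less than
          1.\<close>
        ultimately have "\<bar>real (q b) - real (q' b)\<bar> < 1" by (auto split: if_splits)
        then show ?thesis by linarith
      qed
      then have "q = q'" using q by (auto simp: Q_def intro: PiE_ext)
      then show "x = x' \<and> q = q'" using eq by (simp add: F_def)
    qed
    show "F ` Sigma ?\<Pi> Q = ?T"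
    proof (intro set_eqI iffI)
      fix z assume "z \<in> F ` Sigma ?\<Pi> Q"
      then obtain x q where x: "x \<in> ?\<Pi>" and q: "q \<in> Q x" and z: "z = F (x, q)" by auto
      have "lexnn (representation U z b) (representation U w b)" if b: "b \<in> U" for b
      proof -
        have "representation U x b / real D \<in> (if representation U w b > 0 then {0..<1} else {0<..1})"
          using x b by (simp add: fundamental_points_def)
        then have "representation U x b \<ge> 0" "representation U w b > 0 \<or> representation U x b > 0"
          using D by (auto simp: zero_le_divide_iff zero_less_divide_iff split: if_splits)
        then show ?thesis
          using rep[OF x b, of q] D unfolding z lexnn_def
          by (smt (verit) mult_nonneg_nonneg of_nat_0_le_iff)
      qed
      moreover have "\<eta> \<bullet> z = t" using q D unfolding z \<eta>F by (simp add: Q_def field_simps)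
      ultimately show "z \<in> ?T" using F_span[OF x] z by (simp add: simplicial_cone_def)
    next
      fix z assume z: "z \<in> ?T"
      define l where "l b = representation U z b / real D" for b
      \<comment> \<open>On a removed facet the remainder lies in (0,1], so the quotient is the
        ceiling minus 1 instead of the floor.\<close>
      define q where "q = restrict (\<lambda>b. nat (if representation U w b > 0 then \<lfloor>l b\<rfloor> else \<lceil>l b\<rceil> - 1)) U"
      define x where "x = z + (\<Sum>b\<in>U. (- real D * real (q b)) *\<^sub>R b)"
      have zs: "z \<in> span U" using z by (simp add: simplicial_cone_def)
      have l: "l b - real (q b) \<in> (if representation U w b > 0 then {0..<1} else {0<..1})" if b: "b \<in> U" for b
      proof -
        have lx: "lexnn (representation U z b) (representation U w b)"
          using z b by (simp add: simplicial_cone_def)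
        show ?thesis
        proof (cases "representation U w b > 0")
          case True
          then have "l b \<ge> 0" using lx D by (auto simp: l_def lexnn_def)
          then have "real (q b) = of_int \<lfloor>l b\<rfloor>" using True b by (simp add: q_def)
          then show ?thesis using True by simp linarith
        next
          case False
          then have "l b > 0" using lx D w[OF b] by (auto simp: l_def lexnn_def)
          then have "\<lceil>l b\<rceil> \<ge> 1" by linarith
          then have "real (q b) = of_int (\<lceil>l b\<rceil> - 1)" using False b by (simp add: q_def)
          then show ?thesis using False by simp linarith
        qed
      qed
      have repx: "representation U x b = representation U z b - real D * real (q b)" if "b \<in> U" for b
        using representation_add_sum[OF U that zs, of "\<lambda>b. - real D * real (q b)"] by (simp add: x_def)
      have "real (q b) *\<^sub>R (real D *\<^sub>R b) \<in> integer_points" if "b \<in> U" for b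
        by (rule integer_points_scale[OF Ints_of_nat int[OF that]])
      then have "(\<Sum>b\<in>U. (real D * real (q b)) *\<^sub>R b) \<in> integer_points"
        by (intro integer_points_sum) (simp add: mult.commute)
      then have "x \<in> integer_points"
        using z by (auto simp: x_def sum_negf intro!: integer_points_diff)
      moreover have "x \<in> span U"
        unfolding x_def using zs by (rule span_add[OF _ span_sum]) (intro span_scale span_base)
      ultimately have x\<Pi>: "x \<in> ?\<Pi>"
        using l repx D by (auto simp: fundamental_points_def l_def diff_divide_distrib)
      have zF: "z = F (x, q)" by (simp add: F_def x_def sum_negf)
      have "\<eta> \<bullet> x + real D * real (sum q U) = t" using \<eta>F[of x q] z zF by simp
      then have "real (sum q U) = (t - \<eta> \<bullet> x) / real D" using D by (simp add: field_simps)
      then have "q \<in> Q x" by (simp add: Q_def q_def)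
      then show "z \<in> F ` Sigma ?\<Pi> Q" using zF x\<Pi> by blast
    qed
  qed
  have fin\<Pi>: "finite ?\<Pi>" by (rule finite_fundamental_points[OF U D])
  have "card ?T = card (Sigma ?\<Pi> Q)" using bij_betw_same_card[OF bij] by simp
  also have "\<dots> = (\<Sum>x\<in>?\<Pi>. card (Q x))" using fin\<Pi> finQ by (intro card_SigmaI) auto
  finally have "real (card ?T) = (\<Sum>x\<in>?\<Pi>. real (card (Q x)))" by simp
  also have "\<dots> = (\<Sum>x\<in>?\<Pi>. multichoose k ((t - \<eta> \<bullet> x) / real D))"
  proof (rule sum.cong)
    fix x assume "x \<in> ?\<Pi>"
    then have "(t - \<eta> \<bullet> x) / real D > - real (Suc k)"
      using t D by (fastforce simp: field_simps)
    then show "real (card (Q x)) = multichoose k ((t - \<eta> \<bullet> x) / real D)"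
      unfolding Q_def using multichoose_eq_card[OF fU card] by blast
  qed simp
  finally show "real (card ?T) = (\<Sum>x\<in>?\<Pi>. multichoose k ((t - \<eta> \<bullet> x) / real D))" .
  have "finite (Sigma ?\<Pi> Q)" using fin\<Pi> finQ by auto
  then show "finite ?T" using bij_betw_finite[OF bij] by simp
qed

text \<open>The reflection taking \<open>x\<close> to \<open>c - x\<close> exchanges [0,1) and (0,1]
  in every coordinate. The height of \<open>c\<close> is \<open>D * (k + 1)\<close>, which after
  division by \<open>D\<close> is exactly the shift in
  \<open>multichoose_reciprocity\<close>.\<close>

lemma fundamental_points_reciprocity:
  fixes U :: "(real ^ 'n::finite) set"
  assumes U: "independent U" and card: "card U = Suc k" and D: "D > 0"
    and int: "\<And>b. b \<in> U \<Longrightarrow> real D *\<^sub>R b \<in> integer_points"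
    and \<eta>: "\<And>b. b \<in> U \<Longrightarrow> \<eta> \<bullet> b = 1"
    and w: "\<And>b. b \<in> U \<Longrightarrow> representation U w b \<noteq> 0" "w \<in> span U"
  shows "(\<Sum>x\<in>fundamental_points U D (- w). multichoose k ((t - \<eta> \<bullet> x) / real D)) =
    (-1) ^ k * (\<Sum>x\<in>fundamental_points U D w. multichoose k ((- t - \<eta> \<bullet> x) / real D))"
proof -
  define c where "c = (\<Sum>b\<in>U. real D *\<^sub>R b)"
  have c: "c \<in> integer_points" "c \<in> span U"
    unfolding c_def by (intro integer_points_sum int, assumption) (intro span_sum span_scale span_base)
  have repc: "representation U (c - x) b = real D - representation U x b"
    if "x \<in> span U" "b \<in> U" for x b
    using representation_sum_scale[OF U that(2), of "\<lambda>_. real D"] that c U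
    by (simp add: representation_diff c_def)
  have repw: "representation U (- w) b = - representation U w b" for b
    using U w(2) by (simp add: representation_neg)
  have \<eta>c: "\<eta> \<bullet> c = real D * real (Suc k)" using \<eta> card by (simp add: c_def inner_sum_right)
  have refl: "c - x \<in> fundamental_points U D v'"
    if x: "x \<in> fundamental_points U D v"
      and v: "\<And>b. b \<in> U \<Longrightarrow> representation U v' b > 0 \<longleftrightarrow> \<not> representation U v b > 0" for x v v'
  proof -
    have xs: "x \<in> span U" "x \<in> integer_points" using x by (auto simp: fundamental_points_def)
    have "representation U (c - x) b / real D \<in> (if representation U v' b > 0 then {0..<1} else {0<..1})"
      if b: "b \<in> U" for b
    proof -
      have "representation U x b / real D \<in> (if representation U v b > 0 then {0..<1} else {0<..1})"
        using x b by (simp add: fundamental_points_def)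
      moreover have "representation U (c - x) b / real D = 1 - representation U x b / real D"
        using repc[OF xs(1) b] D by (simp add: diff_divide_distrib)
      ultimately show ?thesis using v[OF b] by (auto split: if_splits)
    qed
    then show ?thesis using xs c
      by (auto simp: fundamental_points_def intro: span_diff integer_points_diff)
  qed
  have sgn: "representation U w b > 0 \<longleftrightarrow> \<not> representation U (- w) b > 0"
    "representation U (- w) b > 0 \<longleftrightarrow> \<not> representation U w b > 0" if "b \<in> U" for b
    using w(1)[OF that] repw[of b] by linarith+
  have "(\<Sum>x\<in>fundamental_points U D (- w). multichoose k ((t - \<eta> \<bullet> x) / real D)) =
     (\<Sum>x\<in>fundamental_points U D w. multichoose k ((t - \<eta> \<bullet> (c - x)) / real D))"
    by (rule sum.reindex_bij_witness[of _ "\<lambda>x. c - x" "\<lambda>x. c - x"])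
       (use refl sgn in \<open>auto\<close>)
  also have "\<dots> = (\<Sum>x\<in>fundamental_points U D w. (-1) ^ k * multichoose k ((- t - \<eta> \<bullet> x) / real D))"
  proof (rule sum.cong)
    fix x
    have "(t - \<eta> \<bullet> (c - x)) / real D = - ((- t - \<eta> \<bullet> x) / real D) - real (Suc k)"
      using D by (simp add: inner_diff_right \<eta>c field_simps)
    then show "multichoose k ((t - \<eta> \<bullet> (c - x)) / real D) = (-1) ^ k * multichoose k ((- t - \<eta> \<bullet> x) / real D)"
      using multichoose_reciprocity by simp
  qed simp
  finally show ?thesis by (simp add: sum_distrib_left)
qed


text \<open>A moment curve starting at \<open>p\<close> stays in the kernel and meets each proper
  rational hyperplane of the kernel in finitely many parameters. There are only countably many such
  hyperplanes, so some point of the curve near \<open>p\<close> avoids them all, and nearness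
  preserves the strict inequalities.\<close>

lemma ex_generic_point:
  fixes C A :: "(real ^ 'n::finite) set"
  assumes C: "C \<subseteq> rational_points" and p: "\<forall>c\<in>C. c \<bullet> p = 0"
    and A: "finite A" "\<forall>a\<in>A. a \<bullet> p > 0"
  obtains w where "relation_space w = {x. \<forall>c\<in>C. c \<bullet> x = 0}" "\<forall>a\<in>A. a \<bullet> w > 0"
proof -
  let ?W = "{x. \<forall>c\<in>C. c \<bullet> x = 0}"
  obtain F where F: "F \<subseteq> ?W \<inter> rational_points" "independent F" "?W \<inter> rational_points \<subseteq> span F"
    using maximal_independent_subset by blast
  have WF: "?W \<subseteq> span F"
    using rational_kernel_span[OF C] span_mono[OF F(3)] by (auto simp: span_span)
  have "finite F" using F(2) independent_imp_finite by blast
  then obtain f where f: "bij_betw f {0..<card F} F" using ex_bij_betw_nat_finite by blast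
  define r where "r = card F"
  have fF: "f i \<in> F" if "i < r" for i using f that by (auto simp: r_def bij_betw_def)
  have Ff: "\<exists>i<r. f i = x" if "x \<in> F" for x
    using f that unfolding r_def bij_betw_def by (metis atLeastLessThan_iff imageE)
  define w where "w \<theta> = p + (\<Sum>i<r. \<theta> ^ Suc i *\<^sub>R f i)" for \<theta> :: real
  have "c \<bullet> f i = 0" if "c \<in> C" "i < r" for c i using fF[OF that(2)] F(1) that(1) by blast
  then have wW: "w \<theta> \<in> ?W" for \<theta>
    using p by (simp add: w_def inner_add_right inner_sum_right)
  have cw: "c \<bullet> w \<theta> = (\<Sum>i\<le>r. (if i = 0 then c \<bullet> p else c \<bullet> f (i - 1)) * \<theta> ^ i)" for c \<theta>
    by (subst sum.atMost_shift) (simp add: w_def inner_add_right inner_sum_right mult.commute)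
  define B where "B = {c \<in> rational_points. \<not> ?W \<subseteq> {x. c \<bullet> x = 0}}"
  have "finite {\<theta>. c \<bullet> w \<theta> = 0}" if c: "c \<in> B" for c
  proof -
    have "\<exists>i<r. c \<bullet> f i \<noteq> 0"
    proof (rule ccontr)
      assume "\<not> (\<exists>i<r. c \<bullet> f i \<noteq> 0)"
      then have "F \<subseteq> {x. c \<bullet> x = 0}" using Ff by blast
      then have "span F \<subseteq> {x. c \<bullet> x = 0}"
        using span_minimal[OF _ subspace_kernel[of "{c}"]] by simp
      then show False using c WF by (auto simp: B_def)
    qed
    then obtain i where "i < r" "c \<bullet> f i \<noteq> 0" by blast
    then have "\<exists>j\<le>r. (if j = 0 then c \<bullet> p else c \<bullet> f (j - 1)) \<noteq> 0"
      by (intro exI[of _ "Suc i"]) auto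
    then show ?thesis unfolding cw by (subst polyfun_finite_roots)
  qed
  moreover have "countable B" unfolding B_def
    by (rule countable_subset[OF _ countable_rational_points]) auto
  ultimately have cnt: "countable (\<Union>c\<in>B. {\<theta>. c \<bullet> w \<theta> = 0})"
    by (intro countable_UN) (auto intro: countable_finite)
  have "\<forall>\<^sub>F \<theta> in at_right 0. \<forall>a\<in>A. a \<bullet> w \<theta> > 0"
  proof (rule eventually_ball_finite[OF A(1)], rule ballI)
    fix a assume a: "a \<in> A"
    have "((\<lambda>\<theta>. a \<bullet> w \<theta>) \<longlongrightarrow> a \<bullet> (p + (\<Sum>i<r. 0 ^ Suc i *\<^sub>R f i))) (at_right 0)"
      unfolding w_def by (intro tendsto_intros)
    then have "((\<lambda>\<theta>. a \<bullet> w \<theta>) \<longlongrightarrow> a \<bullet> p) (at_right 0)" by simp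
    then show "\<forall>\<^sub>F \<theta> in at_right 0. a \<bullet> w \<theta> > 0" using A(2) a by (intro order_tendstoD) auto
  qed
  then obtain \<delta> where \<delta>: "\<delta> > 0" "\<And>\<theta>. 0 < \<theta> \<Longrightarrow> \<theta> < \<delta> \<Longrightarrow> \<forall>a\<in>A. a \<bullet> w \<theta> > 0"
    unfolding eventually_at_right_field by blast
  have "\<not> {0<..<\<delta>} \<subseteq> (\<Union>c\<in>B. {\<theta>. c \<bullet> w \<theta> = 0})"
    using cnt uncountable_open_interval[of 0 \<delta>] \<delta>(1) countable_subset by blast
  then obtain \<theta> where \<theta>: "0 < \<theta>" "\<theta> < \<delta>" "\<And>c. c \<in> B \<Longrightarrow> c \<bullet> w \<theta> \<noteq> 0"
    unfolding subset_iff UN_iff mem_Collect_eq greaterThanLessThan_iff by blast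
  have "relation_space (w \<theta>) = ?W"
  proof
    show "relation_space (w \<theta>) \<subseteq> ?W" using wW[of \<theta>] C by (auto simp: relation_space_def)
    show "?W \<subseteq> relation_space (w \<theta>)" using \<theta>(3) unfolding relation_space_def B_def by blast
  qed
  then show ?thesis using that \<delta>(2)[OF \<theta>(1,2)] by blast
qed

lemma card_disjoint_cover:
  assumes "finite \<U>" "\<And>U. U \<in> \<U> \<Longrightarrow> finite (X U)" "\<And>U. U \<in> \<U> \<Longrightarrow> X U \<subseteq> S"
    "\<And>x. x \<in> S \<Longrightarrow> \<exists>!U. U \<in> \<U> \<and> x \<in> X U"
  shows "card S = (\<Sum>U\<in>\<U>. card (X U))"
proof -
  have "S = (\<Union>U\<in>\<U>. X U)" using assms(3,4) by blast
  moreover have "card (\<Union>U\<in>\<U>. X U) = (\<Sum>U\<in>\<U>. card (X U))"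
    using assms by (intro card_UN_disjoint) blast+
  ultimately show ?thesis by simp
qed

text \<open>Since every constraint is positive at \<open>w\<close>, the choice \<open>e = 1\<close>
  resolves a vanishing constraint in favor of the point and \<open>e = -1\<close> against it: the
  two partitions count the closed and the open cone. Fixing the height lowers the degree from
  \<open>Suc k\<close> to \<open>k\<close>.\<close>

theorem rational_cone_reciprocity:
  fixes C A :: "(real ^ 'n::finite) set"
  assumes C: "C \<subseteq> rational_points" and W: "W = {x. \<forall>c\<in>C. c \<bullet> x = 0}"
    and A: "finite A" "A \<subseteq> rational_points" "A \<noteq> {}" and \<eta>: "\<eta> \<in> rational_points"
    and p: "p \<in> W" "\<forall>a\<in>A. a \<bullet> p > 0"
    and pointed: "\<And>x. x \<in> W \<Longrightarrow> x \<noteq> 0 \<Longrightarrow> \<forall>a\<in>A. a \<bullet> x \<ge> 0 \<Longrightarrow> \<eta> \<bullet> x > 0"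
    and k: "dim W = Suc k"
  shows "\<exists>Q. quasipoly_le k Q \<and>
    (\<forall>t\<ge>0. Q t = real (card {x \<in> integer_points \<inter> W. (\<forall>a\<in>A. a \<bullet> x \<ge> 0) \<and> \<eta> \<bullet> x = of_int t})) \<and>
    (\<forall>t\<ge>1. (-1) ^ k * Q (- t) =
      real (card {x \<in> integer_points \<inter> W. (\<forall>a\<in>A. a \<bullet> x > 0) \<and> \<eta> \<bullet> x = of_int t}))"
proof -
  obtain w where w: "relation_space w = W" "\<forall>a\<in>A. a \<bullet> w > 0"
    using ex_generic_point[OF C, of p A] p A(1) W by blast
  have wW: "w \<in> W" using w(1) self_in_relation_space by blast
  obtain \<U> where fin: "finite \<U>"
    and props: "\<forall>U\<in>\<U>. independent U \<and> U \<subseteq> rational_points \<and> span U = relation_space w \<and>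
      (\<forall>b\<in>U. \<eta> \<bullet> b = 1 \<and> (\<forall>a\<in>A. a \<bullet> b \<ge> 0) \<and> representation U w b \<noteq> 0)"
    and cover: "\<forall>e\<in>{1,-1}. \<forall>x\<in>relation_space w. (\<forall>a\<in>A. lexnn (a \<bullet> x) (e * (a \<bullet> w))) \<longrightarrow>
      (\<exists>!U. U \<in> \<U> \<and> x \<in> simplicial_cone U (e *\<^sub>R w))"
  proof -
    have "\<forall>x\<in>relation_space w. x \<noteq> 0 \<longrightarrow> (\<forall>a\<in>A. a \<bullet> x \<ge> 0) \<longrightarrow> \<eta> \<bullet> x > 0"
      using pointed w(1) by blast
    from cone_decomposition[OF A(1,2) \<eta> this] show ?thesis
      by (elim exE conjE) (rule that)
  qed
  have U: "independent U" "U \<subseteq> rational_points" "span U = W" "\<And>b. b \<in> U \<Longrightarrow> \<eta> \<bullet> b = 1"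
    "\<And>b a. b \<in> U \<Longrightarrow> a \<in> A \<Longrightarrow> a \<bullet> b \<ge> 0" "\<And>b. b \<in> U \<Longrightarrow> representation U w b \<noteq> 0"
    "finite U" "card U = Suc k" if "U \<in> \<U>" for U
  proof -
    show U: "independent U" "U \<subseteq> rational_points" "span U = W" "\<And>b. b \<in> U \<Longrightarrow> \<eta> \<bullet> b = 1"
      "\<And>b a. b \<in> U \<Longrightarrow> a \<in> A \<Longrightarrow> a \<bullet> b \<ge> 0" "\<And>b. b \<in> U \<Longrightarrow> representation U w b \<noteq> 0"
      using props that w(1) by auto
    show "finite U" using U(1) independent_imp_finite by blast
    show "card U = Suc k" using dim_span_eq_card_independent[OF U(1)] U(3) k by simp
  qed
  have "finite (\<Union>\<U>)" "\<Union>\<U> \<subseteq> rational_points" using fin U(2,7) by auto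
  then obtain D where D: "D > 0" "\<And>b. b \<in> \<Union>\<U> \<Longrightarrow> real D *\<^sub>R b \<in> integer_points"
    using ex_common_denominator by blast
  define G where "G v t = (\<Sum>U\<in>\<U>. \<Sum>x\<in>fundamental_points U D v. multichoose k ((t - \<eta> \<bullet> x) / real D))"
    for v t
  have height: "\<eta> \<bullet> x = (\<Sum>b\<in>U. representation U x b)" if "U \<in> \<U>" "x \<in> span U" for U x
    using inner_representation[OF U(1)[OF that(1)] that(2), of \<eta>] U(4)[OF that(1)] by simp
  have le: "representation U x b \<le> real D" if "U \<in> \<U>" "x \<in> fundamental_points U D v" "b \<in> U" for U x v b
    using that(2,3) D(1) by (fastforce simp: fundamental_points_def field_simps split: if_splits)
  have height_le: "\<eta> \<bullet> x \<le> real D * real (Suc k)" if "U \<in> \<U>" "x \<in> fundamental_points U D v" for U x v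
  proof -
    have "\<eta> \<bullet> x = (\<Sum>b\<in>U. representation U x b)"
      using height[OF that(1)] that(2) by (simp add: fundamental_points_def)
    also have "\<dots> \<le> (\<Sum>b\<in>U. real D)" by (intro sum_mono le[OF that])
    finally show ?thesis using U(8)[OF that(1)] by (simp add: mult.commute)
  qed
  \<comment> \<open>Strictness makes the closed formula valid at t = 0. It holds because
    \<open>w\<close>, being interior, has a positive coordinate, at which remainders stay below 1.
    For \<open>- w\<close> the weak bound is used, so the open formula starts at t = 1.\<close>
  have height_less: "\<eta> \<bullet> x < real D * real (Suc k)" if V: "V \<in> \<U>" and x: "x \<in> fundamental_points V D w" for V x
  proof -
    obtain a where a: "a \<in> A" using A(3) by blast
    have "\<exists>b\<in>V. representation V w b > 0"
    proof (rule ccontr)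
      assume "\<not> (\<exists>b\<in>V. representation V w b > 0)"
      then have "(\<Sum>b\<in>V. (a \<bullet> b) * representation V w b) \<le> 0"
        using U(5)[OF V _ a] by (intro sum_nonpos) (auto simp: mult_le_0_iff not_less)
      then show False
        using inner_representation[OF U(1)[OF V], of w a] U(3)[OF V] wW w(2) a by force
    qed
    then obtain b where b: "b \<in> V" "representation V w b > 0" by blast
    have "\<eta> \<bullet> x = (\<Sum>b\<in>V. representation V x b)"
      using height[OF V] x by (simp add: fundamental_points_def)
    also have "\<dots> < (\<Sum>b\<in>V. real D)"
    proof (rule sum_strict_mono_ex1)
      show "\<exists>b\<in>V. representation V x b < real D"
        using b x D(1) by (intro bexI[of _ b]) (auto simp: fundamental_points_def field_simps)
    qed (use U(7)[OF V] le[OF V x] in auto)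
    finally show ?thesis using U(8)[OF V] by (simp add: mult.commute)
  qed
  have count: "real (card {x \<in> integer_points \<inter> W. (\<forall>a\<in>A. lexnn (a \<bullet> x) (e * (a \<bullet> w))) \<and> \<eta> \<bullet> x = t})
      = G (e *\<^sub>R w) t"
    if e: "e \<in> {1, -1}" and t: "\<And>V x. V \<in> \<U> \<Longrightarrow> x \<in> fundamental_points V D (e *\<^sub>R w) \<Longrightarrow> \<eta> \<bullet> x < t + real D * real (Suc k)"
    for e t
  proof -
    have rep: "representation V (e *\<^sub>R w) b = e * representation V w b" if "V \<in> \<U>" for V b
      using U(1,3)[OF that] wW by (simp add: representation_scale)
    have rep0: "representation V (e *\<^sub>R w) b \<noteq> 0" if "V \<in> \<U>" "b \<in> V" for V b
      using rep[OF that(1)] U(6)[OF that] e by auto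
    let ?X = "\<lambda>V. {x \<in> integer_points \<inter> simplicial_cone V (e *\<^sub>R w). \<eta> \<bullet> x = t}"
    have X: "real (card (?X V)) = (\<Sum>x\<in>fundamental_points V D (e *\<^sub>R w). multichoose k ((t - \<eta> \<bullet> x) / real D))"
      "finite (?X V)" if V: "V \<in> \<U>" for V
      using card_simplicial_cone[OF U(1,8)[OF V] D(1), of \<eta> "e *\<^sub>R w" t] D(2) U(4)[OF V] rep0[OF V] t[OF V] V
      by auto
    have "card {x \<in> integer_points \<inter> W. (\<forall>a\<in>A. lexnn (a \<bullet> x) (e * (a \<bullet> w))) \<and> \<eta> \<bullet> x = t} = (\<Sum>V\<in>\<U>. card (?X V))"
    proof (rule card_disjoint_cover[OF fin])
      fix V assume V: "V \<in> \<U>"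
      show "?X V \<subseteq> {x \<in> integer_points \<inter> W. (\<forall>a\<in>A. lexnn (a \<bullet> x) (e * (a \<bullet> w))) \<and> \<eta> \<bullet> x = t}"
      proof
        fix x assume x: "x \<in> ?X V"
        have "e *\<^sub>R w \<in> span V" using U(3)[OF V] wW span_scale by blast
        then have "lexnn (a \<bullet> x) (a \<bullet> (e *\<^sub>R w))" if "a \<in> A" for a
          using simplicial_cone_lexnn[OF U(1)[OF V]] x U(5)[OF V _ that] by blast
        then show "x \<in> {x \<in> integer_points \<inter> W. (\<forall>a\<in>A. lexnn (a \<bullet> x) (e * (a \<bullet> w))) \<and> \<eta> \<bullet> x = t}"
          using x U(3)[OF V] by (auto simp: simplicial_cone_def)
      qed
    next
      fix x assume x: "x \<in> {x \<in> integer_points \<inter> W. (\<forall>a\<in>A. lexnn (a \<bullet> x) (e * (a \<bullet> w))) \<and> \<eta> \<bullet> x = t}"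
      then have "\<exists>!V. V \<in> \<U> \<and> x \<in> simplicial_cone V (e *\<^sub>R w)"
        using bspec[OF bspec[OF cover e], of x] w(1) by blast
      then show "\<exists>!V. V \<in> \<U> \<and> x \<in> ?X V" using x by simp
    qed (rule X)
    then show ?thesis using X(1) by (simp add: G_def)
  qed
  define Q where "Q t = G w (of_int t)" for t :: int
  have "quasipoly_le k Q"
    unfolding Q_def G_def using D(1) by (intro quasipoly_le_sum quasipoly_le_multichoose)
  moreover have "Q t = real (card {x \<in> integer_points \<inter> W. (\<forall>a\<in>A. a \<bullet> x \<ge> 0) \<and> \<eta> \<bullet> x = of_int t})"
    if t: "t \<ge> 0" for t
  proof -
    have "lexnn (a \<bullet> x) (1 * (a \<bullet> w)) \<longleftrightarrow> a \<bullet> x \<ge> 0" if "a \<in> A" for a x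
      using w(2) that by (auto simp: lexnn_def)
    then have eq: "{x \<in> integer_points \<inter> W. (\<forall>a\<in>A. a \<bullet> x \<ge> 0) \<and> \<eta> \<bullet> x = of_int t} =
        {x \<in> integer_points \<inter> W. (\<forall>a\<in>A. lexnn (a \<bullet> x) (1 * (a \<bullet> w))) \<and> \<eta> \<bullet> x = of_int t}" by auto
    have "\<eta> \<bullet> x < of_int t + real D * real (Suc k)"
      if "V \<in> \<U>" "x \<in> fundamental_points V D (1 *\<^sub>R w)" for V x
    proof -
      have "\<eta> \<bullet> x < real D * real (Suc k)" using height_less that by simp
      moreover have "(0::real) \<le> of_int t" using t by simp
      ultimately show ?thesis by linarith
    qed
    from count[of 1 "of_int t", OF _ this] show ?thesis
      unfolding eq by (simp add: Q_def)
  qed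
  moreover have "(-1) ^ k * Q (- t) = real (card {x \<in> integer_points \<inter> W. (\<forall>a\<in>A. a \<bullet> x > 0) \<and> \<eta> \<bullet> x = of_int t})"
    if t: "t \<ge> 1" for t
  proof -
    have "lexnn (a \<bullet> x) (-1 * (a \<bullet> w)) \<longleftrightarrow> a \<bullet> x > 0" if "a \<in> A" for a x
      using w(2) that by (force simp: lexnn_def)
    then have eq: "{x \<in> integer_points \<inter> W. (\<forall>a\<in>A. a \<bullet> x > 0) \<and> \<eta> \<bullet> x = of_int t} =
        {x \<in> integer_points \<inter> W. (\<forall>a\<in>A. lexnn (a \<bullet> x) (-1 * (a \<bullet> w))) \<and> \<eta> \<bullet> x = of_int t}" by auto
    have "\<eta> \<bullet> x < of_int t + real D * real (Suc k)"
      if "V \<in> \<U>" "x \<in> fundamental_points V D ((-1) *\<^sub>R w)" for V x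
    proof -
      have "(1::real) \<le> of_int t" using t by simp
      then show ?thesis using height_le[OF that] by linarith
    qed
    from count[of "-1" "of_int t", OF _ this]
    have "real (card {x \<in> integer_points \<inter> W. (\<forall>a\<in>A. a \<bullet> x > 0) \<and> \<eta> \<bullet> x = of_int t}) = G (- w) (of_int t)"
      unfolding eq by simp
    also have "\<dots> = (-1) ^ k * G w (- of_int t)"
      unfolding G_def sum_distrib_left[of _ _ \<U>]
    proof (rule sum.cong)
      fix V assume V: "V \<in> \<U>"
      show "(\<Sum>x\<in>fundamental_points V D (- w). multichoose k ((of_int t - \<eta> \<bullet> x) / real D)) =
        (-1) ^ k * (\<Sum>x\<in>fundamental_points V D w. multichoose k ((- of_int t - \<eta> \<bullet> x) / real D))"
        using U(4,6)[OF V] U(3)[OF V] wW D(2) V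
        by (intro fundamental_points_reciprocity[OF U(1,8)[OF V] D(1)]) auto
    qed simp
    finally show ?thesis by (simp add: Q_def)
  qed
  ultimately show ?thesis by blast
qed

section \<open>Lattices and Riemann sums\<close>

lemma subgroup_int_scale:
  fixes \<Lambda> :: "(real ^ 'n) set"
  assumes "0 \<in> \<Lambda>" "\<And>x y. x \<in> \<Lambda> \<Longrightarrow> y \<in> \<Lambda> \<Longrightarrow> x - y \<in> \<Lambda>" "x \<in> \<Lambda>"
  shows "of_int k *\<^sub>R x \<in> \<Lambda>"
proof (induction k rule: int_induct[where k = 0])
  case (step1 i)
  have "0 - x \<in> \<Lambda>" using assms by blast
  then have "of_int i *\<^sub>R x - (0 - x) \<in> \<Lambda>" using step1 assms(2) by blast
  then show ?case by (simp add: algebra_simps)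
next
  case (step2 i)
  then have "of_int i *\<^sub>R x - x \<in> \<Lambda>" using assms by blast
  then show ?case by (simp add: algebra_simps)
qed (use assms in auto)

lemma lattice_basis_subset:
  fixes B :: "(real ^ 'n::finite) set"
  assumes "lattice_basis B \<Lambda>" shows "B \<subseteq> \<Lambda>"
proof
  fix b assume b: "b \<in> B"
  have "finite B" using assms independent_imp_finite by (auto simp: lattice_basis_def)
  then have "(\<Sum>b'\<in>B. of_int (if b' = b then 1 else 0) *\<^sub>R b') = b"
    using b by (simp add: if_distrib[of "\<lambda>x. of_int x *\<^sub>R _"] cong: if_cong)
  then have "b \<in> range (\<lambda>z :: real ^ 'n \<Rightarrow> int. \<Sum>b\<in>B. of_int (z b) *\<^sub>R b)"
    by (intro range_eqI[of _ _ "\<lambda>b'. if b' = b then 1 else 0"]) simp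
  then show "b \<in> \<Lambda>" using assms by (simp add: lattice_basis_def)
qed

text \<open>Induction on the coordinates that may be nonzero. Division with remainder by a vector
  \<open>v\<close> of least positive \<open>j\<close>-th coordinate sends every lattice vector into
  the sublattice where that coordinate is 0, so \<open>v\<close> extends a basis of the
  sublattice.\<close>

lemma ex_lattice_basis_support:
  fixes \<Lambda> :: "(real ^ 'n::finite) set"
  assumes "finite J" "\<Lambda> \<subseteq> integer_points" "0 \<in> \<Lambda>" "\<And>x y. x \<in> \<Lambda> \<Longrightarrow> y \<in> \<Lambda> \<Longrightarrow> x - y \<in> \<Lambda>"
    "\<And>x j. x \<in> \<Lambda> \<Longrightarrow> j \<notin> J \<Longrightarrow> x $ j = 0"
  shows "\<exists>B. lattice_basis B \<Lambda>"
  using assms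
proof (induction J arbitrary: \<Lambda> rule: finite_induct)
  case empty
  then have "\<Lambda> = {0}" by (auto simp: vec_eq_iff)
  then have "lattice_basis {} \<Lambda>" by (auto simp: lattice_basis_def independent_empty)
  then show ?case by blast
next
  case (insert j J)
  define \<Lambda>0 where "\<Lambda>0 = {x \<in> \<Lambda>. x $ j = 0}"
  have "\<exists>B. lattice_basis B \<Lambda>0"
  proof (rule insert.IH)
    fix x i assume "x \<in> \<Lambda>0" "i \<notin> J"
    then show "x $ i = 0" using insert.prems(4)[of x i] by (cases "i = j") (auto simp: \<Lambda>0_def)
  qed (use insert.prems in \<open>auto simp: \<Lambda>0_def\<close>)
  then obtain B0 where B0: "lattice_basis B0 \<Lambda>0" by blast
  show ?case
  proof (cases "\<Lambda> = \<Lambda>0")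
    case True
    then show ?thesis using B0 by blast
  next
    case False
    then obtain x0 where x0: "x0 \<in> \<Lambda>" "x0 $ j \<noteq> 0" by (auto simp: \<Lambda>0_def)
    have "\<exists>x. x \<in> \<Lambda> \<and> x $ j > 0"
    proof (cases "x0 $ j > 0")
      case False
      have "0 - x0 \<in> \<Lambda>" using insert.prems x0 by blast
      moreover have "(0 - x0) $ j > 0" using False x0 by simp
      ultimately show ?thesis by blast
    qed (use x0 in blast)
    then obtain x1 where x1: "x1 \<in> \<Lambda> \<and> x1 $ j > 0" by blast
    \<comment> \<open>The coordinates are integers; \<open>nat\<close> and floor only turn them into
      a measure with natural values.\<close>
    obtain v where v: "v \<in> \<Lambda>" "v $ j > 0"
      and vmin: "\<And>y. y \<in> \<Lambda> \<Longrightarrow> y $ j > 0 \<Longrightarrow> nat \<lfloor>v $ j\<rfloor> \<le> nat \<lfloor>y $ j\<rfloor>"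
      using ex_has_least_nat[of "\<lambda>x. x \<in> \<Lambda> \<and> x $ j > 0", OF x1, of "\<lambda>x. nat \<lfloor>x $ j\<rfloor>"] by blast
    have red: "\<exists>q. x - of_int q *\<^sub>R v \<in> \<Lambda>0" if x: "x \<in> \<Lambda>" for x
    proof -
      define q where "q = \<lfloor>x $ j / v $ j\<rfloor>"
      define y where "y = x - of_int q *\<^sub>R v"
      have y: "y \<in> \<Lambda>"
        unfolding y_def using insert.prems x v subgroup_int_scale[of \<Lambda> v q] by blast
      have yj: "y $ j = v $ j * (x $ j / v $ j - of_int q)" using v by (simp add: y_def field_simps)
      have "x $ j / v $ j - of_int q \<ge> 0" "x $ j / v $ j - of_int q < 1"
        unfolding q_def by linarith+
      then have yb: "0 \<le> y $ j" "y $ j < v $ j"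
        unfolding yj using v(2) by (auto simp: mult_less_cancel_left2)
      have "y $ j = 0"
      proof (rule ccontr)
        assume "y $ j \<noteq> 0"
        then have "nat \<lfloor>v $ j\<rfloor> \<le> nat \<lfloor>y $ j\<rfloor>" using vmin y yb by simp
        moreover have "v $ j \<in> \<int>" "y $ j \<in> \<int>"
          using insert.prems(1) v(1) y by (auto simp: integer_points_def)
        then obtain m n where "v $ j = of_int m" "y $ j = of_int n" by (auto elim!: Ints_cases)
        ultimately show False using yb v(2) by simp
      qed
      then show ?thesis using y by (auto simp: \<Lambda>0_def y_def)
    qed
    have ind0: "independent B0" and range0: "\<Lambda>0 = range (\<lambda>z. \<Sum>b\<in>B0. of_int (z b) *\<^sub>R b)"
      using B0 by (auto simp: lattice_basis_def)
    have fB0: "finite B0" using ind0 independent_imp_finite by blast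
    have "span B0 \<subseteq> {x. \<forall>c\<in>{axis j 1}. c \<bullet> x = 0}"
      using lattice_basis_subset[OF B0]
      by (intro span_minimal subspace_kernel) (auto simp: \<Lambda>0_def inner_axis')
    then have vB0: "v \<notin> span B0" using v(2) by (auto simp: inner_axis')
    then have vB0': "v \<notin> B0" using span_base by blast
    have "\<Lambda> = range (\<lambda>z. \<Sum>b\<in>insert v B0. of_int (z b) *\<^sub>R b)"
    proof (intro set_eqI iffI)
      fix x assume "x \<in> \<Lambda>"
      then obtain q where "x - of_int q *\<^sub>R v \<in> \<Lambda>0" using red by blast
      then obtain z where z: "x - of_int q *\<^sub>R v = (\<Sum>b\<in>B0. of_int (z b) *\<^sub>R b)" using range0 by auto
      have "(\<Sum>b\<in>B0. of_int ((z(v := q)) b) *\<^sub>R b) = (\<Sum>b\<in>B0. of_int (z b) *\<^sub>R b)"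
        using vB0' by (intro sum.cong) auto
      then have "x = (\<Sum>b\<in>insert v B0. of_int ((z(v := q)) b) *\<^sub>R b)"
        using z fB0 vB0' by (simp add: algebra_simps)
      then show "x \<in> range (\<lambda>z. \<Sum>b\<in>insert v B0. of_int (z b) *\<^sub>R b)" by blast
    next
      fix x assume "x \<in> range (\<lambda>z. \<Sum>b\<in>insert v B0. of_int (z b) *\<^sub>R b)"
      then obtain z where x: "x = of_int (z v) *\<^sub>R v + (\<Sum>b\<in>B0. of_int (z b) *\<^sub>R b)"
        using fB0 vB0' by auto
      have 1: "(\<Sum>b\<in>B0. of_int (z b) *\<^sub>R b) \<in> \<Lambda>" using range0 by (auto simp: \<Lambda>0_def)
      have 2: "of_int (- z v) *\<^sub>R v \<in> \<Lambda>" using insert.prems v subgroup_int_scale by blast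
      have "(\<Sum>b\<in>B0. of_int (z b) *\<^sub>R b) - of_int (- z v) *\<^sub>R v \<in> \<Lambda>"
        by (rule insert.prems(3)[OF 1 2])
      then show "x \<in> \<Lambda>" by (simp add: x add.commute)
    qed
    then have "lattice_basis (insert v B0) \<Lambda>"
      using ind0 vB0 by (simp add: lattice_basis_def independent_insert)
    then show ?thesis by blast
  qed
qed

lemma ex_lattice_basis:
  fixes C :: "(real ^ 'n::finite) set"
  shows "\<exists>B. lattice_basis B (integer_points \<inter> {x. \<forall>c\<in>C. c \<bullet> x = 0})"
  by (rule ex_lattice_basis_support[of UNIV]) (auto simp: inner_diff_right intro: integer_points_diff)

text \<open>The rational points span the kernel, and each has a positive integer multiple in the
  lattice.\<close>

lemma span_lattice_basis:
  fixes C :: "(real ^ 'n::finite) set"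
  assumes C: "C \<subseteq> rational_points"
    and B: "lattice_basis B (integer_points \<inter> {x. \<forall>c\<in>C. c \<bullet> x = 0})"
  shows "span B = {x. \<forall>c\<in>C. c \<bullet> x = 0}"
proof
  let ?V = "{x. \<forall>c\<in>C. c \<bullet> x = 0}"
  show "span B \<subseteq> ?V"
    using lattice_basis_subset[OF B] by (intro span_minimal subspace_kernel) auto
  have "?V \<inter> rational_points \<subseteq> span B"
  proof
    fix x assume x: "x \<in> ?V \<inter> rational_points"
    then obtain D where D: "D > 0" "real D *\<^sub>R x \<in> integer_points"
      using ex_common_denominator[of "{x}"] by auto
    then have "real D *\<^sub>R x \<in> integer_points \<inter> ?V" using x by auto
    then obtain z where "real D *\<^sub>R x = (\<Sum>b\<in>B. of_int (z b) *\<^sub>R b)"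
      using B unfolding lattice_basis_def by auto
    then have "real D *\<^sub>R x \<in> span B"
      by (simp only:) (rule span_sum, rule span_scale, rule span_base)
    then have "(1 / real D) *\<^sub>R (real D *\<^sub>R x) \<in> span B" by (rule span_scale)
    then show "x \<in> span B" using D(1) by simp
  qed
  then show "?V \<subseteq> span B"
    using rational_kernel_span[OF C] span_mono[of _ "span B"] by (auto simp: span_span)
qed

text \<open>Integrate over the coordinate \<open>b0\<close> first: on each line parallel to its axis
  the equation has at most one solution.\<close>

lemma null_hyperplane_PiM:
  fixes \<alpha> :: "'b \<Rightarrow> real"
  assumes B: "finite B" and b0: "b0 \<in> B" "\<alpha> b0 \<noteq> 0"
  shows "{u \<in> B \<rightarrow>\<^sub>E UNIV. c + (\<Sum>b\<in>B. u b * \<alpha> b) = 0} \<in> null_sets (Pi\<^sub>M B (\<lambda>_. lborel))"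
proof -
  interpret product_sigma_finite "\<lambda>_ :: 'b. lborel :: real measure" by standard
  define B' where "B' = B - {b0}"
  have B': "B = insert b0 B'" "b0 \<notin> B'" "finite B'" using assms by (auto simp: B'_def)
  let ?M = "Pi\<^sub>M B (\<lambda>_. lborel :: real measure)"
  let ?H = "{u \<in> B \<rightarrow>\<^sub>E UNIV. c + (\<Sum>b\<in>B. u b * \<alpha> b) = 0}"
  have sp: "space ?M = B \<rightarrow>\<^sub>E UNIV" by (simp add: space_PiM)
  have "(\<lambda>u. c + (\<Sum>b\<in>B. u b * \<alpha> b)) \<in> borel_measurable ?M"
    by measurable
  from measurable_sets[OF this, of "{0}"] have H: "?H \<in> sets ?M"
    by (simp add: vimage_def sp Int_def conj_commute)
  have "emeasure ?M ?H = (\<integral>\<^sup>+u. indicator ?H u \<partial>?M)" using H by simp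
  also have "\<dots> = (\<integral>\<^sup>+x. (\<integral>\<^sup>+y. indicator ?H (x(b0 := y)) \<partial>lborel) \<partial>(Pi\<^sub>M B' (\<lambda>_. lborel)))"
    using H unfolding B'(1) by (intro product_nn_integral_insert[OF B'(3,2)]) auto
  also have "\<dots> = (\<integral>\<^sup>+x. 0 \<partial>(Pi\<^sub>M B' (\<lambda>_. lborel :: real measure)))"
  proof (rule nn_integral_cong)
    fix x :: "'b \<Rightarrow> real"
    define y0 where "y0 = - (c + (\<Sum>b\<in>B'. x b * \<alpha> b)) / \<alpha> b0"
    have "indicator ?H (x(b0 := y)) \<le> (indicator {y0} y :: ennreal)" for y
    proof (cases "x(b0 := y) \<in> ?H")
      case True
      have "(\<Sum>b\<in>B'. (x(b0 := y)) b * \<alpha> b) = (\<Sum>b\<in>B'. x b * \<alpha> b)"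
        using B'(2) by (intro sum.cong) auto
      then have "c + (y * \<alpha> b0 + (\<Sum>b\<in>B'. x b * \<alpha> b)) = 0"
        using True B' by (simp add: B'(1))
      then have "y = y0" using b0(2) by (simp add: y0_def field_simps)
      then show ?thesis by (simp add: indicator_def)
    qed simp
    then have "(\<integral>\<^sup>+y. indicator ?H (x(b0 := y)) \<partial>lborel) \<le> (\<integral>\<^sup>+y. indicator {y0} y \<partial>(lborel :: real measure))"
      by (intro nn_integral_mono)
    then show "(\<integral>\<^sup>+y. indicator ?H (x(b0 := y)) \<partial>(lborel :: real measure)) = 0" by simp
  qed
  finally show ?thesis using H by (simp add: null_sets_def)
qed

lemma measure_box_PiM:
  fixes l :: "'b \<Rightarrow> real"
  assumes "finite B" "h \<ge> 0"
  shows "(\<Pi>\<^sub>E b\<in>B. {l b..<l b + h}) \<in> sets (Pi\<^sub>M B (\<lambda>_. lborel))"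
    and "emeasure (Pi\<^sub>M B (\<lambda>_. lborel)) (\<Pi>\<^sub>E b\<in>B. {l b..<l b + h}) = ennreal (h ^ card B)"
proof -
  interpret product_sigma_finite "\<lambda>_ :: 'b. lborel :: real measure" by standard
  show "(\<Pi>\<^sub>E b\<in>B. {l b..<l b + h}) \<in> sets (Pi\<^sub>M B (\<lambda>_. lborel))"
    using assms by (intro sets_PiM_I_finite) auto
  show "emeasure (Pi\<^sub>M B (\<lambda>_. lborel)) (\<Pi>\<^sub>E b\<in>B. {l b..<l b + h}) = ennreal (h ^ card B)"
    using assms by (subst emeasure_PiM) (auto simp: ennreal_power)
qed

text \<open>Riemann sums over the grids \<open>(\<int>\<^sup>B + \<beta>) / \<phi>\<close>, evaluated by dominated convergence.\<close>

lemma grid_count_limit: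
  fixes B :: "(real ^ 'n::finite) set" and \<phi> :: "nat \<Rightarrow> real" and \<beta> :: "nat \<Rightarrow> real ^ 'n \<Rightarrow> real"
    and p :: "real ^ 'n" and R :: real
  defines "\<Phi> \<equiv> \<lambda>u. p + (\<Sum>b\<in>B. u b *\<^sub>R b)"
  assumes B: "finite B" and X: "open X" "X \<subseteq> Y" and Y: "closed Y"
    and null: "{u \<in> B \<rightarrow>\<^sub>E UNIV. \<Phi> u \<in> Y - X} \<in> null_sets (Pi\<^sub>M B (\<lambda>_. lborel))"
    and bound: "\<And>u b. u \<in> B \<rightarrow>\<^sub>E UNIV \<Longrightarrow> \<Phi> u \<in> Y \<Longrightarrow> b \<in> B \<Longrightarrow> \<bar>u b\<bar> \<le> R"
    and \<phi>: "\<And>k. \<phi> k \<ge> 1" "filterlim \<phi> at_top sequentially"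
  shows "(\<lambda>k. real (card {z \<in> B \<rightarrow>\<^sub>E (UNIV :: int set). \<Phi> (\<lambda>b. (of_int (z b) + \<beta> k b) / \<phi> k) \<in> X}) / \<phi> k ^ card B)
    \<longlonglongrightarrow> measure (Pi\<^sub>M B (\<lambda>_. lborel)) {u \<in> B \<rightarrow>\<^sub>E UNIV. \<Phi> u \<in> Y}"
proof -
  let ?M = "Pi\<^sub>M B (\<lambda>_. lborel :: real measure)"
  have sp: "space ?M = B \<rightarrow>\<^sub>E UNIV" by (simp add: space_PiM)
  define pt where "pt k z b = (of_int (z b) + \<beta> k b) / \<phi> k" for k and z :: "real ^ 'n \<Rightarrow> int" and b
  define Z where "Z k = {z \<in> B \<rightarrow>\<^sub>E (UNIV :: int set). \<Phi> (pt k z) \<in> X}" for k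
  \<comment> \<open>Each counted grid point carries a half-open cell of side
    \<open>1 / \<phi> k\<close>, so the normalized count is the volume of the union
    \<open>E k\<close> of the cells.\<close>
  define box where "box k z = (\<Pi>\<^sub>E b\<in>B. {pt k z b..<pt k z b + 1 / \<phi> k})" for k z
  define E where "E k = (\<Union>z\<in>Z k. box k z)" for k
  let ?F = "{u \<in> B \<rightarrow>\<^sub>E UNIV. \<Phi> u \<in> Y}"
  have \<phi>0: "\<phi> k > 0" for k using \<phi>(1)[of k] by linarith
  have \<Phi>_cong: "\<Phi> u = \<Phi> (restrict u B)" for u by (simp add: \<Phi>_def)
  have pt_bound: "\<bar>pt k z b\<bar> \<le> R" if "z \<in> Z k" "b \<in> B" for k z b
  proof -
    have "\<Phi> (restrict (pt k z) B) \<in> Y" using that X(2) \<Phi>_cong[of "pt k z"] by (auto simp: Z_def)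
    then have "\<bar>restrict (pt k z) B b\<bar> \<le> R" using bound[of "restrict (pt k z) B" b] that(2) by auto
    then show ?thesis using that(2) by simp
  qed
  have finZ: "finite (Z k)" for k
  proof (rule finite_subset)
    show "Z k \<subseteq> (\<Pi>\<^sub>E b\<in>B. {\<lceil>- R * \<phi> k - \<beta> k b\<rceil>..\<lfloor>R * \<phi> k - \<beta> k b\<rfloor>})"
    proof
      fix z assume z: "z \<in> Z k"
      have "z b \<in> {\<lceil>- R * \<phi> k - \<beta> k b\<rceil>..\<lfloor>R * \<phi> k - \<beta> k b\<rfloor>}" if b: "b \<in> B" for b
      proof -
        have "\<bar>of_int (z b) + \<beta> k b\<bar> \<le> R * \<phi> k"
          using pt_bound[OF z b] \<phi>0[of k] by (simp add: pt_def abs_divide pos_divide_le_eq)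
        then show ?thesis by (auto simp: ceiling_le_iff le_floor_iff)
      qed
      then show "z \<in> (\<Pi>\<^sub>E b\<in>B. {\<lceil>- R * \<phi> k - \<beta> k b\<rceil>..\<lfloor>R * \<phi> k - \<beta> k b\<rfloor>})"
        using z by (auto simp: Z_def PiE_def)
    qed
    show "finite (\<Pi>\<^sub>E b\<in>B. {\<lceil>- R * \<phi> k - \<beta> k b\<rceil>..\<lfloor>R * \<phi> k - \<beta> k b\<rfloor>})"
      using B by (intro finite_PiE) auto
  qed
  \<comment> \<open>The index of the cell that contains \<open>u\<close>.\<close>
  define rnd where "rnd k u = restrict (\<lambda>b. \<lfloor>\<phi> k * u b - \<beta> k b\<rfloor>) B" for k and u :: "real ^ 'n \<Rightarrow> real"
  have in_box: "u \<in> box k z \<longleftrightarrow> z = rnd k u" if u: "u \<in> B \<rightarrow>\<^sub>E UNIV" and z: "z \<in> B \<rightarrow>\<^sub>E (UNIV :: int set)" for u k z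
  proof -
    have "u b \<in> {pt k z b..<pt k z b + 1 / \<phi> k} \<longleftrightarrow> z b = \<lfloor>\<phi> k * u b - \<beta> k b\<rfloor>" for b
    proof -
      have "pt k z b + 1 / \<phi> k = (of_int (z b) + \<beta> k b + 1) / \<phi> k" by (simp add: pt_def add_divide_distrib)
      then have "u b \<in> {pt k z b..<pt k z b + 1 / \<phi> k} \<longleftrightarrow>
          of_int (z b) + \<beta> k b \<le> u b * \<phi> k \<and> u b * \<phi> k < of_int (z b) + \<beta> k b + 1"
        using \<phi>0[of k] by (auto simp: pt_def pos_divide_le_eq pos_less_divide_eq)
      then show ?thesis by (simp add: mult.commute eq_commute[of "z b"] floor_eq_iff) linarith
    qed
    then show ?thesis using u z by (auto simp: box_def rnd_def PiE_iff extensional_def fun_eq_iff)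
  qed
  have E_iff: "u \<in> E k \<longleftrightarrow> \<Phi> (pt k (rnd k u)) \<in> X" if u: "u \<in> B \<rightarrow>\<^sub>E UNIV" for u k
  proof -
    have "rnd k u \<in> B \<rightarrow>\<^sub>E UNIV" by (simp add: rnd_def)
    then show ?thesis using in_box[OF u] unfolding E_def Z_def by auto
  qed
  have boxM: "box k z \<in> sets ?M" "emeasure ?M (box k z) = ennreal ((1 / \<phi> k) ^ card B)" for k z
    unfolding box_def using \<phi>0[of k] by (auto intro!: measure_box_PiM B)
  have E_sets: "E k \<in> sets ?M" for k unfolding E_def using finZ boxM by (intro sets.finite_UN) auto
  have E_sub: "E k \<subseteq> B \<rightarrow>\<^sub>E UNIV" for k by (auto simp: E_def box_def PiE_def extensional_def)
  have disj: "disjoint_family_on (box k) (Z k)" for k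
    unfolding disjoint_family_on_def
  proof (intro ballI impI)
    fix z z' assume z: "z \<in> Z k" "z' \<in> Z k" "z \<noteq> z'"
    show "box k z \<inter> box k z' = {}"
    proof (rule ccontr)
      assume "box k z \<inter> box k z' \<noteq> {}"
      then obtain u where u: "u \<in> box k z" "u \<in> box k z'" by blast
      then have "u \<in> B \<rightarrow>\<^sub>E UNIV" by (auto simp: box_def PiE_def extensional_def)
      then show False using in_box[of u] u z by (auto simp: Z_def)
    qed
  qed
  have "emeasure ?M (E k) = (\<Sum>z\<in>Z k. emeasure ?M (box k z))" for k
    unfolding E_def using disj finZ boxM by (intro sum_emeasure[symmetric]) auto
  then have "emeasure ?M (E k) = ennreal (real (card (Z k)) * (1 / \<phi> k) ^ card B)" for k
    using boxM(2) \<phi>0[of k] by (simp add: ennreal_mult ennreal_of_nat_eq_real_of_nat)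
  then have E_measure: "measure ?M (E k) = real (card (Z k)) / \<phi> k ^ card B" for k
    using \<phi>0[of k] by (simp add: measure_def power_divide)
  have "\<Phi> \<in> borel_measurable ?M"
    unfolding \<Phi>_def by measurable
  from measurable_sets[OF this borel_closed[OF Y]] have F_sets: "?F \<in> sets ?M"
    by (simp add: vimage_def sp Int_def conj_commute)
  \<comment> \<open>An integrable bound for all \<open>E k\<close>. Cells have side at most 1; the
    absolute value keeps the side of the box nonnegative even for negative \<open>R\<close>.\<close>
  define W where "W = (\<Pi>\<^sub>E b\<in>B. {- R - 1..<(- R - 1) + (2 * \<bar>R\<bar> + 2)})"
  have W: "W \<in> sets ?M" "emeasure ?M W < \<infinity>"
    unfolding W_def using measure_box_PiM[OF B, of "2 * \<bar>R\<bar> + 2" "\<lambda>_. - R - 1"]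
    by auto
  have E_W: "E k \<subseteq> W" for k
  proof
    fix u assume "u \<in> E k"
    then obtain z where z: "z \<in> Z k" "u \<in> box k z" by (auto simp: E_def)
    have "u b \<in> {- R - 1..<(- R - 1) + (2 * \<bar>R\<bar> + 2)}" if b: "b \<in> B" for b
    proof -
      have "1 / \<phi> k \<le> 1" using \<phi>(1)[of k] by simp
      moreover have "pt k z b \<le> u b" "u b < pt k z b + 1 / \<phi> k" using z(2) b by (auto simp: box_def PiE_def Pi_def)
      ultimately show ?thesis using pt_bound[OF z(1) b] by auto
    qed
    then show "u \<in> W" using z(2) by (auto simp: W_def box_def PiE_def)
  qed
  have conv: "(\<lambda>k. \<Phi> (pt k (rnd k u))) \<longlonglongrightarrow> \<Phi> u" for u
    unfolding \<Phi>_def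
  proof (intro tendsto_add tendsto_const tendsto_sum tendsto_scaleR)
    fix b assume b: "b \<in> B"
    have bd: "\<bar>pt k (rnd k u) b - u b\<bar> \<le> 1 / \<phi> k" for k
    proof -
      have "pt k (rnd k u) b - u b = (of_int \<lfloor>\<phi> k * u b - \<beta> k b\<rfloor> - (\<phi> k * u b - \<beta> k b)) / \<phi> k"
        using \<phi>0[of k] b by (simp add: pt_def rnd_def field_simps)
      also have "\<bar>\<dots>\<bar> = \<bar>of_int \<lfloor>\<phi> k * u b - \<beta> k b\<rfloor> - (\<phi> k * u b - \<beta> k b)\<bar> / \<phi> k"
        using \<phi>0[of k] by (simp add: abs_divide)
      also have "\<dots> \<le> 1 / \<phi> k" using \<phi>0[of k] by (intro divide_right_mono) linarith+
      finally show ?thesis .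
    qed
    have "(\<lambda>k. 1 / \<phi> k) \<longlonglongrightarrow> 0"
      by (intro tendsto_divide_0[OF tendsto_const] filterlim_at_top_imp_at_infinity \<phi>(2))
    then have "(\<lambda>k. pt k (rnd k u) b - u b) \<longlonglongrightarrow> 0"
      by (rule Lim_null_comparison[rotated]) (use bd in auto)
    then show "(\<lambda>k. pt k (rnd k u) b) \<longlonglongrightarrow> u b" by (simp add: LIM_zero_iff)
  qed
  have "(\<lambda>k. integral\<^sup>L ?M (indicator (E k))) \<longlonglongrightarrow> (integral\<^sup>L ?M (indicator ?F) :: real)"
  proof (rule integral_dominated_convergence[where w = "indicator W"])
    show "integrable ?M (indicator W :: _ \<Rightarrow> real)"
      using W by (simp add: integrable_indicator_iff)
    \<comment> \<open>The corner of the cell around \<open>u\<close> tends to \<open>u\<close>, so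
      membership is eventually constant inside the open \<open>X\<close> and outside the closed
      \<open>Y\<close>. What remains is the null set \<open>Y - X\<close>.\<close>
    show "AE u in ?M. (\<lambda>k. indicator (E k) u :: real) \<longlonglongrightarrow> indicator ?F u"
    proof (rule AE_I'[OF null], rule subsetI)
      fix u assume "u \<in> {u \<in> space ?M. \<not> (\<lambda>k. indicator (E k) u :: real) \<longlonglongrightarrow> indicator ?F u}"
      then have u': "u \<in> B \<rightarrow>\<^sub>E UNIV" and nlim: "\<not> (\<lambda>k. indicator (E k) u :: real) \<longlonglongrightarrow> indicator ?F u"
        using sp by auto
      have "\<Phi> u \<in> Y"
      proof (rule ccontr)
        assume a: "\<Phi> u \<notin> Y"
        have "\<forall>\<^sub>F k in sequentially. \<Phi> (pt k (rnd k u)) \<in> - Y"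
          using conv[of u] a Y by (intro topological_tendstoD) (auto simp: open_Compl)
        then have "\<forall>\<^sub>F k in sequentially. (indicator (E k) u :: real) = indicator ?F u"
        proof eventually_elim
          case (elim k)
          then have "u \<notin> E k" using X(2) E_iff[OF u'] by blast
          then show ?case using a by simp
        qed
        from tendsto_eventually[OF this] nlim show False by contradiction
      qed
      moreover have "\<Phi> u \<notin> X"
      proof
        assume a: "\<Phi> u \<in> X"
        have "\<forall>\<^sub>F k in sequentially. \<Phi> (pt k (rnd k u)) \<in> X"
          using conv[of u] a X(1) by (intro topological_tendstoD)
        then have "\<forall>\<^sub>F k in sequentially. (indicator (E k) u :: real) = indicator ?F u"
        proof eventually_elim
          case (elim k)
          then have "u \<in> E k" using E_iff[OF u'] by blast
          moreover have "u \<in> ?F" using a X(2) u' by blast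
          ultimately show ?case by simp
        qed
        from tendsto_eventually[OF this] nlim show False by contradiction
      qed
      ultimately show "u \<in> {u \<in> B \<rightarrow>\<^sub>E UNIV. \<Phi> u \<in> Y - X}" using u' by simp
    qed
    show "AE u in ?M. norm (indicator (E k) u :: real) \<le> indicator W u" for k
      using E_W[of k] by (auto simp: indicator_def)
  qed (use E_sets F_sets in auto)
  moreover have "integral\<^sup>L ?M (indicator (E k)) = real (card (Z k)) / \<phi> k ^ card B" for k
    using E_measure[of k] E_sub[of k] sp by (simp add: Int_absorb2)
  moreover have "integral\<^sup>L ?M (indicator ?F) = measure ?M ?F"
    using sp by (simp add: Int_absorb2 Collect_restrict)
  ultimately show ?thesis by (simp add: Z_def pt_def[abs_def])
qed

section \<open>The polytope\<close>

lemma card_less_strict_mono: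
  fixes g :: "'a::finite \<Rightarrow> 'b::linorder"
  assumes "g i < g j" shows "card {k. g k < g i} < card {k. g k < g j}"
  using assms by (intro psubset_card_mono) (auto dest: less_trans)

lemma bij_betw_rank:
  fixes g :: "'a::finite \<Rightarrow> 'b::linorder"
  assumes "inj g"
  shows "bij_betw (\<lambda>j. card {k. g k < g j}) UNIV {..<CARD('a)}"
proof -
  have inj: "inj (\<lambda>j. card {k. g k < g j})"
  proof (rule injI)
    fix i j assume eq: "card {k. g k < g i} = card {k. g k < g j}"
    have "g i = g j"
      using card_less_strict_mono[of g i j] card_less_strict_mono[of g j i] eq
      by (cases "g i" "g j" rule: linorder_cases) auto
    then show "i = j" using assms by (auto dest: injD)
  qed
  have "card {k. g k < g j} < CARD('a)" for j
    by (rule psubset_card_mono) auto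
  then have "range (\<lambda>j. card {k. g k < g j}) \<subseteq> {..<CARD('a)}" by auto
  moreover have "card (range (\<lambda>j. card {k. g k < g j})) = CARD('a)" using inj by (rule card_image)
  ultimately have "range (\<lambda>j. card {k. g k < g j}) = {..<CARD('a)}"
    by (intro card_subset_eq) auto
  then show ?thesis using inj by (simp add: bij_betw_def)
qed

text \<open>The permutation matches ranks: the value at \<open>\<sigma> i\<close> has the same rank
  among all values as \<open>i\<close> has in the index type.\<close>

lemma ex1_sorting_permutation:
  fixes g :: "'n::{finite,linorder} \<Rightarrow> real"
  assumes "inj g"
  shows "\<exists>!\<sigma>. \<sigma> permutes UNIV \<and> strict_mono (\<lambda>i. g (\<sigma> i))"
proof -
  define r where "r j = card {k. g k < g j}" for j
  define s where "s i = card {k. k < i}" for i :: 'n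
  have r: "bij_betw r UNIV {..<CARD('n)}" using bij_betw_rank[OF assms] by (simp add: r_def[abs_def])
  have s: "bij_betw s UNIV {..<CARD('n)}" using bij_betw_rank[of "\<lambda>i::'n. i"] by (simp add: s_def[abs_def])
  define \<sigma> where "\<sigma> = inv_into UNIV r \<circ> s"
  have "bij_betw \<sigma> UNIV UNIV"
    unfolding \<sigma>_def using s bij_betw_inv_into[OF r] by (rule bij_betw_trans)
  then have perm: "\<sigma> permutes UNIV" by (rule bij_imp_permutes) simp
  have r\<sigma>: "r (\<sigma> i) = s i" for i
    unfolding \<sigma>_def comp_def using r s by (intro f_inv_into_f) (auto simp: bij_betw_def)
  have mono: "strict_mono (\<lambda>i. g (\<sigma> i))"
  proof (rule strict_monoI)
    fix i j :: 'n assume "i < j"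
    then have "s i < s j" unfolding s_def by (rule card_less_strict_mono)
    then have "r (\<sigma> i) < r (\<sigma> j)" by (simp add: r\<sigma>)
    then show "g (\<sigma> i) < g (\<sigma> j)"
      using card_less_strict_mono[of g "\<sigma> j" "\<sigma> i"] unfolding r_def
      by (cases "g (\<sigma> i)" "g (\<sigma> j)" rule: linorder_cases) auto
  qed
  have "\<tau> = \<sigma>" if \<tau>: "\<tau> permutes UNIV" "strict_mono (\<lambda>i. g (\<tau> i))" for \<tau>
  proof
    fix i
    have "{k. g k < g (\<tau> i)} = \<tau> ` {j. j < i}"
    proof (intro set_eqI iffI)
      fix k assume "k \<in> {k. g k < g (\<tau> i)}"
      moreover obtain j where "k = \<tau> j" using \<tau>(1) by (metis permutes_surj surjD)
      ultimately show "k \<in> \<tau> ` {j. j < i}" using strict_mono_less[OF \<tau>(2)] by auto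
    qed (use strict_mono_less[OF \<tau>(2)] in auto)
    then have "r (\<tau> i) = s i"
      unfolding r_def s_def using permutes_inj[OF \<tau>(1)] by (simp add: card_image inj_on_subset)
    then have "r (\<tau> i) = r (\<sigma> i)" by (simp add: r\<sigma>)
    then show "\<tau> i = \<sigma> i" using r by (auto simp: bij_betw_def dest: injD)
  qed
  then show ?thesis using perm mono by blast
qed

text \<open>All pairs \<open>j < i\<close> are compared instead of neighbors, which avoids
  successors in the index type.\<close>

definition chamber_forms :: "('n \<Rightarrow> 'n) \<Rightarrow> (real ^ 'n::{finite,linorder}) set" where
  "chamber_forms \<sigma> = range (\<lambda>j. axis j 1) \<union> (\<lambda>(i, j). axis (\<sigma> i) 1 - axis (\<sigma> j) 1) ` {(i, j). j < i}"

lemma chamber_forms_facts: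
  "finite (chamber_forms \<sigma>)" "chamber_forms \<sigma> \<subseteq> rational_points" "chamber_forms \<sigma> \<noteq> {}"
  by (auto simp: chamber_forms_def intro!: rational_points_diff)

lemma chamber_forms_nonneg:
  "(\<forall>a\<in>chamber_forms \<sigma>. a \<bullet> x \<ge> 0) \<longleftrightarrow> (\<forall>j. 0 \<le> x $ j) \<and> compatible x \<sigma>"
proof -
  have "compatible x \<sigma> \<longleftrightarrow> (\<forall>i j. j < i \<longrightarrow> x $ \<sigma> j \<le> x $ \<sigma> i)"
    unfolding compatible_def mono_def by (metis order_le_less order.refl)
  then show ?thesis
    by (auto simp: chamber_forms_def ball_Un inner_axis' inner_diff_left)
qed

lemma chamber_forms_pos:
  "(\<forall>a\<in>chamber_forms \<sigma>. a \<bullet> x > 0) \<longleftrightarrow> (\<forall>j. 0 < x $ j) \<and> realizes x \<sigma>"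
  unfolding realizes_def strict_mono_def
  by (auto simp: chamber_forms_def ball_Un inner_axis' inner_diff_left)

locale rational_forms =
  fixes f :: "nat \<Rightarrow> real ^ 'n::{finite,linorder} \<Rightarrow> real" and m :: nat
    and s P :: "(real ^ 'n::{finite,linorder}) set"
  assumes forms: "\<And>i. i \<in> {1..m} \<Longrightarrow> rational_linear_form (f i)"
    and m: "m \<ge> 1"
    and s: "s = {x. \<forall>i\<in>{1..m}. f i x = 1}"
    and P: "P = s \<inter> {x. \<forall>j. 0 \<le> x $ j}"
    and bounded: "bounded P"
    and not_coord: "\<And>j. \<not> P \<subseteq> {x. x $ j = 0}"
begin

section \<open>The homogenized polytope\<close>

definition F :: "nat \<Rightarrow> (real, 'n) vec" where "F i = (\<chi> j. f i (axis j 1))"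
definition "\<eta> = F 1"
definition "C = (\<lambda>i. F i - F 1) ` {1..m}"
definition "W = {x. \<forall>c\<in>C. c \<bullet> x = 0}"
text \<open>The direction space of \<open>s\<close>, so that \<open>n\<close> is the dimension of
  \<open>s\<close>.\<close>

definition "V = {x. \<forall>c\<in>F ` {1..m}. c \<bullet> x = 0}"
definition "n = dim V"

lemma f_eq: "i \<in> {1..m} \<Longrightarrow> f i x = F i \<bullet> x"
proof -
  assume i: "i \<in> {1..m}"
  then have lin: "linear (f i)" using forms by (simp add: rational_linear_form_def)
  have "f i x = f i (\<Sum>j\<in>UNIV. x $ j *\<^sub>R axis j 1)"
    using basis_expansion[of x] by (simp add: scalar_mult_eq_scaleR)
  also have "\<dots> = (\<Sum>j\<in>UNIV. x $ j * f i (axis j 1))"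
    using lin by (simp add: linear_sum linear_scale)
  finally show "f i x = F i \<bullet> x" by (simp add: F_def inner_vec_def mult.commute)
qed

lemma F_rational: "F ` {1..m} \<subseteq> rational_points"
  using forms by (auto simp: F_def rational_points_def rational_linear_form_def)

lemma C_rational: "C \<subseteq> rational_points"
  using F_rational m by (auto simp: C_def intro!: rational_points_diff)

lemma \<eta>_rational: "\<eta> \<in> rational_points"
  using F_rational m by (auto simp: \<eta>_def)

lemma W_iff: "x \<in> W \<longleftrightarrow> (\<forall>i\<in>{1..m}. F i \<bullet> x = \<eta> \<bullet> x)"
  by (auto simp: W_def C_def \<eta>_def inner_diff_left)

lemma W_height: "x \<in> W \<and> \<eta> \<bullet> x = t \<longleftrightarrow> (\<forall>i\<in>{1..m}. F i \<bullet> x = t)"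
  using m by (auto simp: W_iff \<eta>_def)

lemma s_iff: "x \<in> s \<longleftrightarrow> x \<in> W \<and> \<eta> \<bullet> x = 1"
  unfolding W_height by (simp add: s f_eq)

lemma V_iff: "x \<in> V \<longleftrightarrow> x \<in> W \<and> \<eta> \<bullet> x = 0"
  unfolding W_height by (simp add: V_def)

lemma subspaces: "subspace W" "subspace V"
  unfolding W_def V_def by (rule subspace_kernel)+

lemma affine_s: "affine s"
  unfolding affine_def
proof (intro ballI allI impI)
  fix x y :: "(real, 'n) vec" and u v :: real
  assume xy: "x \<in> s" "y \<in> s" and uv: "u + v = 1"
  have "u *\<^sub>R x + v *\<^sub>R y \<in> W"
    using xy s_iff by (intro subspace_add subspace_scale subspaces) auto
  moreover have "\<eta> \<bullet> (u *\<^sub>R x + v *\<^sub>R y) = 1" using xy uv by (simp add: s_iff inner_add_right)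
  ultimately show "u *\<^sub>R x + v *\<^sub>R y \<in> s" by (simp add: s_iff)
qed

lemma convex_P: "convex P"
proof -
  have "{x :: (real, 'n) vec. \<forall>j. 0 \<le> x $ j} = (\<Inter>j. {x. 0 \<le> axis j 1 \<bullet> x})" by (auto simp: inner_axis')
  then have "convex {x :: (real, 'n) vec. \<forall>j. 0 \<le> x $ j}"
    by (auto intro!: convex_INT convex_halfspace_ge)
  then show ?thesis unfolding P using affine_s affine_imp_convex by (blast intro: convex_Int)
qed

lemma P_nonempty: "P \<noteq> {}"
  using not_coord by blast

text \<open>A segment from \<open>q\<close> in \<open>P\<close> to a relative interior point can be
  prolonged inside \<open>P\<close>; if \<open>q $ j > 0\<close> and \<open>x $ j = 0\<close>, the
  prolongation would leave the orthant. Conversely, a ball whose radius is the least coordinate of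
  \<open>x\<close> stays in the orthant.\<close>

lemma rel_interior_P: "rel_interior P = {x \<in> s. \<forall>j. 0 < x $ j}"
proof (intro set_eqI iffI)
  fix x assume x: "x \<in> rel_interior P"
  then have xP: "x \<in> P" using rel_interior_subset by blast
  have "0 < x $ j" for j
  proof (rule ccontr)
    assume "\<not> 0 < x $ j"
    then have xj: "x $ j = 0" using xP by (auto simp: P order.antisym not_less)
    obtain q where q: "q \<in> P" "q $ j \<noteq> 0" using not_coord[of j] by auto
    then have qj: "q $ j > 0" by (auto simp: P order_less_le)
    obtain e where e: "e > 1" "(1 - e) *\<^sub>R q + e *\<^sub>R x \<in> P"
      using x q(1) convex_rel_interior_iff[OF convex_P P_nonempty] by blast
    then have "0 \<le> ((1 - e) *\<^sub>R q + e *\<^sub>R x) $ j" by (simp only: P) simp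
    then show False using e(1) qj xj by (simp add: zero_le_mult_iff)
  qed
  then show "x \<in> {x \<in> s. \<forall>j. 0 < x $ j}" using xP by (simp add: P)
next
  fix x assume x: "x \<in> {x \<in> s. \<forall>j. 0 < x $ j}"
  have hull: "affine hull P \<subseteq> s" using affine_s by (intro hull_minimal) (auto simp: P)
  define e where "e = Min (range (\<lambda>j. x $ j))"
  have e: "e > 0" "\<And>j. e \<le> x $ j" using x by (auto simp: e_def)
  have "ball x e \<inter> affine hull P \<subseteq> P"
  proof
    fix y assume y: "y \<in> ball x e \<inter> affine hull P"
    have "0 \<le> y $ j" for j
    proof -
      have "\<bar>(x - y) $ j\<bar> \<le> norm (x - y)" by (rule component_le_norm_cart)
      also have "\<dots> < e" using y by (simp add: dist_norm)
      finally show ?thesis using e(2)[of j] by simp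
    qed
    then show "y \<in> P" using y hull by (auto simp: P)
  qed
  moreover have "x \<in> P" using x by (auto simp: P less_imp_le)
  ultimately show "x \<in> rel_interior P" using e(1) by (auto simp: mem_rel_interior_ball)
qed

lemma ex_positive: "\<exists>x\<in>s. \<forall>j. 0 < x $ j"
proof -
  have "rel_interior P \<noteq> {}" using rel_interior_eq_empty[OF convex_P] P_nonempty by simp
  then show ?thesis using rel_interior_P by blast
qed

lemma open_positive: "open {x :: (real, 'n) vec. \<forall>j. 0 < x $ j}"
proof -
  have "{x :: (real, 'n) vec. \<forall>j. 0 < x $ j} = (\<Inter>j. {x. 0 < x $ j})" by auto
  then show ?thesis by (auto intro!: open_INT open_Collect_less continuous_intros)
qed

text \<open>The points of \<open>s\<close> with positive coordinates are nonempty and relatively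
  open in \<open>s\<close>, so they already span it affinely.\<close>

lemma affine_hull_P: "affine hull P = s"
proof
  show "affine hull P \<subseteq> s" using affine_s by (intro hull_minimal) (auto simp: P)
  have "affine hull (s \<inter> {x. \<forall>j. 0 < x $ j}) = affine hull s"
    using ex_positive affine_s open_positive by (intro affine_hull_affine_Int_open) auto
  then have "affine hull (s \<inter> {x. \<forall>j. 0 < x $ j}) = s"
    using affine_s by (simp add: hull_same)
  moreover have "s \<inter> {x. \<forall>j. 0 < x $ j} \<subseteq> P" by (auto simp: P less_imp_le)
  ultimately show "s \<subseteq> affine hull P" using hull_mono by metis
qed

text \<open>A nonzero nonnegative point of height 0 would be a recession direction of the bounded
  \<open>P\<close>. A point of negative height, scaled and added to a positive point of
  \<open>s\<close>, gives a point of height 0 with positive coordinates, which the first case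
  excludes.\<close>

lemma pointed:
  assumes x: "x \<in> W" "x \<noteq> 0" "\<And>j. 0 \<le> x $ j"
  shows "\<eta> \<bullet> x > 0"
proof -
  obtain p where p: "p \<in> s" "\<And>j. 0 < p $ j" using ex_positive by blast
  have zero: "y = 0" if y: "y \<in> W" "\<And>j. 0 \<le> y $ j" "\<eta> \<bullet> y = 0" for y
  proof (rule ccontr)
    assume "y \<noteq> 0"
    obtain M where M: "\<And>x. x \<in> P \<Longrightarrow> norm x \<le> M" using bounded bounded_iff by blast
    have "p \<in> P" using p by (auto simp: P less_imp_le)
    then have "M \<ge> 0" using M[of p] norm_ge_zero[of p] by linarith
    \<comment> \<open>Large enough that \<open>p + l *\<^sub>R y\<close> has norm at least
      \<open>M + 1\<close>.\<close>
    define l where "l = (M + norm p + 1) / norm y"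
    have l: "l \<ge> 0" using \<open>M \<ge> 0\<close> by (simp add: l_def)
    have "p + l *\<^sub>R y \<in> W"
      using p y s_iff by (intro subspace_add subspace_scale subspaces) auto
    moreover have "0 \<le> (p + l *\<^sub>R y) $ j" for j
      using p(2)[of j] y(2)[of j] l by (simp add: add_nonneg_nonneg less_imp_le)
    ultimately have "p + l *\<^sub>R y \<in> P"
      using p(1) y(3) by (simp add: P s_iff inner_add_right)
    then have "norm (p + l *\<^sub>R y) \<le> M" by (rule M)
    moreover have "norm (l *\<^sub>R y) = M + norm p + 1"
      using \<open>M \<ge> 0\<close> norm_ge_zero[of p] \<open>y \<noteq> 0\<close> by (simp add: l_def)
    moreover have "norm (l *\<^sub>R y) \<le> norm (p + l *\<^sub>R y) + norm p"
      using norm_triangle_ineq4[of "p + l *\<^sub>R y" p] by simp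
    ultimately show False by linarith
  qed
  show ?thesis
  proof (rule ccontr)
    assume "\<not> \<eta> \<bullet> x > 0"
    then have neg: "\<eta> \<bullet> x < 0" using zero[of x] x by fastforce
    define y where "y = p + (1 / (- (\<eta> \<bullet> x))) *\<^sub>R x"
    have pos: "0 < y $ j" for j
    proof -
      have "0 \<le> x $ j / (- (\<eta> \<bullet> x))" using x(3)[of j] neg by (intro divide_nonneg_pos) auto
      then show ?thesis using p(2)[of j] by (simp add: y_def)
    qed
    have "y \<in> W" unfolding y_def
      using p x s_iff by (intro subspace_add subspace_scale subspaces) auto
    moreover have "\<eta> \<bullet> y = 0" using p(1) neg by (simp add: y_def inner_diff_right s_iff)
    ultimately have "y = 0" using zero[of y] pos less_imp_le by blast
    then show False using pos[of undefined] by simp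
  qed
qed

text \<open>A point of \<open>s\<close> has height 1 and spans a complement of the height-0 part
  \<open>V\<close>.\<close>

lemma dim_W: "dim W = Suc n"
proof -
  obtain p where p: "p \<in> s" using ex_positive by blast
  have "W = span (insert p V)"
  proof
    show "span (insert p V) \<subseteq> W" using p by (intro span_minimal subspaces) (auto simp: s_iff V_iff)
    show "W \<subseteq> span (insert p V)"
    proof
      fix x assume x: "x \<in> W"
      have "x - (\<eta> \<bullet> x) *\<^sub>R p \<in> W" using x p s_iff by (intro subspace_diff subspace_scale subspaces) auto
      then have "x - (\<eta> \<bullet> x) *\<^sub>R p \<in> V" using p by (simp add: V_iff s_iff inner_diff_right)
      then have "x - (\<eta> \<bullet> x) *\<^sub>R p \<in> span V" by (rule span_base)
      then show "x \<in> span (insert p V)" unfolding span_insert by blast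
    qed
  qed
  moreover have spV: "span V = V" using subspaces(2) span_eq_iff by blast
  have "p \<notin> span V" unfolding spV using p by (simp add: s_iff V_iff)
  ultimately show ?thesis by (simp add: dim_insert n_def)
qed

lemma s_translate: "p \<in> s \<Longrightarrow> s = (+) p ` V"
proof (intro set_eqI iffI)
  fix x assume p: "p \<in> s" and x: "x \<in> s"
  have "x - p \<in> W" using p x s_iff by (intro subspace_diff subspaces) auto
  then have "x - p \<in> V" using p x by (simp add: V_iff s_iff inner_diff_right)
  then show "x \<in> (+) p ` V" by (intro image_eqI[of _ _ "x - p"]) auto
next
  fix x assume p: "p \<in> s" and "x \<in> (+) p ` V"
  then obtain v where v: "x = p + v" "v \<in> V" by auto
  have "x \<in> W" unfolding v(1) using p v s_iff V_iff by (intro subspace_add subspaces) auto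
  then show "x \<in> s" using p v by (simp add: V_iff s_iff inner_add_right)
qed

lemma aff_dim_s: "nat (aff_dim s) = n"
proof -
  obtain p where "p \<in> s" using ex_positive by blast
  then have "aff_dim s = aff_dim V" using s_translate[of p] aff_dim_translation_eq[of p V] by simp
  then show ?thesis using aff_dim_subspace[OF subspaces(2)] by (simp add: n_def)
qed

lemma direction_lattice_P: "direction_lattice P = integer_points \<inter> V"
proof -
  obtain p where p: "p \<in> s" using ex_positive by blast
  have "{x - y |x y. x \<in> s \<and> y \<in> s} = V"
  proof (intro set_eqI iffI)
    fix z assume "z \<in> {x - y |x y. x \<in> s \<and> y \<in> s}"
    then obtain x y where z: "z = x - y" "x \<in> s" "y \<in> s" by auto
    then have "z \<in> W" using s_iff subspace_diff[OF subspaces(1)] by auto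
    then show "z \<in> V" using z by (simp add: V_iff s_iff inner_diff_right)
  next
    fix z assume "z \<in> V"
    then have "p + z \<in> s" using s_translate[OF p] by blast
    moreover have "z = (p + z) - p" by simp
    ultimately show "z \<in> {x - y |x y. x \<in> s \<and> y \<in> s}" using p by blast
  qed
  then show ?thesis by (simp add: direction_lattice_def affine_hull_P)
qed

lemma dilate_s_iff:
  assumes "t \<noteq> 0"
  shows "x \<in> dilate t s \<longleftrightarrow> x \<in> W \<and> \<eta> \<bullet> x = t"
proof
  assume "x \<in> dilate t s"
  then obtain y where "y \<in> s" "x = t *\<^sub>R y" by (auto simp: dilate_def)
  then show "x \<in> W \<and> \<eta> \<bullet> x = t" using subspace_scale[OF subspaces(1)] by (auto simp: s_iff)
next
  assume x: "x \<in> W \<and> \<eta> \<bullet> x = t"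
  then have "(1 / t) *\<^sub>R x \<in> s" using assms subspace_scale[OF subspaces(1)] by (auto simp: s_iff)
  moreover have "x = t *\<^sub>R ((1 / t) *\<^sub>R x)" using assms by simp
  ultimately show "x \<in> dilate t s" unfolding dilate_def by blast
qed

lemma dilate_P_iff:
  assumes "t > 0"
  shows "x \<in> dilate t P \<longleftrightarrow> x \<in> W \<and> (\<forall>j. 0 \<le> x $ j) \<and> \<eta> \<bullet> x = t"
proof -
  have "x \<in> dilate t P \<longleftrightarrow> x \<in> dilate t s \<and> (\<forall>j. 0 \<le> x $ j)"
  proof
    assume "x \<in> dilate t P"
    then show "x \<in> dilate t s \<and> (\<forall>j. 0 \<le> x $ j)" using assms by (auto simp: dilate_def P)
  next
    assume "x \<in> dilate t s \<and> (\<forall>j. 0 \<le> x $ j)"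
    then obtain y where "y \<in> s" "x = t *\<^sub>R y" "\<forall>j. 0 \<le> x $ j" by (auto simp: dilate_def)
    then show "x \<in> dilate t P" using assms by (auto simp: dilate_def P zero_le_mult_iff)
  qed
  then show ?thesis using dilate_s_iff[of t x] assms by auto
qed

definition "realizable = {\<tau>. \<tau> permutes UNIV \<and> realizable_in \<tau> (rel_interior P)}"

lemma finite_realizable: "finite realizable"
  unfolding realizable_def by (rule finite_subset[OF _ finite_permutations[of UNIV]]) auto

definition closed_chamber :: "('n \<Rightarrow> 'n) \<Rightarrow> real \<Rightarrow> ((real, 'n) vec) set" where
  "closed_chamber \<sigma> t = {x \<in> integer_points \<inter> W. (\<forall>a\<in>chamber_forms \<sigma>. a \<bullet> x \<ge> 0) \<and> \<eta> \<bullet> x = t}"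

definition open_chamber :: "('n \<Rightarrow> 'n) \<Rightarrow> real \<Rightarrow> ((real, 'n) vec) set" where
  "open_chamber \<sigma> t = {x \<in> integer_points \<inter> W. (\<forall>a\<in>chamber_forms \<sigma>. a \<bullet> x > 0) \<and> \<eta> \<bullet> x = t}"

lemma finite_dilate: "finite (integer_points \<inter> dilate t P)"
  using bounded by (intro finite_integer_points) (auto simp: dilate_def intro: bounded_scaling)

text \<open>Realizability supplies the interior point of the cone that
  \<open>rational_cone_reciprocity\<close> asks for; boundedness of \<open>P\<close> supplies
  pointedness.\<close>

lemma chamber_reciprocity:
  assumes "\<sigma> \<in> realizable"
  shows "\<exists>Q. quasipoly_le n Q \<and> (\<forall>t\<ge>0. Q t = real (card (closed_chamber \<sigma> (of_int t)))) \<and>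
    (\<forall>t\<ge>1. (-1) ^ n * Q (- t) = real (card (open_chamber \<sigma> (of_int t))))"
proof -
  obtain p where p: "p \<in> rel_interior P" "realizes p \<sigma>"
    using assms by (auto simp: realizable_def realizable_in_def)
  then have "p \<in> W" "\<forall>a\<in>chamber_forms \<sigma>. a \<bullet> p > 0"
    using rel_interior_P s_iff chamber_forms_pos[of \<sigma> p] by simp_all
  then show ?thesis
    unfolding closed_chamber_def open_chamber_def
    using pointed chamber_forms_nonneg dim_W
    by (intro rational_cone_reciprocity[OF C_rational W_def chamber_forms_facts \<eta>_rational]) blast+
qed

lemma A_closed_eq:
  assumes t: "t \<ge> 1"
  shows "A_closed P t = (\<Sum>\<sigma>\<in>realizable. card (closed_chamber \<sigma> (real t)))"
proof -
  have fin: "finite (closed_chamber \<sigma> (real t))" for \<sigma>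
    by (rule finite_subset[OF _ finite_dilate[of "real t"]])
       (use t in \<open>auto simp: closed_chamber_def dilate_P_iff chamber_forms_nonneg\<close>)
  have "{(x, \<sigma>). x \<in> integer_points \<inter> dilate (real t) P \<and> (\<forall>j. 0 \<le> x $ j) \<and>
     \<sigma> permutes UNIV \<and> compatible x \<sigma> \<and> realizable_in \<sigma> (rel_interior P)} =
     prod.swap ` (SIGMA \<sigma>:realizable. closed_chamber \<sigma> (real t))"
    using t by (auto simp: closed_chamber_def realizable_def dilate_P_iff chamber_forms_nonneg image_iff)
  then have "A_closed P t = card (SIGMA \<sigma>:realizable. closed_chamber \<sigma> (real t))"
    by (simp add: A_closed_def card_image)
  also have "\<dots> = (\<Sum>\<sigma>\<in>realizable. card (closed_chamber \<sigma> (real t)))"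
    using finite_realizable fin by (intro card_SigmaI) auto
  finally show ?thesis .
qed

text \<open>Distinct coordinates are sorted by exactly one permutation. It is realizable because
  \<open>x\<close> divided by \<open>t\<close> lies in the relative interior, so restricting to
  realizable permutations loses no point.\<close>

lemma A_open_eq:
  assumes t: "t \<ge> 1"
  shows "A_open P t = (\<Sum>\<sigma>\<in>realizable. card (open_chamber \<sigma> (real t)))"
  unfolding A_open_def
proof (rule card_disjoint_cover[OF finite_realizable])
  fix \<sigma> assume \<sigma>: "\<sigma> \<in> realizable"
  show sub: "open_chamber \<sigma> (real t) \<subseteq> {x \<in> integer_points \<inter> dilate (real t) P. (\<forall>j. 0 < x $ j) \<and> inj (\<lambda>j. x $ j)}"
  proof
    fix x assume x: "x \<in> open_chamber \<sigma> (real t)"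
    then have pos: "\<forall>j. 0 < x $ j" "realizes x \<sigma>" by (auto simp: open_chamber_def chamber_forms_pos)
    have perm: "\<sigma> permutes UNIV" using \<sigma> by (simp add: realizable_def)
    have "inj (\<lambda>i. x $ \<sigma> i)" using pos(2) unfolding realizes_def by (rule strict_mono_imp_inj_on)
    then have "inj ((\<lambda>i. x $ \<sigma> i) \<circ> inv \<sigma>)"
      using permutes_inj[OF permutes_inv[OF perm]] by (rule inj_compose)
    moreover have "(\<lambda>i. x $ \<sigma> i) \<circ> inv \<sigma> = (\<lambda>j. x $ j)"
      using permutes_inverses(1)[OF perm] by auto
    ultimately have "inj (\<lambda>j. x $ j)" by simp
    then show "x \<in> {x \<in> integer_points \<inter> dilate (real t) P. (\<forall>j. 0 < x $ j) \<and> inj (\<lambda>j. x $ j)}"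
      using x pos t by (auto simp: open_chamber_def dilate_P_iff less_imp_le)
  qed
  show "finite (open_chamber \<sigma> (real t))"
    by (rule finite_subset[OF _ finite_dilate[of "real t"]]) (use sub in blast)
next
  fix x assume x: "x \<in> {x \<in> integer_points \<inter> dilate (real t) P. (\<forall>j. 0 < x $ j) \<and> inj (\<lambda>j. x $ j)}"
  have iff: "\<sigma> \<in> realizable \<and> x \<in> open_chamber \<sigma> (real t) \<longleftrightarrow> \<sigma> permutes UNIV \<and> strict_mono (\<lambda>i. x $ \<sigma> i)" for \<sigma>
  proof
    assume "\<sigma> permutes UNIV \<and> strict_mono (\<lambda>i. x $ \<sigma> i)"
    then have \<sigma>: "\<sigma> permutes UNIV" "realizes x \<sigma>" by (auto simp: realizes_def)
    have xW: "x \<in> W" "\<eta> \<bullet> x = real t" using x t by (auto simp: dilate_P_iff)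
    have "(1 / real t) *\<^sub>R x \<in> rel_interior P"
      using x xW t subspace_scale[OF subspaces(1)] by (auto simp: rel_interior_P s_iff)
    moreover have "realizes ((1 / real t) *\<^sub>R x) \<sigma>"
      using \<sigma>(2) t by (auto simp: realizes_def strict_mono_def divide_strict_right_mono)
    ultimately have "\<sigma> \<in> realizable" using \<sigma>(1) by (auto simp: realizable_def realizable_in_def)
    then show "\<sigma> \<in> realizable \<and> x \<in> open_chamber \<sigma> (real t)"
      using x xW \<sigma>(2) by (auto simp: open_chamber_def chamber_forms_pos)
  qed (auto simp: realizable_def open_chamber_def chamber_forms_pos realizes_def)
  show "\<exists>!\<sigma>. \<sigma> \<in> realizable \<and> x \<in> open_chamber \<sigma> (real t)"
    unfolding iff using x by (intro ex1_sorting_permutation) auto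
qed

text \<open>By pointedness only the origin has height 0, so each realizable permutation adds 1 to
  the constant term.\<close>

lemma closed_chamber_zero: "closed_chamber \<sigma> 0 = {0}"
proof -
  have "0 \<in> W" using subspace_0 subspaces by blast
  then show ?thesis
    using pointed by (fastforce simp: closed_chamber_def chamber_forms_nonneg compatible_def mono_def)
qed

lemma ex_quasipolynomials:
  "\<exists>Q. quasipoly_le n Q \<and> (\<forall>t\<ge>1. Q (int t) = real (A_closed P t)) \<and>
    (\<forall>t\<ge>1. (-1) ^ n * Q (- int t) = real (A_open P t)) \<and> Q 0 = real (card realizable)"
proof -
  obtain q where q: "\<And>\<sigma>. \<sigma> \<in> realizable \<Longrightarrow> quasipoly_le n (q \<sigma>)"
    "\<And>\<sigma> t. \<sigma> \<in> realizable \<Longrightarrow> t \<ge> 0 \<Longrightarrow> q \<sigma> t = real (card (closed_chamber \<sigma> (of_int t)))"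
    "\<And>\<sigma> t. \<sigma> \<in> realizable \<Longrightarrow> t \<ge> 1 \<Longrightarrow> (-1) ^ n * q \<sigma> (- t) = real (card (open_chamber \<sigma> (of_int t)))"
    using chamber_reciprocity by metis
  define Q where "Q t = (\<Sum>\<sigma>\<in>realizable. q \<sigma> t)" for t
  have "quasipoly_le n Q" unfolding Q_def using q(1) by (rule quasipoly_le_sum)
  moreover have "Q (int t) = real (A_closed P t)" if "t \<ge> 1" for t
    using that q(2)[of _ "int t"] by (simp add: Q_def A_closed_eq)
  moreover have "(-1) ^ n * Q (- int t) = real (A_open P t)" if "t \<ge> 1" for t
    using that q(3)[of _ "int t"] by (simp add: Q_def A_open_eq sum_distrib_left)
  moreover have "Q 0 = real (card realizable)"
    using q(2)[of _ 0] by (simp add: Q_def closed_chamber_zero)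
  ultimately show ?thesis by blast
qed


text \<open>The periodic leading coefficient is supported on these heights. Equations instead of
  \<open>dilate\<close> make it evident that they form a subgroup of the integers.\<close>

definition "lattice_height t \<longleftrightarrow> (\<exists>x\<in>integer_points. \<forall>i\<in>{1..m}. F i \<bullet> x = of_int t)"

lemma lattice_height_iff: "lattice_height t \<longleftrightarrow> integer_points \<inter> dilate (of_int t) s \<noteq> {}"
proof (cases "t = 0")
  case True
  have "0 \<in> dilate 0 s" using ex_positive by (auto simp: dilate_def)
  then have "integer_points \<inter> dilate 0 s \<noteq> {}" using integer_points_zero by blast
  moreover have "lattice_height 0" unfolding lattice_height_def by (intro bexI[of _ 0]) auto
  ultimately show ?thesis using True by simp
next
  case False
  then have "x \<in> dilate (of_int t) s \<longleftrightarrow> (\<forall>i\<in>{1..m}. F i \<bullet> x = of_int t)" for x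
    using dilate_s_iff[of "of_int t" x] W_height by simp
  then show ?thesis unfolding lattice_height_def by blast
qed

lemma lattice_height_diff:
  assumes "lattice_height t" "lattice_height u" shows "lattice_height (t - u)"
proof -
  obtain x y where "x \<in> integer_points" "\<forall>i\<in>{1..m}. F i \<bullet> x = of_int t"
    "y \<in> integer_points" "\<forall>i\<in>{1..m}. F i \<bullet> y = of_int u"
    using assms unfolding lattice_height_def by blast
  then show ?thesis unfolding lattice_height_def
    by (intro bexI[of _ "x - y"]) (auto simp: inner_diff_right intro: integer_points_diff)
qed

lemma lattice_height_scale:
  assumes "lattice_height t" shows "lattice_height (t * k)"
proof -
  obtain x where "x \<in> integer_points" "\<forall>i\<in>{1..m}. F i \<bullet> x = of_int t"
    using assms unfolding lattice_height_def by blast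
  then show ?thesis unfolding lattice_height_def
    by (intro bexI[of _ "of_int k *\<^sub>R x"]) (auto simp: mult.commute intro: integer_points_scale)
qed

lemma lattice_height_uminus: "lattice_height (- t) \<longleftrightarrow> lattice_height t"
  using lattice_height_scale[of t "-1"] lattice_height_scale[of "- t" "-1"] by auto

lemma lattice_height_shift:
  assumes "lattice_height u" shows "lattice_height (t + u) \<longleftrightarrow> lattice_height t"
  using lattice_height_diff[of "t + u" u] lattice_height_diff[of t "- u"] assms
  by (auto simp: lattice_height_uminus)

text \<open>Rational points span \<open>W\<close>, so one of them has nonzero height; normalizing it
  to height 1 and clearing denominators gives an integer point of positive height.\<close>

lemma ex_lattice_height: "\<exists>t>0. lattice_height t"
proof -
  obtain p where p: "p \<in> s" using ex_positive by blast
  have "\<exists>v\<in>W \<inter> rational_points. \<eta> \<bullet> v \<noteq> 0"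
  proof (rule ccontr)
    assume "\<not> ?thesis"
    then have "span (W \<inter> rational_points) \<subseteq> {x. \<forall>c\<in>{\<eta>}. c \<bullet> x = 0}"
      by (intro span_minimal subspace_kernel) auto
    moreover have "p \<in> span (W \<inter> rational_points)"
      using rational_kernel_span[OF C_rational] p s_iff unfolding W_def by blast
    ultimately show False using p by (auto simp: s_iff)
  qed
  then obtain v where v: "v \<in> W" "v \<in> rational_points" "\<eta> \<bullet> v \<noteq> 0" by blast
  define u where "u = (1 / (\<eta> \<bullet> v)) *\<^sub>R v"
  have u: "u \<in> W" "\<eta> \<bullet> u = 1" "u \<in> rational_points"
    using v subspace_scale[OF subspaces(1) v(1)] \<eta>_rational
    by (auto simp: u_def intro!: rational_points_scale Rats_divide rational_points_inner)
  obtain D where D: "D > 0" "real D *\<^sub>R u \<in> integer_points"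
    using ex_common_denominator[of "{u}"] u(3) by auto
  have "lattice_height (int D)"
    unfolding lattice_height_def
    using D(2) u(1,2) W_iff[of u] by (intro bexI[of _ "real D *\<^sub>R u"]) auto
  then show ?thesis using D(1) by (intro exI[of _ "int D"]) auto
qed

section \<open>The leading coefficient as a volume\<close>

abbreviation (input) "distinct_positive \<equiv> {x :: (real, 'n) vec. (\<forall>j. 0 < x $ j) \<and> inj (\<lambda>j. x $ j)}"
abbreviation (input) "nonnegative \<equiv> {x :: (real, 'n) vec. \<forall>j. 0 \<le> x $ j}"

lemma open_distinct_positive: "open distinct_positive"
proof -
  have "distinct_positive = {x. \<forall>j. 0 < x $ j} \<inter> (\<Inter>i. \<Inter>j\<in>- {i}. {x. x $ i \<noteq> x $ j})"
    by (auto simp: inj_def)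
  then show ?thesis
    by (auto intro!: open_Int open_positive open_INT open_Collect_neq continuous_intros)
qed

lemma closed_nonnegative: "closed nonnegative"
proof -
  have "nonnegative = (\<Inter>j. {x. 0 \<le> x $ j})" by auto
  then show ?thesis by (auto intro!: closed_INT closed_Collect_le continuous_intros)
qed

context
  fixes B :: "(real, 'n) vec set" and p :: "(real, 'n) vec"
  assumes B: "lattice_basis B (integer_points \<inter> V)" and p: "p \<in> s"
begin

lemma B_basis: "independent B" "finite B" "span B = V" "card B = n"
proof -
  show "independent B" using B by (simp add: lattice_basis_def)
  then show "finite B" by (rule independent_imp_finite)
  show "span B = V" using span_lattice_basis[OF F_rational] B by (simp add: V_def)
  then show "card B = n"
    using dim_span_eq_card_independent[OF \<open>independent B\<close>] by (simp add: n_def)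
qed

lemma coordinates_in_s: "p + (\<Sum>b\<in>B. u b *\<^sub>R b) \<in> s"
proof -
  have "(\<Sum>b\<in>B. u b *\<^sub>R b) \<in> V"
    unfolding B_basis(3)[symmetric] by (intro span_sum span_scale span_base)
  then show ?thesis using s_translate[OF p] by blast
qed

text \<open>Either \<open>c\<close> is nonconstant on \<open>s\<close> and the coordinates satisfy a
  nontrivial affine equation, or it is a nonzero constant and the set is empty.\<close>

lemma null_hyperplane:
  assumes "\<not> s \<subseteq> {x. c \<bullet> x = 0}"
  shows "{u \<in> B \<rightarrow>\<^sub>E UNIV. c \<bullet> (p + (\<Sum>b\<in>B. u b *\<^sub>R b)) = 0} \<in> null_sets (Pi\<^sub>M B (\<lambda>_. lborel))"
proof -
  have eq: "c \<bullet> (p + (\<Sum>b\<in>B. u b *\<^sub>R b)) = c \<bullet> p + (\<Sum>b\<in>B. u b * (c \<bullet> b))" for u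
    by (simp add: inner_add_right inner_sum_right)
  show ?thesis
  proof (cases "\<exists>b\<in>B. c \<bullet> b \<noteq> 0")
    case True
    then show ?thesis unfolding eq using null_hyperplane_PiM[OF B_basis(2)] by blast
  next
    case False
    then have "V \<subseteq> {x. \<forall>c\<in>{c}. c \<bullet> x = 0}"
      unfolding B_basis(3)[symmetric] by (intro span_minimal subspace_kernel) auto
    then have "c \<bullet> x = c \<bullet> p" if "x \<in> s" for x
      using that s_translate[OF p] by (auto simp: inner_add_right)
    then have "c \<bullet> p \<noteq> 0" using assms by auto
    then have "{u \<in> B \<rightarrow>\<^sub>E UNIV. c \<bullet> (p + (\<Sum>b\<in>B. u b *\<^sub>R b)) = 0} = {}"
      using False by (simp add: eq)
    then show ?thesis by (simp only: null_sets.empty_sets)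
  qed
qed

text \<open>Nonnegative points missed by the open count have a zero or a repeated coordinate. They
  lie in finitely many hyperplanes, none of which contains \<open>s\<close>; for the repeated
  coordinates this is the assumption on \<open>P\<close>.\<close>

lemma null_nongeneric:
  assumes "\<forall>i j. i \<noteq> j \<longrightarrow> \<not> P \<subseteq> {x. x $ i = x $ j}"
  shows "{u \<in> B \<rightarrow>\<^sub>E UNIV. p + (\<Sum>b\<in>B. u b *\<^sub>R b) \<in> nonnegative - distinct_positive}
    \<in> null_sets (Pi\<^sub>M B (\<lambda>_. lborel))"
proof -
  let ?M = "Pi\<^sub>M B (\<lambda>_. lborel :: real measure)"
  let ?\<Phi> = "\<lambda>u. p + (\<Sum>b\<in>B. u b *\<^sub>R b)"
  define H where "H c = {u \<in> B \<rightarrow>\<^sub>E UNIV. c \<bullet> ?\<Phi> u = 0}" for c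
  define D where "D = range (\<lambda>j. axis j 1 :: (real, 'n) vec) \<union> (\<lambda>(i, j). axis i 1 - axis j 1) ` {(i, j). i \<noteq> j}"
  have "P \<subseteq> s" by (auto simp: P)
  then have "\<not> s \<subseteq> {x. c \<bullet> x = 0}" if "c \<in> D" for c
    using that assms not_coord unfolding D_def
    by (auto simp: inner_axis' inner_diff_left) (meson subset_trans)+
  then have "H c \<in> null_sets ?M" if "c \<in> D" for c
    using null_hyperplane that by (simp add: H_def)
  moreover have "finite D" by (simp add: D_def)
  ultimately have null: "(\<Union>c\<in>D. H c) \<in> null_sets ?M"
    by (intro null_sets_UN') (auto intro: countable_finite)
  have sub: "{u \<in> B \<rightarrow>\<^sub>E UNIV. ?\<Phi> u \<in> nonnegative - distinct_positive} \<subseteq> (\<Union>c\<in>D. H c)"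
  proof
    fix u assume u: "u \<in> {u \<in> B \<rightarrow>\<^sub>E UNIV. ?\<Phi> u \<in> nonnegative - distinct_positive}"
    then consider j where "?\<Phi> u $ j = 0" | i j where "i \<noteq> j" "?\<Phi> u $ i = ?\<Phi> u $ j"
      by (auto simp: inj_def order_le_less)
    then show "u \<in> (\<Union>c\<in>D. H c)"
    proof cases
      case (1 j)
      then have "u \<in> H (axis j 1)" using u by (simp add: H_def inner_axis')
      then show ?thesis by (auto simp: D_def)
    next
      case (2 i j)
      then have "u \<in> H (axis i 1 - axis j 1)" using u by (simp add: H_def inner_axis' inner_diff_left)
      then show ?thesis using 2(1) unfolding D_def by blast
    qed
  qed
  have "?\<Phi> \<in> borel_measurable ?M" by measurable
  moreover have "nonnegative - distinct_positive \<in> sets borel"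
    using open_distinct_positive closed_nonnegative by (intro sets.Diff) auto
  ultimately have "?\<Phi> -` (nonnegative - distinct_positive) \<inter> space ?M \<in> sets ?M"
    by (rule measurable_sets)
  also have "?\<Phi> -` (nonnegative - distinct_positive) \<inter> space ?M
      = {u \<in> B \<rightarrow>\<^sub>E UNIV. ?\<Phi> u \<in> nonnegative - distinct_positive}"
    by (auto simp: space_PiM)
  finally show ?thesis by (rule null_sets_subset[OF null _ sub])
qed

text \<open>Coordinates with respect to a basis are bounded linear functionals, and the nonnegative
  points of \<open>s\<close> form the bounded set \<open>P\<close>.\<close>

lemma coordinates_bounded:
  "\<exists>R. \<forall>u. p + (\<Sum>b\<in>B. u b *\<^sub>R b) \<in> nonnegative \<longrightarrow> (\<forall>b\<in>B. \<bar>u b\<bar> \<le> R)"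
proof -
  obtain M where M: "\<And>x. x \<in> P \<Longrightarrow> norm x \<le> M" using bounded bounded_iff by blast
  have "\<exists>K\<ge>0. \<forall>u. \<bar>u b\<bar> \<le> norm (\<Sum>b\<in>B. u b *\<^sub>R b) * K" if b: "b \<in> B" for b
  proof -
    obtain g :: "(real, 'n) vec \<Rightarrow> real" where g: "linear g" "\<forall>x\<in>B. g x = (if x = b then 1 else 0)"
      using linear_independent_extend[OF B_basis(1), of "\<lambda>x. if x = b then 1 else 0"] by blast
    then have "bounded_linear g" using linear_conv_bounded_linear by blast
    then obtain K where K: "K \<ge> 0" "\<And>x. norm (g x) \<le> norm x * K"
      using bounded_linear.nonneg_bounded by blast
    have "g (\<Sum>b\<in>B. u b *\<^sub>R b) = u b" for u
      using g b B_basis(2) by (simp add: linear_sum linear_scale if_distrib[of "\<lambda>x. _ * x"] cong: if_cong sum.cong)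
    then have "\<bar>u b\<bar> \<le> norm (\<Sum>b\<in>B. u b *\<^sub>R b) * K" for u
      using K(2)[of "\<Sum>b\<in>B. u b *\<^sub>R b"] by simp
    then show ?thesis using K(1) by blast
  qed
  then obtain K where K: "\<And>b. b \<in> B \<Longrightarrow> K b \<ge> 0"
    "\<And>b u. b \<in> B \<Longrightarrow> \<bar>u b\<bar> \<le> norm (\<Sum>b\<in>B. u b *\<^sub>R b) * K b" by metis
  show ?thesis
  proof (intro exI allI impI ballI)
    fix u b assume u: "p + (\<Sum>b\<in>B. u b *\<^sub>R b) \<in> nonnegative" and b: "b \<in> B"
    then have "norm (p + (\<Sum>b\<in>B. u b *\<^sub>R b)) \<le> M"
      using coordinates_in_s by (intro M) (auto simp: P)
    then have "norm (\<Sum>b\<in>B. u b *\<^sub>R b) \<le> M + norm p"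
      using norm_triangle_ineq4[of "p + (\<Sum>b\<in>B. u b *\<^sub>R b)" p] by simp
    then have "\<bar>u b\<bar> \<le> (M + norm p) * K b"
      using K(2)[OF b, of u] mult_right_mono[OF _ K(1)[OF b]] by (meson order_trans)
    \<comment> \<open>The sum is a bound common to all \<open>b\<close>, and unlike a maximum it is
      harmless when \<open>B\<close> is empty.\<close>
    also have "\<dots> \<le> (\<Sum>b\<in>B. \<bar>(M + norm p) * K b\<bar>)"
      using member_le_sum[OF b, of "\<lambda>b. \<bar>(M + norm p) * K b\<bar>"] B_basis(2) by simp
    finally show "\<bar>u b\<bar> \<le> (\<Sum>b\<in>B. \<bar>(M + norm p) * K b\<bar>)" .
  qed
qed

text \<open>The integer points at height \<open>t\<close> are the lattice translated by
  \<open>y\<close>. Scaled into \<open>s\<close> and read in coordinates based at \<open>p\<close>,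
  they become the integer grid shifted by \<open>\<beta>\<close> and divided by
  \<open>t\<close>.\<close>

lemma A_open_grid:
  assumes t: "t \<ge> 1" and y: "y \<in> integer_points" "\<forall>i\<in>{1..m}. F i \<bullet> y = real t"
  defines "\<beta> \<equiv> representation B (y - real t *\<^sub>R p)"
  shows "A_open P t = card {z \<in> B \<rightarrow>\<^sub>E (UNIV :: int set).
    p + (\<Sum>b\<in>B. ((of_int (z b) + \<beta> b) / real t) *\<^sub>R b) \<in> distinct_positive}"
proof -
  let ?pt = "\<lambda>z. y + (\<Sum>b\<in>B. of_int (z b) *\<^sub>R b)"
  let ?Z = "{z \<in> B \<rightarrow>\<^sub>E (UNIV :: int set).
    p + (\<Sum>b\<in>B. ((of_int (z b) + \<beta> b) / real t) *\<^sub>R b) \<in> distinct_positive}"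
  have t0: "real t > 0" using t by simp
  have yW: "y \<in> W" "\<eta> \<bullet> y = real t" using y(2) W_height[of y "real t"] by auto
  have "y - real t *\<^sub>R p \<in> W"
    using yW p s_iff by (intro subspace_diff subspace_scale subspaces) auto
  then have "y - real t *\<^sub>R p \<in> span B" using yW p by (simp add: B_basis(3) V_iff s_iff inner_diff_right)
  then have \<beta>: "(\<Sum>b\<in>B. \<beta> b *\<^sub>R b) = y - real t *\<^sub>R p"
    unfolding \<beta>_def by (rule sum_representation[OF B_basis(1)])
  have grid: "p + (\<Sum>b\<in>B. ((of_int (z b) + \<beta> b) / real t) *\<^sub>R b) = (1 / real t) *\<^sub>R ?pt z" for z :: "(real, 'n) vec \<Rightarrow> int"
  proof -
    have "(\<Sum>b\<in>B. ((of_int (z b) + \<beta> b) / real t) *\<^sub>R b) =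
        (1 / real t) *\<^sub>R ((\<Sum>b\<in>B. of_int (z b) *\<^sub>R b) + (\<Sum>b\<in>B. \<beta> b *\<^sub>R b))"
      by (simp add: scaleR_sum_right scaleR_add_left add_divide_distrib sum.distrib scaleR_add_right)
    then show ?thesis unfolding \<beta> using t0 by (simp add: algebra_simps)
  qed
  have dp: "(1 / real t) *\<^sub>R x \<in> distinct_positive \<longleftrightarrow> x \<in> distinct_positive" for x :: "(real, 'n) vec"
    using t0 by (auto simp: inj_def zero_less_divide_iff)
  have "bij_betw ?pt ?Z {x \<in> integer_points \<inter> dilate (real t) P. (\<forall>j. 0 < x $ j) \<and> inj (\<lambda>j. x $ j)}"
    unfolding bij_betw_def
  proof
    show "inj_on ?pt ?Z"
    proof (rule inj_onI)
      fix z z' assume z: "z \<in> ?Z" "z' \<in> ?Z" and eq: "?pt z = ?pt z'"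
      have "z b = z' b" if b: "b \<in> B" for b
      proof -
        have "of_int (z b) = representation B (\<Sum>b\<in>B. of_int (z b) *\<^sub>R b) b"
          using representation_sum_scale[OF B_basis(1) b] by simp
        also have "\<dots> = representation B (\<Sum>b\<in>B. of_int (z' b) *\<^sub>R b) b" using eq by simp
        also have "\<dots> = of_int (z' b)" using representation_sum_scale[OF B_basis(1) b] by simp
        finally show ?thesis by simp
      qed
      then show "z = z'" using z by (auto intro: PiE_ext)
    qed
    show "?pt ` ?Z = {x \<in> integer_points \<inter> dilate (real t) P. (\<forall>j. 0 < x $ j) \<and> inj (\<lambda>j. x $ j)}"
    proof (intro set_eqI iffI)
      fix x assume "x \<in> ?pt ` ?Z"
      then obtain z where z: "z \<in> ?Z" and x: "x = ?pt z" by blast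
      have "x \<in> distinct_positive" using z unfolding x mem_Collect_eq grid using dp by blast
      moreover have "(\<Sum>b\<in>B. of_int (z b) *\<^sub>R b) \<in> integer_points \<inter> V"
        using B unfolding lattice_basis_def by blast
      then have "x \<in> integer_points" "x \<in> W" "\<eta> \<bullet> x = real t"
        using y(1) yW subspace_add[OF subspaces(1) yW(1)]
        by (auto simp: x V_iff inner_add_right intro!: integer_points_add)
      ultimately show "x \<in> {x \<in> integer_points \<inter> dilate (real t) P. (\<forall>j. 0 < x $ j) \<and> inj (\<lambda>j. x $ j)}"
        using t0 by (auto simp: dilate_P_iff less_imp_le)
    next
      fix x assume "x \<in> {x \<in> integer_points \<inter> dilate (real t) P. (\<forall>j. 0 < x $ j) \<and> inj (\<lambda>j. x $ j)}"
      then have x: "x \<in> integer_points" "x \<in> W" "\<eta> \<bullet> x = real t" "x \<in> distinct_positive"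
        using t0 by (auto simp: dilate_P_iff)
      have "x - y \<in> W" using x yW by (intro subspace_diff subspaces)
      then have "x - y \<in> integer_points \<inter> V"
        using x yW y(1) by (simp add: V_iff inner_diff_right integer_points_diff)
      then obtain z where z: "x - y = (\<Sum>b\<in>B. of_int (z b) *\<^sub>R b)"
        using B unfolding lattice_basis_def by auto
      then have xz: "x = ?pt (restrict z B)" by (simp add: algebra_simps)
      moreover have "restrict z B \<in> ?Z"
        using x(4) dp unfolding mem_Collect_eq grid xz[symmetric] by simp
      ultimately show "x \<in> ?pt ` ?Z" by blast
    qed
  qed
  then show ?thesis unfolding A_open_def by (rule bij_betw_same_card[symmetric])
qed

text \<open>The shift of the grid may vary with \<open>k\<close> without control, which
  \<open>grid_count_limit\<close> permits. Every \<open>T k\<close> has to be a lattice height for a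
  grid to exist.\<close>

lemma A_open_limit:
  fixes T :: "nat \<Rightarrow> nat"
  assumes generic: "\<forall>i j. i \<noteq> j \<longrightarrow> \<not> P \<subseteq> {x. x $ i = x $ j}"
    and T: "\<And>k. T k \<ge> 1" "\<And>k. lattice_height (int (T k))" "filterlim T at_top sequentially"
  shows "(\<lambda>k. real (A_open P (T k)) / real (T k) ^ n) \<longlonglongrightarrow> coordinate_volume B p P"
proof -
  obtain y where y: "\<And>k. y k \<in> integer_points" "\<And>k. \<forall>i\<in>{1..m}. F i \<bullet> y k = real (T k)"
    using T(2) unfolding lattice_height_def of_int_of_nat_eq by metis
  obtain R where R: "\<forall>u. p + (\<Sum>b\<in>B. u b *\<^sub>R b) \<in> nonnegative \<longrightarrow> (\<forall>b\<in>B. \<bar>u b\<bar> \<le> R)"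
    using coordinates_bounded by blast
  define \<beta> where "\<beta> k = representation B (y k - real (T k) *\<^sub>R p)" for k
  have "(\<lambda>k. real (card {z \<in> B \<rightarrow>\<^sub>E (UNIV :: int set).
      p + (\<Sum>b\<in>B. ((of_int (z b) + \<beta> k b) / real (T k)) *\<^sub>R b) \<in> distinct_positive}) / real (T k) ^ card B)
    \<longlonglongrightarrow> measure (Pi\<^sub>M B (\<lambda>_. lborel)) {u \<in> B \<rightarrow>\<^sub>E UNIV. p + (\<Sum>b\<in>B. u b *\<^sub>R b) \<in> nonnegative}"
  proof (rule grid_count_limit[OF B_basis(2) open_distinct_positive _ closed_nonnegative null_nongeneric[OF generic]])
    show "distinct_positive \<subseteq> nonnegative" by (auto simp: less_imp_le)
    show "\<bar>u b\<bar> \<le> R" if "p + (\<Sum>b\<in>B. u b *\<^sub>R b) \<in> nonnegative" "b \<in> B" for u b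
      using R that by blast
    show "1 \<le> real (T k)" for k using T(1)[of k] by simp
    show "filterlim (\<lambda>k. real (T k)) at_top sequentially"
      using T(3) by (rule filterlim_compose[OF filterlim_real_sequentially])
  qed
  moreover have "{u \<in> B \<rightarrow>\<^sub>E UNIV. p + (\<Sum>b\<in>B. u b *\<^sub>R b) \<in> nonnegative} =
      {u \<in> B \<rightarrow>\<^sub>E UNIV. p + (\<Sum>b\<in>B. u b *\<^sub>R b) \<in> P}"
    using coordinates_in_s by (auto simp: P)
  ultimately show ?thesis
    using A_open_grid[OF T(1) y] B_basis(4) by (simp add: coordinate_volume_def \<beta>_def)
qed

end

text \<open>Steps that are multiples of a lattice height \<open>M\<close> preserve whether
  \<open>t\<close> is a lattice height. If it is, the limit is the volume; if not, all counts along
  the progression are 0.\<close>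

lemma A_open_leading_term:
  assumes generic: "\<forall>i j. i \<noteq> j \<longrightarrow> \<not> P \<subseteq> {x. x $ i = x $ j}"
    and Q: "quasipoly_le n Q" "\<And>t. t \<ge> 1 \<Longrightarrow> Q (int t) = real (A_open P t)"
  shows "has_leading_term Q (\<lambda>t. if lattice_height t then vol P else 0) n"
proof -
  obtain M where M: "M > 0" "lattice_height M" using ex_lattice_height by blast
  define B where "B = (SOME B. lattice_basis B (direction_lattice P))"
  define p where "p = (SOME p. p \<in> affine hull P)"
  have B: "lattice_basis B (integer_points \<inter> V)"
    using someI_ex[OF ex_lattice_basis[of "F ` {1..m}"]]
    by (simp add: B_def direction_lattice_P V_def)
  have "\<exists>p. p \<in> affine hull P" using ex_positive affine_hull_P by blast
  then have p: "p \<in> s" unfolding p_def affine_hull_P[symmetric] by (rule someI_ex)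
  have vol: "vol P = coordinate_volume B p P" by (simp add: vol_def B_def p_def)
  show ?thesis
  proof (rule has_leading_termI[OF Q(1) M(1)])
    fix t r :: int assume r: "r > 0"
    \<comment> \<open>The offset makes every argument at least 1, where \<open>Q\<close> agrees with
      the count; it does not affect the limit.\<close>
    define k0 where "k0 = nat (\<bar>t\<bar> + 1)"
    define T where "T k = nat (t + M * r * int (k + k0))" for k
    have Mr: "M * r \<ge> 1" using M(1) r by (simp add: int_one_le_iff_zero_less)
    have Tge: "t + M * r * int (k + k0) \<ge> 1 + int k" for k
    proof -
      have "M * r * int (k + k0) \<ge> 1 * int (k + k0)" using Mr by (intro mult_right_mono) auto
      then show ?thesis by (simp add: k0_def)
    qed
    have T: "int (T k) = t + M * r * int (k + k0)" "T k \<ge> Suc k" for k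
      using Tge[of k] by (simp_all add: T_def)
    have hT: "lattice_height (int (T k)) \<longleftrightarrow> lattice_height t" for k
      unfolding T using lattice_height_shift[OF lattice_height_scale[OF M(2)], of t "r * int (k + k0)"]
      by (simp add: mult.assoc)
    have "(\<lambda>k. real (A_open P (T k)) / real (T k) ^ n) \<longlonglongrightarrow> (if lattice_height t then vol P else 0)"
    proof (cases "lattice_height t")
      case True
      have "filterlim T at_top sequentially"
        using T(2) by (intro filterlim_at_top_mono[OF filterlim_Suc]) auto
      moreover have "T k \<ge> 1" for k using T(2)[of k] by simp
      ultimately show ?thesis
        using A_open_limit[OF B p generic, of T] True hT vol by simp
    next
      case False
      have "A_open P (T k) = 0" for k
      proof -
        have "T k > 0" using T(2)[of k] by simp
        have "integer_points \<inter> dilate (real (T k)) s = {}"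
          using False hT[of k] lattice_height_iff[of "int (T k)"] by simp
        then have "integer_points \<inter> dilate (real (T k)) P = {}" by (auto simp: dilate_def P)
        then show ?thesis by (simp add: A_open_def)
      qed
      then show ?thesis using False by simp
    qed
    moreover have "Q (t + M * r * int (k + k0)) / of_int (t + M * r * int (k + k0)) ^ n =
        real (A_open P (T k)) / real (T k) ^ n" for k
      unfolding T(1)[symmetric] using Q(2)[of "T k"] T(2)[of k] by simp
    ultimately have "(\<lambda>k. Q (t + M * r * int (k + k0)) / of_int (t + M * r * int (k + k0)) ^ n)
        \<longlonglongrightarrow> (if lattice_height t then vol P else 0)" by (simp only:)
    then show "(\<lambda>k. Q (t + M * r * int k) / of_int (t + M * r * int k) ^ n)
        \<longlonglongrightarrow> (if lattice_height t then vol P else 0)"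
      by (rule LIMSEQ_offset)
  qed
qed

end

theorem theorem3p14:
  fixes f :: "nat \<Rightarrow> real ^ 'n::{finite,linorder} \<Rightarrow> real" and m :: nat
    and s P :: "(real ^ 'n::{finite,linorder}) set"
  assumes forms: "\<And>i. i \<in> {1..m} \<Longrightarrow> rational_linear_form (f i)"
    and appear: "\<And>j. \<exists>i\<in>{1..m}. appears_in j (f i)"
    and s: "s = {x. \<forall>i\<in>{1..m}. f i x = 1}"
    and consistent: "s \<noteq> {}"
    and P: "P = s \<inter> {x. \<forall>j. 0 \<le> x $ j}"
    and bounded: "bounded P"
    and not_coord: "\<And>j. \<not> P \<subseteq> {x. x $ j = 0}"
  shows "\<exists>Qo Q :: int \<Rightarrow> real.
    quasipolynomial Qo \<and> (\<forall>t\<ge>1. Qo (int t) = real (A_open P t)) \<and>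
    quasipolynomial Q \<and> (\<forall>t\<ge>1. Q (int t) = real (A_closed P t)) \<and>
    ((\<forall>i j. i \<noteq> j \<longrightarrow> \<not> P \<subseteq> {x. x $ i = x $ j}) \<longrightarrow>
      (let L = (\<lambda>t. if integer_points \<inter> dilate (of_int t) s \<noteq> {} then vol P else 0) in
        has_leading_term Qo L (nat (aff_dim s)) \<and> has_leading_term Q L (nat (aff_dim s)))) \<and>
    Q 0 = real (card {\<tau>. \<tau> permutes UNIV \<and> realizable_in \<tau> (rel_interior P)}) \<and>
    (\<forall>t. (-1) ^ nat (aff_dim s) * Qo (- t) = Q t)"
proof -
  \<comment> \<open>Any variable appears in some form, so there is a form to serve as the
    height.\<close>
  have "m \<ge> 1" using appear[of undefined] by auto
  interpret rational_forms f m s P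
    by standard (fact forms \<open>m \<ge> 1\<close> s P bounded not_coord)+
  obtain Q where Q: "quasipoly_le n Q" "\<forall>t\<ge>1. Q (int t) = real (A_closed P t)"
    "\<forall>t\<ge>1. (-1) ^ n * Q (- int t) = real (A_open P t)" "Q 0 = real (card realizable)"
    using ex_quasipolynomials by blast
  \<comment> \<open>The open quasipolynomial is defined by reciprocity; \<open>Q(3)\<close> says
    that it gives the open counts for positive \<open>t\<close>.\<close>
  define Qo where "Qo t = (-1) ^ n * Q (- t)" for t
  have Qo: "quasipoly_le n Qo" unfolding Qo_def using Q(1) by (rule quasipoly_le_cmult_reflect)
  have sgn: "(-1) ^ n * ((-1) ^ n * x) = x" for x :: real
    by (simp flip: mult.assoc power_mult_distrib)
  have rec: "(-1) ^ n * Qo (- t) = Q t" for t by (simp add: Qo_def sgn)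
  define L where "L t = (if lattice_height t then vol P else 0)" for t
  have lead: "has_leading_term Qo L n \<and> has_leading_term Q L n"
    if generic: "\<forall>i j. i \<noteq> j \<longrightarrow> \<not> P \<subseteq> {x. x $ i = x $ j}"
  proof -
    have "has_leading_term Qo L n"
      unfolding L_def using generic Qo Q(3) by (intro A_open_leading_term) (auto simp: Qo_def)
    \<comment> \<open>Lattice heights are symmetric under negation, so \<open>L\<close> is
      even.\<close>
    moreover from this have "has_leading_term (\<lambda>t. (-1) ^ n * Qo (- t)) L n"
      by (rule has_leading_term_reflect) (simp add: L_def lattice_height_uminus)
    ultimately show ?thesis by (simp add: rec)
  qed
  have L: "L = (\<lambda>t. if integer_points \<inter> dilate (of_int t) s \<noteq> {} then vol P else 0)"
    by (simp add: L_def fun_eq_iff lattice_height_iff)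
  show ?thesis
  proof (rule exI[of _ Qo], rule exI[of _ Q], intro conjI)
    show "quasipolynomial Qo" "quasipolynomial Q"
      using Qo Q(1) quasipolynomial_iff by blast+
    show "\<forall>t\<ge>1. Qo (int t) = real (A_open P t)" using Q(3) by (simp add: Qo_def)
    show "\<forall>t\<ge>1. Q (int t) = real (A_closed P t)" by (rule Q(2))
    show "(\<forall>i j. i \<noteq> j \<longrightarrow> \<not> P \<subseteq> {x. x $ i = x $ j}) \<longrightarrow>
      (let L = (\<lambda>t. if integer_points \<inter> dilate (of_int t) s \<noteq> {} then vol P else 0) in
        has_leading_term Qo L (nat (aff_dim s)) \<and> has_leading_term Q L (nat (aff_dim s)))"
      unfolding Let_def aff_dim_s L[symmetric] using lead by blast
    show "Q 0 = real (card {\<tau>. \<tau> permutes UNIV \<and> realizable_in \<tau> (rel_interior P)})"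
      using Q(4) by (simp add: realizable_def)
    show "\<forall>t. (-1) ^ nat (aff_dim s) * Qo (- t) = Q t"
      unfolding aff_dim_s using rec by blast
  qed
qed

end
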